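(* Let $\beta\in(0,1)$ be fixed and let $x>0$ be given. Define \[ \mathscr{M}(T,x)=\mathrm{meas}\Big\{t\in[T^{\beta},T]:\ -\mathrm{Re}\,\frac{\zeta'}{\zeta}(1+{\rm i}t)\ \ge\ \log\log T+\log\log\log T+C_1-x\Big\}, \] where $C_1=\log(1-\beta)-\log\log 4-\gamma-\sum_{k=2}^{\infty}\sum_{p}\frac{\log p}{p^k}-1$. Then \[ \mathscr{M}(T,x)\ \ge\ T^{\,1-(1-\beta)e^{-x}+o(1)}\qquad\text{as } T\to\infty. \]
   Context: $\zeta$ is the Riemann zeta function, $\gamma$ is the Euler–Mascheroni constant, $p$ runs over primes, and $\mathrm{meas}$ denotes Lebesgue measure. *)

theory Defs
  imports "HOL-Complex_Analysis.Complex_Analysis"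
begin

section \<open>The Riemann zeta function\<close>

text \<open>
  The analytic continuation of the Dirichlet series to the punctured plane. It exists and is unique
  away from 1 (see the lemmas below); the value at the pole 1 is arbitrary.
\<close>

definition is_zeta_continuation :: "(complex \<Rightarrow> complex) \<Rightarrow> bool" where
  "is_zeta_continuation f \<longleftrightarrow>
     f holomorphic_on (- {1}) \<and>
     (\<forall>s. Re s > 1 \<longrightarrow> f s = (\<Sum>n. 1 / of_nat (Suc n) powr s))"

definition zeta :: "complex \<Rightarrow> complex" where
  "zeta = (SOME f. is_zeta_continuation f)"


subsection \<open>Existence and uniqueness of the continuation\<close>

text \<open>
  Expanding (n + 1) powr (1 - w) around n by Taylor's formula and summing over n expresses
  (w - 1) * zeta w through values of zeta further to the right plus a remainder series that converges
  in a larger half-plane; iterating this continues the function one unit to the left at a time.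
\<close>

lemma holomorphic_on_suminf:
  fixes g :: "nat \<Rightarrow> complex \<Rightarrow> complex"
  assumes "open S" and hol: "\<And>n. g n holomorphic_on S"
    and bnd: "\<And>x. x \<in> S \<Longrightarrow> \<exists>d>0. cball x d \<subseteq> S \<and>
                 (\<exists>M. summable M \<and> (\<forall>n. \<forall>y\<in>cball x d. norm (g n y) \<le> M n))"
  shows "(\<lambda>x. \<Sum>n. g n x) holomorphic_on S"
proof (rule holomorphic_uniform_sequence[OF \<open>open S\<close>])
  show "(\<lambda>x. \<Sum>i<n. g i x) holomorphic_on S" for n
    by (intro holomorphic_on_sum hol)
next
  fix x assume "x \<in> S"
  from bnd[OF this] obtain d M where d: "d > 0" "cball x d \<subseteq> S" and M: "summable M"
    and le: "\<forall>n. \<forall>y\<in>cball x d. norm (g n y) \<le> M n"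
    by (elim exE conjE)
  have "uniform_limit (cball x d) (\<lambda>n x. \<Sum>i<n. g i x) (\<lambda>x. suminf (\<lambda>i. g i x)) sequentially"
    by (rule Weierstrass_m_test[OF _ M]) (use le in auto)
  with d show "\<exists>d>0. cball x d \<subseteq> S \<and> uniform_limit (cball x d) (\<lambda>n x. \<Sum>i<n. g i x)
                 (\<lambda>x. suminf (\<lambda>i. g i x)) sequentially"
    by blast
qed

lemma norm_nat_powr: "norm ((of_nat (Suc n) :: complex) powr w) = real (Suc n) powr Re w"
  by (subst norm_powr_real_powr) auto

lemma summable_nat_powr:
  assumes "c < -1"
  shows "summable (\<lambda>n. real (Suc n) powr c)"
  using assms by (subst summable_Suc_iff) (simp add: summable_real_powr_iff)

lemma summable_zeta:
  assumes "Re w > 1"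
  shows "summable (\<lambda>n. (of_nat (Suc n) :: complex) powr (-w))"
  by (rule summable_norm_cancel) (use assms summable_nat_powr[of "- Re w"] in \<open>simp add: norm_nat_powr del: of_nat_Suc\<close>)

lemma holomorphic_zeta_series:
  "(\<lambda>w. \<Sum>n. (of_nat (Suc n) :: complex) powr (-w)) holomorphic_on {w. Re w > 1}"
proof (rule holomorphic_on_suminf)
  show "open {w. Re w > 1}" by (rule open_halfspace_Re_gt)
  show "(\<lambda>w. (of_nat (Suc n) :: complex) powr (-w)) holomorphic_on {w. Re w > 1}" for n
    by (intro holomorphic_intros)
next
  fix x :: complex assume x: "x \<in> {w. Re w > 1}"
  define d where "d = (Re x - 1) / 2"
  have d: "d > 0" using x by (simp add: d_def)
  have Re: "Re y \<ge> 1 + d" if "y \<in> cball x d" for y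
    using abs_Re_le_cmod[of "x - y"] that by (simp add: dist_norm d_def field_simps)
  have "norm ((of_nat (Suc n) :: complex) powr (-y)) \<le> real (Suc n) powr (- (1 + d))"
    if "y \<in> cball x d" for n y
    unfolding norm_nat_powr using Re[OF that] by (intro powr_mono) auto
  moreover have "summable (\<lambda>n. real (Suc n) powr (- (1 + d)))"
    using d by (intro summable_nat_powr) auto
  moreover have "cball x d \<subseteq> {w. Re w > 1}" using Re d by force
  ultimately show "\<exists>d>0. cball x d \<subseteq> {w. Re w > 1} \<and>
      (\<exists>M. summable M \<and> (\<forall>n. \<forall>y\<in>cball x d. norm ((of_nat (Suc n) :: complex) powr (-y)) \<le> M n))"
    using d by blast
qed

definition zeta_rem :: "nat \<Rightarrow> nat \<Rightarrow> complex \<Rightarrow> complex" where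
  "zeta_rem k m w = of_nat (Suc (Suc m)) powr (1 - w) -
     (\<Sum>j\<le>Suc k. ((1 - w) gchoose j) * of_nat (Suc m) powr (1 - w - of_nat j))"

lemma zeta_rem_bound:
  assumes "Re w > - real k"
  shows "norm (zeta_rem k m w) \<le>
           norm (\<Prod>l<Suc (Suc k). 1 - w - of_nat l) * real (Suc m) powr (- 1 - real k - Re w)"
proof -
  define a where "a = 1 - w"
  define c where "c = (\<lambda>i. \<Prod>l<i. a - of_nat l)"
  define f where "f = (\<lambda>i z. c i * z powr (a - of_nat i))"
  define S where "S = closed_segment (of_nat (Suc m)) (of_nat (Suc (Suc m)) :: complex)"
  have S: "z \<notin> \<real>\<^sub>\<le>\<^sub>0" "norm z \<ge> real (Suc m)" "z \<in> \<real>" "Re z > 0" if "z \<in> S" for z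
  proof -
    from that obtain u where u: "u \<ge> 0" "z = of_real (real (Suc m) + u)"
      unfolding S_def closed_segment_def by (auto simp: algebra_simps scaleR_conv_of_real)
    show "z \<notin> \<real>\<^sub>\<le>\<^sub>0" unfolding u(2) using u(1) by (subst nonpos_Reals_of_real_iff) auto
    show "norm z \<ge> real (Suc m)" unfolding u(2) norm_of_real using u(1) by linarith
    show "z \<in> \<real>" unfolding u(2) by (rule Reals_of_real)
    show "Re z > 0" unfolding u(2) using u(1) by simp
  qed
  define B where "B = norm (c (Suc (Suc k))) * real (Suc m) powr (- 1 - real k - Re w)"
  have "norm (f 0 (of_nat (Suc (Suc m))) - (\<Sum>i\<le>Suc k. f i (of_nat (Suc m)) *
          (of_nat (Suc (Suc m)) - of_nat (Suc m)) ^ i / fact i))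
        \<le> B * norm ((of_nat (Suc (Suc m)) :: complex) - of_nat (Suc m)) ^ Suc (Suc k) / fact (Suc k)"
  proof (rule complex_Taylor[of S])
    show "convex S" unfolding S_def by (rule convex_closed_segment)
    show "(of_nat (Suc m) :: complex) \<in> S" "(of_nat (Suc (Suc m)) :: complex) \<in> S"
      unfolding S_def by (rule ends_in_segment)+
    fix x assume x: "x \<in> S"
    show "(f i has_field_derivative f (Suc i) x) (at x within S)" for i
      unfolding f_def c_def using S[OF x]
      by (auto intro!: derivative_eq_intros simp: algebra_simps)
    have "norm (x powr (a - of_nat (Suc (Suc k)))) = norm x powr (- 1 - real k - Re w)"
      using S[OF x] by (subst norm_powr_real_powr) (auto simp: a_def algebra_simps elim!: Reals_cases)
    also have "\<dots> \<le> real (Suc m) powr (- 1 - real k - Re w)"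
      using S[OF x] assms by (intro powr_mono2') auto
    finally show "norm (f (Suc (Suc k)) x) \<le> B"
      unfolding f_def B_def norm_mult by (rule mult_left_mono) auto
  qed
  moreover have "f i z / fact i = (a gchoose i) * z powr (a - of_nat i)" for i z
    by (simp add: f_def c_def gbinomial_prod_rev atLeast0LessThan)
  ultimately have "norm (zeta_rem k m w) \<le> B / fact (Suc k)"
    by (simp add: zeta_rem_def a_def f_def c_def gbinomial_prod_rev atLeast0LessThan)
  also have "\<dots> \<le> B / 1"
    by (rule divide_left_mono) (auto simp: B_def fact_ge_1 simp del: fact_Suc)
  finally show ?thesis by (simp add: B_def c_def a_def)
qed

lemma holomorphic_gchoose [holomorphic_intros]:
  "f holomorphic_on S \<Longrightarrow> (\<lambda>w. f w gchoose j) holomorphic_on S"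
  unfolding gbinomial_prod_rev by (intro holomorphic_intros) auto

lemma holomorphic_zeta_rem: "zeta_rem k m holomorphic_on S"
  unfolding zeta_rem_def by (intro holomorphic_intros) (auto simp del: of_nat_Suc)

lemma zeta_rem_locally_bounded:
  assumes x: "Re x > - real k"
  shows "\<exists>d>0. cball x d \<subseteq> {w. Re w > - real k} \<and>
           (\<exists>M. summable M \<and> (\<forall>m. \<forall>y\<in>cball x d. norm (zeta_rem k m y) \<le> M m))"
proof -
  define d where "d = (Re x + real k) / 2"
  have d: "d > 0" using x by (simp add: d_def)
  have Re: "Re y \<ge> d - real k" if "y \<in> cball x d" for y
    using abs_Re_le_cmod[of "x - y"] that by (simp add: dist_norm d_def field_simps)
  define p where "p = (\<lambda>w::complex. \<Prod>l<Suc (Suc k). 1 - w - of_nat l)"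
  have "compact (p ` cball x d)"
    unfolding p_def by (intro compact_continuous_image continuous_intros) auto
  then obtain C where C: "\<And>y. y \<in> cball x d \<Longrightarrow> norm (p y) \<le> C"
    by (meson bounded_iff compact_imp_bounded imageI)
  have C0: "C \<ge> 0" using C[of x] d norm_ge_zero[of "p x"] by (simp del: norm_ge_zero)
  have "norm (zeta_rem k m y) \<le> C * real (Suc m) powr (- 1 - d)" if y: "y \<in> cball x d" for m y
  proof -
    have "norm (zeta_rem k m y) \<le> norm (p y) * real (Suc m) powr (- 1 - real k - Re y)"
      unfolding p_def using Re[OF y] d by (intro zeta_rem_bound) auto
    also have "\<dots> \<le> C * real (Suc m) powr (- 1 - d)"
      using C[OF y] C0 Re[OF y] by (intro mult_mono powr_mono) auto
    finally show ?thesis .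
  qed
  moreover have "summable (\<lambda>m. C * real (Suc m) powr (- 1 - d))"
    using d by (intro summable_mult summable_nat_powr) auto
  moreover have "cball x d \<subseteq> {w. Re w > - real k}" using Re d by force
  ultimately show ?thesis using d by blast
qed

lemma holomorphic_suminf_zeta_rem:
  "(\<lambda>w. \<Sum>m. zeta_rem k m w) holomorphic_on {w. Re w > - real k}"
proof (rule holomorphic_on_suminf)
  show "open {w. Re w > - real k}" by (rule open_halfspace_Re_gt)
qed (use holomorphic_zeta_rem zeta_rem_locally_bounded in auto)

lemma zeta_series_recurrence:
  fixes w :: complex
  assumes w: "Re w > 1"
  defines "Z \<equiv> (\<lambda>w::complex. \<Sum>n. (of_nat (Suc n) :: complex) powr (-w))"
  shows "(w - 1) * Z w = 1 + (\<Sum>m. zeta_rem k m w) -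
           (\<Sum>i<k. ((1 - w) gchoose Suc i) / of_nat (i + 2) * ((w + of_nat i) * Z (w + of_nat (Suc i))))"
proof -
  define q where "q = (\<lambda>n. (of_nat (Suc n) :: complex) powr (1 - w))"
  have "(\<lambda>n. real (Suc n) powr (1 - Re w)) \<longlonglongrightarrow> 0"
    using w by (intro tendsto_neg_powr filterlim_compose[OF filterlim_real_sequentially filterlim_Suc]) auto
  hence "q \<longlonglongrightarrow> 0"
    by (subst tendsto_norm_zero_iff [symmetric]) (simp add: q_def norm_nat_powr del: of_nat_Suc)
  hence "(\<lambda>n. q (Suc n) - q n) sums (0 - q 0)" by (rule telescope_sums)
  hence A: "(\<lambda>n. q (Suc n) - q n) sums (-1)" by (simp add: q_def)
  have B: "(\<lambda>n. (of_nat (Suc n) :: complex) powr (1 - w - of_nat (Suc j))) sums Z (w + of_nat j)" for j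
  proof -
    have "summable (\<lambda>n. (of_nat (Suc n) :: complex) powr (- (w + of_nat j)))"
      using w by (intro summable_zeta) auto
    from summable_sums[OF this] show ?thesis by (simp add: Z_def algebra_simps)
  qed
  have "(\<lambda>m. (q (Suc m) - q m) - (\<Sum>j\<le>k. ((1 - w) gchoose Suc j) *
           (of_nat (Suc m) powr (1 - w - of_nat (Suc j))))) sums
         (-1 - (\<Sum>j\<le>k. ((1 - w) gchoose Suc j) * Z (w + of_nat j)))"
    by (intro sums_diff A sums_sum sums_mult B)
  also have "(\<lambda>m. (q (Suc m) - q m) - (\<Sum>j\<le>k. ((1 - w) gchoose Suc j) *
           (of_nat (Suc m) powr (1 - w - of_nat (Suc j))))) = (\<lambda>m. zeta_rem k m w)"
    unfolding zeta_rem_def q_def by (subst sum.atMost_Suc_shift) (simp add: fun_eq_iff)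
  finally have R: "(\<Sum>m. zeta_rem k m w) = -1 - (\<Sum>j\<le>k. ((1 - w) gchoose Suc j) * Z (w + of_nat j))"
    by (rule sums_unique [symmetric])
  have "(\<Sum>j\<le>k. ((1 - w) gchoose Suc j) * Z (w + of_nat j)) =
        (1 - w) * Z w + (\<Sum>i<k. ((1 - w) gchoose Suc (Suc i)) * Z (w + of_nat (Suc i)))"
    by (subst sum.atMost_shift) simp
  also have "(\<Sum>i<k. ((1 - w) gchoose Suc (Suc i)) * Z (w + of_nat (Suc i))) =
     - (\<Sum>i<k. ((1 - w) gchoose Suc i) / of_nat (i + 2) * ((w + of_nat i) * Z (w + of_nat (Suc i))))"
    unfolding sum_negf [symmetric]
  proof (rule sum.cong)
    fix i
    have "of_nat (Suc (Suc i)) * ((1 - w) gchoose Suc (Suc i)) =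
          ((1 - w) - of_nat (Suc i)) * ((1 - w) gchoose Suc i)"
      by (metis gbinomial_absorb_comp gbinomial_absorption)
    moreover have nz: "of_nat i + 2 \<noteq> (0 :: complex)"
      using of_nat_neq_0[of "Suc i", where 'a = complex] by (simp add: add.commute)
    ultimately have *: "((1 - w) gchoose Suc (Suc i)) =
          - (((1 - w) gchoose Suc i) / of_nat (i + 2) * (w + of_nat i))"
      using nz by (simp add: field_simps del: gbinomial_Suc_Suc)
    show "((1 - w) gchoose Suc (Suc i)) * Z (w + of_nat (Suc i)) =
      - (((1 - w) gchoose Suc i) / of_nat (i + 2) * ((w + of_nat i) * Z (w + of_nat (Suc i))))"
      unfolding * by (simp only: mult_minus_left mult.assoc)
  qed auto
  finally show ?thesis unfolding R by (simp add: algebra_simps)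
qed

lemma zeta_continuation_halfplane:
  "\<exists>h. h holomorphic_on {w. Re w > 1 - real k} \<and>
     (\<forall>w. Re w > 1 \<longrightarrow> h w = (w - 1) * (\<Sum>n. (of_nat (Suc n) :: complex) powr (-w)))"
proof (induction k)
  case 0
  have "(\<lambda>w. (w - 1) * (\<Sum>n. (of_nat (Suc n) :: complex) powr (-w))) holomorphic_on {w. Re w > 1}"
    by (intro holomorphic_intros holomorphic_zeta_series)
  thus ?case by (intro exI[of _ "\<lambda>w. (w - 1) * (\<Sum>n. (of_nat (Suc n) :: complex) powr (-w))"]) auto
next
  case (Suc k)
  then obtain h where h: "h holomorphic_on {w. Re w > 1 - real k}"
    and eq: "\<And>w. Re w > 1 \<Longrightarrow> h w = (w - 1) * (\<Sum>n. (of_nat (Suc n) :: complex) powr (-w))"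
    by blast
  define g where "g = (\<lambda>w. 1 + (\<Sum>m. zeta_rem k m w) -
    (\<Sum>i<k. ((1 - w) gchoose Suc i) / of_nat (i + 2) * h (w + of_nat (Suc i))))"
  have "(\<lambda>w. h (w + of_nat (Suc i))) holomorphic_on {w. Re w > - real k}" for i
    by (rule holomorphic_on_compose_gen[OF _ h, unfolded o_def]) (auto intro!: holomorphic_intros)
  hence "g holomorphic_on {w. Re w > - real k}"
    unfolding g_def by (intro holomorphic_intros holomorphic_suminf_zeta_rem) auto
  moreover have "g w = (w - 1) * (\<Sum>n. (of_nat (Suc n) :: complex) powr (-w))" if w: "Re w > 1" for w
  proof -
    have "h (w + of_nat (Suc i)) =
        (w + of_nat i) * (\<Sum>n. (of_nat (Suc n) :: complex) powr (- (w + of_nat (Suc i))))" for i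
      using w by (subst eq) auto
    thus ?thesis unfolding zeta_series_recurrence[OF w, of k] g_def by simp
  qed
  ultimately show ?case by (intro exI[of _ g]) auto
qed

lemma zeta_continuation_exists: "\<exists>f. is_zeta_continuation f"
proof -
  define D where "D = (\<lambda>k. {w. Re w > 1 - real k})"
  define Z where "Z = (\<lambda>w::complex. \<Sum>n. (of_nat (Suc n) :: complex) powr (-w))"
  have op: "open (D k)" for k unfolding D_def by (rule open_halfspace_Re_gt)
  have conn: "connected (D k)" for k
    unfolding D_def by (intro convex_connected convex_halfspace_Re_gt)
  obtain h where hol: "\<And>k. h k holomorphic_on D k"
    and eq: "\<And>k w. Re w > 1 \<Longrightarrow> h k w = (w - 1) * Z w"
    unfolding D_def Z_def using zeta_continuation_halfplane by metis
  have mono: "h k w = h l w" if "k \<le> l" "w \<in> D k" for k l w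
  proof (rule analytic_continuation_open[of "D 0" "D k" "h k" "h l"])
    show "h l holomorphic_on D k"
      using hol[of l] by (rule holomorphic_on_subset) (use that in \<open>auto simp: D_def\<close>)
    show "D 0 \<noteq> {}" by (auto simp: D_def intro!: exI[of _ 2])
    show "h k z = h l z" if "z \<in> D 0" for z
      using that by (simp add: D_def eq)
    show "D 0 \<subseteq> D k" by (auto simp: D_def)
  qed (use op conn hol that in blast)+
  define K where "K = (\<lambda>w. nat \<lceil>1 - Re w\<rceil> + 1)"
  have K: "w \<in> D (K w)" for w unfolding D_def K_def by (simp, linarith)
  define F where "F = (\<lambda>w. h (K w) w)"
  have F: "F w = h k w" if "w \<in> D k" for k w
    unfolding F_def using mono[of k "K w" w] mono[of "K w" k w] K[of w] that by (metis linear)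
  have "F holomorphic_on (\<Union>k. D k)"
  proof (rule holomorphic_on_UN_open)
    show "F holomorphic_on D k" for k using hol[of k] F by (subst holomorphic_cong) auto
  qed (rule op)
  hence "F holomorphic_on (- {1})" by (rule holomorphic_on_subset) (use K in blast)
  hence "(\<lambda>w. F w / (w - 1)) holomorphic_on (- {1})" by (intro holomorphic_intros) auto
  moreover have "F w / (w - 1) = (\<Sum>n. 1 / of_nat (Suc n) powr w)" if "Re w > 1" for w
  proof -
    have "F w = (w - 1) * Z w" using F[of w 0] eq[of w 0] that by (simp add: D_def)
    moreover have "w \<noteq> 1" using that by auto
    ultimately show ?thesis
      by (simp add: Z_def powr_minus divide_inverse del: of_nat_Suc)
  qed
  ultimately show ?thesis unfolding is_zeta_continuation_def by blast
qed

lemma zeta_continuation_unique: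
  assumes f: "is_zeta_continuation f" and g: "is_zeta_continuation g" and "s \<noteq> 1"
  shows "f s = g s"
proof (rule analytic_continuation_open[of "{s. Re s > 1}" "- {1}" f g])
  show "open {s::complex. Re s > 1}" by (rule open_halfspace_Re_gt)
  show "{s. Re s > 1} \<noteq> {}" by (auto intro!: exI[of _ 2])
  show "connected (- {1::complex})"
    by (rule connected_punctured_universe) auto
  show "{s. Re s > 1} \<subseteq> - {1}" by auto
  show "open (- {1::complex})" by (rule open_Compl) auto
  show "f z = g z" if "z \<in> {s. Re s > 1}" for z
    using f g that unfolding is_zeta_continuation_def by (metis mem_Collect_eq)
qed (use assms in \<open>simp_all add: is_zeta_continuation_def\<close>)

lemma is_zeta_continuation_zeta: "is_zeta_continuation zeta"
  unfolding zeta_def using zeta_continuation_exists by (rule someI_ex)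

lemma holomorphic_zeta: "zeta holomorphic_on (- {1})"
  using is_zeta_continuation_zeta by (simp add: is_zeta_continuation_def)

lemma zeta_eq_series: "Re s > 1 \<Longrightarrow> zeta s = (\<Sum>n. 1 / of_nat (Suc n) powr s)"
  using is_zeta_continuation_zeta by (simp add: is_zeta_continuation_def)


section \<open>Large values of the logarithmic derivative on the 1-line\<close>

definition C1 :: "real \<Rightarrow> real" where
  "C1 \<beta> = ln (1 - \<beta>) - ln (ln 4) - euler_mascheroni
            - (\<Sum>\<^sub>\<infinity>k\<in>{2..}. \<Sum>\<^sub>\<infinity>p\<in>{p::nat. prime p}. ln (real p) / real p ^ k) - 1"

definition large_set :: "real \<Rightarrow> real \<Rightarrow> real \<Rightarrow> real set" where
  "large_set \<beta> T x = {t \<in> {T powr \<beta>..T}.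
     - Re (deriv zeta (1 + \<i> * of_real t) / zeta (1 + \<i> * of_real t))
       \<ge> ln (ln T) + ln (ln (ln T)) + C1 \<beta> - x}"

definition large_meas :: "real \<Rightarrow> real \<Rightarrow> real \<Rightarrow> real" where
  "large_meas \<beta> T x = measure lebesgue (large_set \<beta> T x)"

end

theory Submission
  imports Defs "HOL-Number_Theory.Number_Theory" "HOL-Real_Asymp.Real_Asymp"
begin

text \<open>
  Resonance method. A nonnegative trigonometric polynomial \<open>f\<close> with nonnegative cosine
  coefficients is integrated against \<open>-Re (\<zeta>'/\<zeta>)\<close> and the weight \<open>1 - t/T\<close>, whose cosine transform is
  nonnegative. On \<open>Re s = \<sigma> > 1\<close> the Dirichlet series of \<open>-\<zeta>'/\<zeta>\<close> has nonnegative coefficients, so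
  all but finitely many of its terms can be dropped; letting \<open>\<sigma>\<close> tend to 1 costs only
  \<open>(\<pi>/2) f(0)\<close> because of the pole, and no information on zeros off the 1-line is needed.

  For \<open>f\<close> take a product over primes \<open>p \<le> N\<close> of Fejer kernels of length \<open>J = \<lfloor>N/p\<rfloor>\<close> in \<open>t log p\<close>.
  Against such a kernel \<open>cos (k t log p)\<close> counts at least as \<open>1 - k/J\<close>, so the weighted mean of
  \<open>-Re (\<zeta>'/\<zeta>)\<close> is at least the sum of \<open>(\<Lambda>(n)/n) (1 - 1/\<lfloor>N/n\<rfloor>)\<close> over \<open>n \<le> N\<close>, which exceeds
  \<open>(log N! - \<psi>(N))/N\<close>. Its maximum relative to its mean is the product of the \<open>\<lfloor>N/p\<rfloor>\<close>, which
  Chebyshev's bound controls. Because prime powers contribute to the mean but are subtracted in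
  the constant \<open>C1\<close>, Chebyshev's bound suffices in place of the prime number theorem.

  On \<open>[0, T]\<close> the function \<open>-Re (\<zeta>'/\<zeta>)\<close> is at most a small power of \<open>T\<close>, by the inequality
  \<open>3 + 4 cos x + cos 2x \<ge> 0\<close>. Hence the mean can only be large if the set of large values has
  measure at least \<open>T/f(0)\<close> up to such a power.
\<close>

section \<open>Chebyshev bounds\<close>

definition psi :: "nat \<Rightarrow> real" where
  "psi n = (\<Sum>d=1..n. mangoldt d)"

lemma psi_nonneg: "psi n \<ge> 0"
  unfolding psi_def by (intro sum_nonneg mangoldt_nonneg)

lemma psi_mono: "m \<le> n \<Longrightarrow> psi m \<le> psi n"
  unfolding psi_def by (intro sum_mono2 mangoldt_nonneg) auto

text \<open>Passing from \<open>n\<close> to \<open>Suc n\<close> raises \<open>n div d\<close> by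
  one exactly when \<open>d\<close> divides \<open>Suc n\<close>, and the von Mangoldt function sums
  to the logarithm over the divisors.\<close>

lemma ln_fact_eq_sum_mangoldt:
  "ln (fact n) = (\<Sum>d=1..n. mangoldt d * real (n div d))"
proof (induction n)
  case (Suc n)
  have range: "d \<in> {1..Suc n}" if "d dvd Suc n" for d
    using that dvd_imp_le[of d "Suc n"] by (cases "d = 0") auto
  have "ln (fact (Suc n) :: real) = ln (real (Suc n)) + ln (fact n)"
    unfolding fact_Suc by (subst ln_mult) auto
  also have "ln (real (Suc n)) = (\<Sum>d | d dvd Suc n. mangoldt d)"
    using mangoldt_sum[of "Suc n", where 'a = real] by simp
  also have "\<dots> = (\<Sum>d=1..Suc n. if d dvd Suc n then mangoldt d else 0)"
    using range
    by (intro sum.mono_neutral_cong_left) (auto simp del: One_nat_def)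
  also have "ln (fact n) = (\<Sum>d=1..Suc n. mangoldt d * real (n div d))"
    using Suc.IH by simp
  finally have "ln (fact (Suc n)) = (\<Sum>d=1..Suc n. (if d dvd Suc n then mangoldt d else 0) + mangoldt d * real (n div d))"
    by (simp only: sum.distrib)
  also have "\<dots> = (\<Sum>d=1..Suc n. mangoldt d * real (Suc n div d))"
  proof (rule sum.cong)
    fix d assume "d \<in> {1..Suc n}"
    have "Suc n div d = (if d dvd Suc n then 1 else 0) + n div d"
      by (auto simp: div_Suc dvd_eq_mod_eq_0)
    thus "(if d dvd Suc n then mangoldt d else 0) + mangoldt d * real (n div d) = mangoldt d * real (Suc n div d)"
      by (simp add: algebra_simps)
  qed simp
  finally show ?case .
qed auto

text \<open>Nested floors commute, and the terms with \<open>d > n div k\<close> vanish. Extending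
  all sums to the same range \<open>1..n\<close> lets combinations of factorials be compared term by
  term.\<close>

lemma ln_fact_div_eq_sum_mangoldt:
  assumes "k > 0"
  shows "ln (fact (n div k)) = (\<Sum>d=1..n. mangoldt d * real (n div d div k))"
proof -
  have "ln (fact (n div k)) = (\<Sum>d=1..n div k. mangoldt d * real (n div d div k))"
    unfolding ln_fact_eq_sum_mangoldt by (simp add: div_mult2_eq [symmetric] mult.commute)
  also have "\<dots> = (\<Sum>d=1..n. mangoldt d * real (n div d div k))"
  proof (intro sum.mono_neutral_left ballI)
    fix d assume d: "d \<in> {1..n} - {1..n div k}"
    hence "n div k < d" by auto
    hence "n div k div d = 0" by simp
    hence "n div d div k = 0" by (metis div_mult2_eq mult.commute)
    thus "mangoldt d * real (n div d div k) = 0" by simp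
  qed (auto intro: order.trans[OF _ div_le_dividend])
  finally show ?thesis .
qed

text \<open>A crude form of Stirling's formula: the induction step only needs
  \<open>ln (n + 1) - ln n \<ge> 1 / (n + 1)\<close>. The lower bound below uses
  \<open>ln (n + 1) - ln n \<le> 1 / n\<close> in the same way.\<close>

lemma ln_fact_upper:
  assumes "n \<ge> 1"
  shows "ln (fact n) \<le> real n * ln n - n + ln n + 1"
  using assms
proof (induction n rule: dec_induct)
  case (step n)
  have "ln (real n / real (Suc n)) \<le> real n / real (Suc n) - 1"
    using step by (intro ln_le_minus_one) auto
  hence "ln (real (Suc n)) - ln (real n) \<ge> 1 / real (Suc n)"
    using step by (simp add: ln_div field_simps)
  hence "(real n + 1) * (ln (real (Suc n)) - ln (real n)) \<ge> (real n + 1) * (1 / real (Suc n))"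
    by (intro mult_left_mono) auto
  hence *: "(real n + 1) * (ln (real (Suc n)) - ln (real n)) \<ge> 1"
    by (simp add: field_simps)
  have "ln (fact (Suc n) :: real) = ln (real (Suc n)) + ln (fact n)"
    unfolding fact_Suc by (subst ln_mult) auto
  also have "\<dots> \<le> ln (real (Suc n)) + (real n * ln n - n + ln n + 1)"
    using step by simp
  also have "\<dots> \<le> real (Suc n) * ln (Suc n) - Suc n + ln (Suc n) + 1"
    using * by (simp add: algebra_simps)
  finally show ?case .
qed auto

lemma ln_fact_lower: "ln (fact n) \<ge> real n * ln n - n"
proof (induction n)
  case (Suc n)
  show ?case
  proof (cases "n = 0")
    case False
    have "ln (real (Suc n) / real n) \<le> real (Suc n) / real n - 1"
      using False by (intro ln_le_minus_one) auto
    hence "ln (real (Suc n)) - ln (real n) \<le> 1 / real n"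
      using False by (simp add: ln_div field_simps)
    hence "real n * (ln (real (Suc n)) - ln (real n)) \<le> real n * (1 / real n)"
      by (intro mult_left_mono) auto
    hence *: "real n * (ln (real (Suc n)) - ln (real n)) \<le> 1"
      using False by simp
    have "ln (fact (Suc n) :: real) = ln (real (Suc n)) + ln (fact n)"
      unfolding fact_Suc by (subst ln_mult) auto
    with Suc.IH * show ?thesis by (simp add: algebra_simps)
  qed auto
qed auto

lemma mult_ln_minus_mono:
  fixes x y :: real
  assumes "1 \<le> x" "x \<le> y"
  shows "x * ln x - x \<le> y * ln y - y"
proof -
  have "ln (y / x) \<ge> 1 - x / y"
    using ln_le_minus_one[of "x / y"] assms by (simp add: ln_div field_simps)
  hence "y * (ln y - ln x) \<ge> y * (1 - x / y)"
    using assms by (intro mult_left_mono) (auto simp: ln_div)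
  moreover have "(y - x) * ln x \<ge> 0" using assms by simp
  ultimately show ?thesis using assms by (simp add: algebra_simps)
qed

text \<open>Monotonicity of \<open>x * ln x - x\<close> allows replacing the floor \<open>m\<close>
  by the quotient \<open>y\<close>, as \<open>m \<le> y \<le> m + 1\<close>. The lower bound passes
  through the factorial of \<open>m + 1\<close> and loses \<open>ln (m + 1)\<close>.\<close>

lemma ln_fact_div_bounds:
  assumes "k > 0" "n \<ge> k"
  defines "y \<equiv> real n / real k"
  shows "ln (fact (n div k)) \<le> y * ln y - y + ln y + 1"
    and "ln (fact (n div k)) \<ge> y * ln y - y - ln (y + 1)"
proof -
  define m where "m = n div k"
  have m: "m \<ge> 1" unfolding m_def using assms by (simp add: Suc_le_eq div_greater_zero_iff)
  have my: "real m \<le> y" unfolding m_def y_def by (rule of_nat_div_le_of_nat)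
  have ym: "y \<le> real m + 1"
    unfolding m_def y_def using assms by (metis add.commute floor_divide_of_nat_eq le_cases less_eq_real_def of_int_of_nat_eq real_of_int_floor_add_one_gt)
  have "ln (fact m) \<le> real m * ln m - m + ln m + 1" by (rule ln_fact_upper[OF m])
  also have "\<dots> \<le> y * ln y - y + ln y + 1"
    using mult_ln_minus_mono[of m y] m my by (intro add_mono) auto
  finally show "ln (fact (n div k)) \<le> y * ln y - y + ln y + 1" by (simp add: m_def)
  have "y * ln y - y \<le> real (Suc m) * ln (Suc m) - Suc m"
    using ym my m by (intro mult_ln_minus_mono) auto
  also have "\<dots> \<le> ln (fact (Suc m))" by (rule ln_fact_lower)
  also have "\<dots> = ln (real (Suc m)) + ln (fact m)"
    unfolding fact_Suc by (subst ln_mult) auto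
  also have "ln (real (Suc m)) \<le> ln (y + 1)" using my by simp
  finally show "ln (fact (n div k)) \<ge> y * ln y - y - ln (y + 1)" by (simp add: m_def)
qed

section \<open>Chebyshev's upper bound for \<open>psi\<close>\<close>

text \<open>
  With this step function Chebyshev's constant is about 1.1706, which the slack of the
  prime powers in \<^term>\<open>C1\<close> can absorb; the simpler choice with constant $\ln 4$ would not do here.
\<close>

lemma chebyshev_step:
  fixes u :: nat
  shows "int u - int (u div 2) - 2 * int (u div 3) + int (u div 6) \<ge> (if 1 \<le> u \<and> u < 3 then 1 else 0)"
proof -
  \<comment> \<open>The left-hand side has period 6 in \<open>u\<close>, because 6 - 3 - 2 * 2 + 1 =
    0, so the six remainders decide.\<close>
  define q r where "q = u div 6" and "r = u mod 6"
  have u: "u = r + q * 6" and "r < 6" by (simp_all add: q_def r_def)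
  have "u div 2 = r div 2 + 3 * q" "u div 3 = r div 3 + 2 * q" "u div 6 = q"
    using div_mult_self1[of 2 r "3 * q"] div_mult_self1[of 3 r "2 * q"] \<open>r < 6\<close>
    unfolding u by (simp_all add: ac_simps)
  moreover from \<open>r < 6\<close> have "r \<in> {0, 1, 2, 3, 4, 5}" by auto
  ultimately show ?thesis unfolding u by auto
qed

text \<open>The right-hand side weights \<open>mangoldt d\<close> by the step function at
  \<open>u = n div d\<close>. That function is never negative, and it is at least 1 for
  \<open>u = 1\<close> and \<open>u = 2\<close>, that is for
  \<open>n div 3 < d \<le> n\<close>.\<close>

lemma psi_minus_psi_third_le:
  "psi n - psi (n div 3) \<le> ln (fact n) - ln (fact (n div 2)) - 2 * ln (fact (n div 3)) + ln (fact (n div 6))"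
proof -
  have "psi n - psi (n div 3) = (\<Sum>d=1..n. mangoldt d * (if n div 3 < d then 1 else 0))"
  proof -
    have "psi n - psi (n div 3) = (\<Sum>d\<in>{1..n}-{1..n div 3}. mangoldt d)"
      unfolding psi_def by (subst sum_diff) (auto intro: order.trans[OF _ div_le_dividend])
    also have "\<dots> = (\<Sum>d=1..n. mangoldt d * (if n div 3 < d then 1 else 0))"
      by (intro sum.mono_neutral_cong_left) auto
    finally show ?thesis .
  qed
  also have "\<dots> \<le> (\<Sum>d=1..n. mangoldt d * (real (n div d) - real (n div d div 2) - 2 * real (n div d div 3) + real (n div d div 6)))"
  proof (intro sum_mono mult_left_mono mangoldt_nonneg)
    fix d assume d: "d \<in> {1..n}"
    define u where "u = n div d"
    have u: "u \<ge> 1" using d unfolding u_def by (simp add: Suc_le_eq div_greater_zero_iff)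
    have "u < 3" if "n div 3 < d"
      using that d unfolding u_def by (simp add: div_less_iff_less_mult mult.commute)
    hence "(if n div 3 < d then 1 else 0) \<le> int u - int (u div 2) - 2 * int (u div 3) + int (u div 6)"
      using chebyshev_step[of u] u by (auto split: if_splits)
    hence "real_of_int (if n div 3 < d then 1 else 0) \<le> real_of_int (int u - int (u div 2) - 2 * int (u div 3) + int (u div 6))"
      by (subst of_int_le_iff)
    moreover have "real_of_int (if n div 3 < d then 1 else 0) = (if n div 3 < d then 1 else 0)"
      by simp
    ultimately show "(if n div 3 < d then 1 else 0) \<le> real (n div d) - real (n div d div 2) - 2 * real (n div d div 3) + real (n div d div 6)"
      unfolding u_def [symmetric] by (simp only: of_int_add of_int_diff of_int_mult of_int_of_nat_eq of_int_numeral)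
  qed
  also have "\<dots> = ln (fact n) - ln (fact (n div 2)) - 2 * ln (fact (n div 3)) + ln (fact (n div 6))"
    using ln_fact_div_eq_sum_mangoldt[of 2 n] ln_fact_div_eq_sum_mangoldt[of 3 n]
      ln_fact_div_eq_sum_mangoldt[of 6 n] ln_fact_eq_sum_mangoldt[of n]
    by (simp only: sum_subtractf sum.distrib sum_distrib_left ring_distribs mult.left_commute[of _ 2] zero_less_numeral)
  finally show ?thesis .
qed

text \<open>This is 3/2 times \<open>ln 2 / 2 + 2 / 3 * ln 3 - ln 6 / 6\<close>, the coefficient
  that Stirling's formula yields for the factorials above; the factor 3/2 sums the geometric series
  with ratio 1/3.\<close>

definition cheb_const :: real where "cheb_const = ln 2 / 2 + 3 / 4 * ln 3"

lemma psi_minus_psi_third_bound: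
  "\<exists>E. \<forall>n. psi n - psi (n div 3) \<le> 2 / 3 * cheb_const * real n + E * sqrt (real n)"
proof -
  \<comment> \<open>The terms \<open>y * ln y\<close> and \<open>y\<close> cancel because 1 - 1/2 -
    2/3 + 1/6 = 0; \<open>R\<close> collects the logarithmic errors of the four factorials.\<close>
  define R where "R = (\<lambda>y::real. (ln y + 1) + ln (y/2 + 1) + 2 * ln (y/3 + 1) + (ln (y/6) + 1))"
  have "eventually (\<lambda>y::real. R y \<le> sqrt y) at_top"
    unfolding R_def by real_asymp
  then obtain y0 where y0: "\<And>y::real. y \<ge> y0 \<Longrightarrow> R y \<le> sqrt y"
    unfolding eventually_at_top_linorder by blast
  \<comment> \<open>The summand 6 makes \<open>n\<close> at least as large as each of the divisors
    1, 2, 3 and 6.\<close>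
  define n0 where "n0 = nat \<lceil>y0\<rceil> + 6"
  \<comment> \<open>The summand \<open>psi n0\<close> covers the finitely many
    \<open>0 < n < n0\<close>, where \<open>sqrt n \<ge> 1\<close>.\<close>
  define E where "E = 1 + psi n0"
  have c: "ln 2 / 2 + 2 / 3 * ln 3 - ln 6 / 6 = 2 / 3 * cheb_const"
    using ln_mult[of "2::real" 3] by (simp add: cheb_const_def field_simps)
  have c0: "cheb_const \<ge> 0" by (simp add: cheb_const_def)
  have "psi n - psi (n div 3) \<le> 2 / 3 * cheb_const * real n + E * sqrt (real n)" for n
  proof (cases "n \<ge> n0")
    case True
    have "psi n - psi (n div 3) \<le> ln (fact n) - ln (fact (n div 2)) - 2 * ln (fact (n div 3)) + ln (fact (n div 6))"
      by (rule psi_minus_psi_third_le)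
    also have "\<dots> \<le> real n * (ln 2 / 2 + 2 / 3 * ln 3 - ln 6 / 6) + sqrt (real n)"
    proof -
      have n: "n \<ge> 6" "real n \<ge> y0" using True unfolding n0_def by linarith+
      define y where "y = real n"
      have y: "y \<ge> 6" using n by (simp add: y_def)
      have l6: "ln (6::real) = ln 2 + ln 3" using ln_mult[of "2::real" 3] by simp
      have l: "ln (y / 2) = ln y - ln 2" "ln (y / 3) = ln y - ln 3" "ln (y / 6) = ln y - ln 6"
        using y by (simp_all add: ln_div)
      have "ln (fact n) - ln (fact (n div 2)) - 2 * ln (fact (n div 3)) + ln (fact (n div 6)) \<le>
          (y * ln y - y + ln y + 1) - (y/2 * ln (y/2) - y/2 - ln (y/2 + 1)) -
          2 * (y/3 * ln (y/3) - y/3 - ln (y/3 + 1)) + (y/6 * ln (y/6) - y/6 + ln (y/6) + 1)"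
        using ln_fact_div_bounds(1)[of 1 n] ln_fact_div_bounds(2)[of 2 n]
          ln_fact_div_bounds(2)[of 3 n] ln_fact_div_bounds(1)[of 6 n] n(1) by (simp add: y_def)
      also have "\<dots> = y * (ln 2 / 2 + 2 / 3 * ln 3 - ln 6 / 6) + R y"
        unfolding l R_def l6 by (simp add: field_simps)
      finally show ?thesis using y0[OF n(2)] by (simp add: y_def)
    qed
    also have "\<dots> \<le> 2 / 3 * cheb_const * real n + E * sqrt (real n)"
      unfolding c E_def using psi_nonneg[of n0] by (simp add: algebra_simps)
    finally show ?thesis .
  next
    case False
    show ?thesis
    proof (cases "n = 0")
      case False
      have "psi n - psi (n div 3) \<le> psi n0"
        using psi_nonneg[of "n div 3"] psi_mono[of n n0] \<open>\<not> n \<ge> n0\<close> by simp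
      also have "\<dots> \<le> E * 1" unfolding E_def by simp
      also have "\<dots> \<le> E * sqrt (real n)"
        using False psi_nonneg[of n0] by (intro mult_left_mono) (auto simp: E_def)
      also have "\<dots> \<le> 2 / 3 * cheb_const * real n + E * sqrt (real n)" using c0 by simp
      finally show ?thesis .
    qed (auto simp: psi_def)
  qed
  thus ?thesis by blast
qed

text \<open>Iterating over \<open>n\<close>, \<open>n div 3\<close>, \<open>n div 9\<close> and so
  on, the main terms form a geometric series with sum \<open>cheb_const * n\<close>.\<close>

lemma psi_le_sqrt:
  "\<exists>B. \<forall>n. psi n \<le> cheb_const * real n + B * sqrt (real n)"
proof -
  obtain E where E: "\<And>n. psi n - psi (n div 3) \<le> 2 / 3 * cheb_const * real n + E * sqrt (real n)"
    using psi_minus_psi_third_bound by blast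
  \<comment> \<open>As \<open>sqrt (n / 3) \<le> 2 / 3 * sqrt n\<close>, the error reproduces itself
    once \<open>E + 2 / 3 * B \<le> B\<close>.\<close>
  define B where "B = 3 * \<bar>E\<bar>"
  have c0: "cheb_const \<ge> 0" by (simp add: cheb_const_def)
  have "psi n \<le> cheb_const * real n + B * sqrt (real n)" for n
  proof (induction n rule: less_induct)
    case (less n)
    show ?case
    proof (cases "n = 0")
      case False
      have "sqrt (real (n div 3)) \<le> sqrt (real n / 3)"
        using of_nat_div_le_of_nat[of n 3, where 'a = real] by simp
      also have "\<dots> \<le> 2 / 3 * sqrt (real n)"
        by (rule real_le_lsqrt) (auto simp: power_mult_distrib power_divide)
      finally have s: "sqrt (real (n div 3)) \<le> 2 / 3 * sqrt (real n)" .
      have "psi n \<le> (2 / 3 * cheb_const * real n + E * sqrt (real n)) + psi (n div 3)"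
        using E[of n] by simp
      also have "psi (n div 3) \<le> cheb_const * real (n div 3) + B * sqrt (real (n div 3))"
        using False by (intro less.IH) auto
      also have "\<dots> \<le> cheb_const * (real n / 3) + B * (2 / 3 * sqrt (real n))"
        using of_nat_div_le_of_nat[of n 3, where 'a = real] c0 s
        by (intro add_mono mult_left_mono) (auto simp: B_def)
      also have "E * sqrt (real n) \<le> B / 3 * sqrt (real n)"
        by (intro mult_right_mono) (auto simp: B_def)
      finally show ?thesis by (simp add: algebra_simps)
    qed (auto simp: psi_def)
  qed
  thus ?thesis by blast
qed

text \<open>Completing the square gives \<open>B * sqrt n \<le> e * n + B^2 / (4 * e)\<close>, so
  any excess \<open>e\<close> over \<open>cheb_const\<close> turns the square root error into a
  constant.\<close>

lemma psi_le_linear: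
  assumes "c > cheb_const"
  shows "\<exists>K\<ge>0. \<forall>n. psi n \<le> c * real n + K"
proof -
  obtain B where B: "\<And>n. psi n \<le> cheb_const * real n + B * sqrt (real n)"
    using psi_le_sqrt by blast
  define e where "e = c - cheb_const"
  have e: "e > 0" using assms by (simp add: e_def)
  have "psi n \<le> c * real n + B\<^sup>2 / (4 * e)" for n
  proof -
    have "0 \<le> (e * sqrt n - B / 2)\<^sup>2 / e" using e by simp
    also have "\<dots> = e * n - B * sqrt n + B\<^sup>2 / (4 * e)"
      using e by (simp add: power2_diff power_mult_distrib power_divide field_simps power2_eq_square)
    finally show ?thesis using B[of n] by (simp add: e_def algebra_simps)
  qed
  moreover have "B\<^sup>2 / (4 * e) \<ge> 0" using e by simp
  ultimately show ?thesis by blast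
qed

lemma ln_bounds:
  "((6931 / 10000) :: real) \<le> ln 2" "ln 2 \<le> ((6932 / 10000) :: real)"
  "((10985 / 10000) :: real) \<le> ln 3" "ln 3 \<le> ((10987 / 10000) :: real)"
proof -
  have "ln (3 / 2 :: real) \<in> {0.40545..0.40549}"
    using ln_approx_bounds[of "3/2" 3] by (simp add: eval_nat_numeral)
  moreover have "ln (3 / 2 :: real) = ln 3 - ln 2" by (simp add: ln_div)
  ultimately have "ln 3 \<in> {ln 2 + 0.40545..ln 2 + (40549 / 100000)::real}" by simp
  moreover have 2: "ln (2::real) \<in> {0.69314..0.69315}"
    using ln_approx_bounds[of 2 6] by (simp add: eval_nat_numeral)
  ultimately show "((6931 / 10000) :: real) \<le> ln 2" "ln 2 \<le> ((6932 / 10000) :: real)"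
     "((10985 / 10000) :: real) \<le> ln 3" "ln 3 \<le> ((10987 / 10000) :: real)" by auto
qed

lemma cheb_const_less: "cheb_const < (1171 / 1000)"
  using ln_bounds by (simp add: cheb_const_def)

section \<open>Prime sums for the size and the gain of the resonator\<close>

text \<open>Partial summation carried out as an induction: the new term has weight
  \<open>ln 1 = 0\<close>, and the old weights all grow by \<open>e = ln (N + 1) - ln N\<close>,
  which adds \<open>psi N * e\<close> with \<open>N * e \<le> 1\<close>.\<close>

lemma sum_mangoldt_ln_le:
  assumes K: "\<And>n. psi n \<le> c * real n + K" and "c \<ge> 0" "K \<ge> 0" "N \<ge> 1"
  shows "(\<Sum>d=1..N. mangoldt d * ln (real N / real d)) \<le> c * real N + K * ln (real N)"
  using \<open>N \<ge> 1\<close>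
proof (induction N rule: dec_induct)
  case base
  show ?case using \<open>c \<ge> 0\<close> by simp
next
  case (step N)
  define e where "e = ln (real (Suc N)) - ln (real N)"
  have e: "e \<ge> 0" using step by (simp add: e_def)
  have "ln (real (Suc N) / real N) \<le> real (Suc N) / real N - 1"
    using step by (intro ln_le_minus_one) auto
  hence "real N * e \<le> real N * (1 / real N)"
    using step by (intro mult_left_mono) (auto simp: ln_div field_simps e_def)
  hence Ne: "real N * e \<le> 1" using step by simp
  have "(\<Sum>d=1..Suc N. mangoldt d * ln (real (Suc N) / real d)) =
        (\<Sum>d=1..N. mangoldt d * ln (real (Suc N) / real d))" by simp
  also have "\<dots> = (\<Sum>d=1..N. mangoldt d * ln (real N / real d) + mangoldt d * e)"
    using step by (intro sum.cong refl) (auto simp: ln_div e_def algebra_simps)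
  also have "\<dots> = (\<Sum>d=1..N. mangoldt d * ln (real N / real d)) + psi N * e"
    by (simp add: sum.distrib psi_def sum_distrib_right)
  also have "psi N * e \<le> (c * real N + K) * e"
    using K[of N] e by (intro mult_right_mono) auto
  also have "\<dots> = c * (real N * e) + K * e" by (simp add: algebra_simps)
  also have "\<dots> \<le> c * 1 + K * e"
    using Ne \<open>c \<ge> 0\<close> by (intro add_mono mult_left_mono order.refl)
  finally show ?case using step.IH by (simp add: e_def algebra_simps)
qed

text \<open>Each prime up to \<open>N powr \<theta>\<close> contributes at most \<open>ln N\<close>.
  For the larger ones \<open>1 \<le> ln p / (\<theta> * ln N)\<close>, which turns the sum over
  primes into one weighted by \<open>mangoldt\<close>. The sum on the left is the logarithm of the
  resonator at 0.\<close>

lemma sum_primes_ln_div_bound: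
  assumes K: "\<And>n. psi n \<le> c * real n + K" and "c \<ge> 0" "K \<ge> 0" "N \<ge> 2" "0 < \<theta>"
  shows "(\<Sum>p | prime p \<and> p \<le> N. ln (real (N div p))) \<le>
           real N powr \<theta> * ln (real N) + (c * real N + K * ln (real N)) / (\<theta> * ln (real N))"
proof -
  define z where "z = real N powr \<theta>"
  define P where "P = {p. prime p \<and> p \<le> N}"
  have fin: "finite P" unfolding P_def by simp
  have lnN: "ln (real N) > 0" using \<open>N \<ge> 2\<close> by simp
  have P: "p > 0" "p \<ge> 2" "p \<le> N" "prime p" if "p \<in> P" for p
    using that prime_ge_2_nat[of p] prime_gt_0_nat[of p] by (auto simp: P_def)
  have le: "ln (real (N div p)) \<le> ln (real N / real p)" if "p \<in> P" for p
  proof -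
    have "N div p \<ge> 1" using P[OF that] by (simp add: Suc_le_eq div_greater_zero_iff)
    thus ?thesis using of_nat_div_le_of_nat[of N p, where 'a = real] P[OF that] by simp
  qed
  have "(\<Sum>p\<in>P. ln (real (N div p))) = (\<Sum>p\<in>{p\<in>P. real p \<le> z}. ln (real (N div p))) +
          (\<Sum>p\<in>{p\<in>P. real p > z}. ln (real (N div p)))"
    using fin by (subst sum.union_disjoint [symmetric]) (auto intro!: sum.cong)
  also have "(\<Sum>p\<in>{p\<in>P. real p \<le> z}. ln (real (N div p))) \<le> (\<Sum>p\<in>{p\<in>P. real p \<le> z}. ln (real N))"
  proof (intro sum_mono)
    fix p assume p: "p \<in> {p\<in>P. real p \<le> z}"
    have "N div p \<ge> 1" using P[of p] p by (auto simp: Suc_le_eq div_greater_zero_iff)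
    moreover have "N div p \<le> N" by simp
    ultimately show "ln (real (N div p)) \<le> ln (real N)"
      by (subst ln_le_cancel_iff) (use \<open>N \<ge> 2\<close> in \<open>auto simp del: div_le_dividend\<close>)
  qed
  also have "\<dots> = real (card {p\<in>P. real p \<le> z}) * ln (real N)" by simp
  also have "\<dots> \<le> z * ln (real N)"
  proof (intro mult_right_mono)
    have "{p\<in>P. real p \<le> z} \<subseteq> {1..nat \<lfloor>z\<rfloor>}"
      using P by (auto simp: le_nat_iff le_floor_iff Suc_le_eq)
    hence "card {p\<in>P. real p \<le> z} \<le> nat \<lfloor>z\<rfloor>" using card_mono[of "{1..nat \<lfloor>z\<rfloor>}"] by fastforce
    hence "real (card {p\<in>P. real p \<le> z}) \<le> real (nat \<lfloor>z\<rfloor>)" by linarith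
    also have "\<dots> \<le> z" by (simp add: z_def)
    finally show "real (card {p\<in>P. real p \<le> z}) \<le> z" .
  qed (use lnN in auto)
  also have "(\<Sum>p\<in>{p\<in>P. real p > z}. ln (real (N div p))) \<le>
             (\<Sum>p\<in>{p\<in>P. real p > z}. mangoldt p * ln (real N / real p) / (\<theta> * ln (real N)))"
  proof (intro sum_mono)
    fix p assume p: "p \<in> {p\<in>P. real p > z}"
    have "ln z \<le> ln (real p)" using p \<open>N \<ge> 2\<close> P[of p] by (subst ln_le_cancel_iff) (auto simp: z_def)
    hence "\<theta> * ln (real N) \<le> mangoldt p" using p \<open>N \<ge> 2\<close> P[of p] by (simp add: z_def ln_powr)
    moreover have "ln (real N / real p) \<ge> 0" using P[of p] p by simp
    ultimately have "\<theta> * ln (real N) * ln (real N / real p) \<le> mangoldt p * ln (real N / real p)"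
      by (intro mult_right_mono)
    hence "ln (real N / real p) \<le> mangoldt p * ln (real N / real p) / (\<theta> * ln (real N))"
      using lnN \<open>\<theta> > 0\<close> by (simp add: pos_le_divide_eq mult.commute)
    with le[of p] p show "ln (real (N div p)) \<le> mangoldt p * ln (real N / real p) / (\<theta> * ln (real N))"
      by simp
  qed
  also have "\<dots> \<le> (\<Sum>p=1..N. mangoldt p * ln (real N / real p) / (\<theta> * ln (real N)))"
    using P lnN \<open>\<theta> > 0\<close>
    by (intro sum_mono2 divide_nonneg_pos mult_nonneg_nonneg mangoldt_nonneg) (auto simp: Suc_le_eq)
  also have "\<dots> = (\<Sum>p=1..N. mangoldt p * ln (real N / real p)) / (\<theta> * ln (real N))"
    by (simp add: sum_divide_distrib)
  also have "\<dots> \<le> (c * real N + K * ln (real N)) / (\<theta> * ln (real N))"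
    using lnN \<open>\<theta> > 0\<close> \<open>N \<ge> 2\<close> sum_mangoldt_ln_le[of c K N] assms
    by (intro divide_right_mono) auto
  finally show ?thesis by (simp add: z_def P_def)
qed

lemma eventually_sum_primes_ln_div_le:
  "eventually (\<lambda>N. (\<Sum>p | prime p \<and> p \<le> N. ln (real (N div p))) \<le> (59 / 50) * real N / ln (real N)) at_top"
proof -
  obtain K where K: "K \<ge> 0" "\<And>n. psi n \<le> (1171 / 1000) * real n + K"
    using psi_le_linear[OF cheb_const_less] by blast
  \<comment> \<open>With \<open>\<theta> = 199 / 200\<close> the leading constant is (1171/1000) /
    (199/200), about 1.1769, which lies below 59/50 = 1.18 and leaves room for the lower order
    terms.\<close>
  have "eventually (\<lambda>N. real N powr (199 / 200) * ln (real N) + ((1171 / 1000) * real N + K * ln (real N)) / ((199 / 200) * ln (real N))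
          \<le> (59 / 50) * real N / ln (real N)) at_top"
    by real_asymp
  thus ?thesis using eventually_ge_at_top[of 2]
  proof eventually_elim
    case (elim N)
    have "(\<Sum>p | prime p \<and> p \<le> N. ln (real (N div p))) \<le> real N powr (199 / 200) * ln (real N) +
        ((1171 / 1000) * real N + K * ln (real N)) / ((199 / 200) * ln (real N))"
      by (rule sum_primes_ln_div_bound) (use K elim in auto)
    with elim show ?case by linarith
  qed
qed

text \<open>Since \<open>n * (N div n) \<le> N\<close>, each term is at least
  \<open>mangoldt n * (N div n - 1) / N\<close>, and these sum to
  \<open>(ln (fact N) - psi N) / N\<close>.\<close>

lemma sum_mangoldt_weighted_ge:
  assumes "N \<ge> 1"
  shows "(\<Sum>n=1..N. mangoldt n / real n * (1 - 1 / real (N div n))) \<ge> ln (real N) - 1 - psi N / real N"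
proof -
  have "ln (real N) - 1 - psi N / real N = (real N * ln (real N) - real N - psi N) / real N"
    using assms by (simp add: field_simps)
  also have "\<dots> \<le> (ln (fact N) - psi N) / real N"
    using assms ln_fact_lower[of N] by (intro divide_right_mono) auto
  also have "\<dots> = (\<Sum>n=1..N. mangoldt n * (real (N div n) - 1) / real N)"
    by (simp add: ln_fact_eq_sum_mangoldt psi_def sum_subtractf sum_divide_distrib algebra_simps diff_divide_distrib)
  also have "\<dots> \<le> (\<Sum>n=1..N. mangoldt n / real n * (1 - 1 / real (N div n)))"
  proof (intro sum_mono)
    fix n assume n: "n \<in> {1..N}"
    define j where "j = N div n"
    have j: "j \<ge> 1" using n by (simp add: j_def Suc_le_eq div_greater_zero_iff)
    have "real (n * j) \<le> real N" unfolding j_def by (subst of_nat_le_iff) simp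
    hence "(real j - 1) / real N \<le> (real j - 1) / real (n * j)"
      using j n by (intro divide_left_mono) auto
    also have "\<dots> = 1 / real n * (1 - 1 / real j)"
      using j n by (simp add: field_simps)
    finally have "mangoldt n * ((real j - 1) / real N) \<le> mangoldt n * (1 / real n * (1 - 1 / real j))"
      by (intro mult_left_mono mangoldt_nonneg)
    thus "mangoldt n * (real (N div n) - 1) / real N \<le> mangoldt n / real n * (1 - 1 / real (N div n))"
      by (simp add: j_def)
  qed
  finally show ?thesis .
qed

lemma eventually_sum_mangoldt_weighted_ge:
  "eventually (\<lambda>N. (\<Sum>n=1..N. mangoldt n / real n * (1 - 1 / real (N div n))) \<ge> ln (real N) - (109 / 50)) at_top"
proof -
  obtain K where K: "K \<ge> 0" "\<And>n. psi n \<le> (1171 / 1000) * real n + K"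
    using psi_le_linear[OF cheb_const_less] by blast
  \<comment> \<open>The constant 109/50 is 1 + 59/50, with 59/50 an eventual upper bound for
    \<open>psi N / N\<close>.\<close>
  have "eventually (\<lambda>N. ((1171 / 1000) * real N + K) / real N \<le> (59 / 50)) at_top"
    by real_asymp
  thus ?thesis using eventually_ge_at_top[of 1]
  proof eventually_elim
    case (elim N)
    have "psi N / real N \<le> ((1171 / 1000) * real N + K) / real N"
      using K(2)[of N] by (intro divide_right_mono) auto
    with elim sum_mangoldt_weighted_ge[of N] show ?case by linarith
  qed
qed

section \<open>The prime power series and the constant \<open>C1\<close>\<close>

text \<open>The primes 2 and 3 with exponents 2 to 7 already suffice. Most of the proof establishes
  summability: a divergent \<open>infsum\<close> has the default value 0, so finite partial sums
  bound it from below only once convergence is known.\<close>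

lemma prime_power_series_ge:
  "(\<Sum>\<^sub>\<infinity>k\<in>{2..}. \<Sum>\<^sub>\<infinity>p\<in>{p::nat. prime p}. ln (real p) / real p ^ k) \<ge> (49 / 100)"
proof -
  define P where "P = {p::nat. prime p}"
  have P: "p \<ge> 2" if "p \<in> P" for p using that prime_ge_2_nat by (auto simp: P_def)
  have nn: "0 \<le> ln (real p) / real p ^ k" if "p \<in> P" for p k
    using P[OF that] by simp
  have "summable (\<lambda>n. 2 * real n powr (-3/2))"
    by (intro summable_mult) (simp add: summable_real_powr_iff)
  hence "(\<lambda>n. 2 * real n powr (-3/2)) summable_on UNIV"
    by (intro norm_summable_imp_summable_on) simp
  hence sq: "(\<lambda>n. 2 * real n powr (-3/2)) summable_on P"
    by (rule summable_on_subset_banach) auto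
  \<comment> \<open>The bound \<open>ln p \<le> 2 * sqrt p\<close> leaves the convergent exponent
    -3/2.\<close>
  have le2: "ln (real p) / real p ^ 2 \<le> 2 * real p powr (-3/2)" if "p \<in> P" for p
  proof -
    have "ln (real p powr (1/2)) \<le> real p powr (1/2)" by (rule ln_bound) (use P[OF that] in auto)
    hence "ln (real p) \<le> 2 * real p powr (1/2)" using P[OF that] by (simp add: ln_powr)
    hence "ln (real p) / real p ^ 2 \<le> 2 * real p powr (1/2) / real p ^ 2"
      by (intro divide_right_mono) auto
    also have "\<dots> = 2 * (real p powr (1/2) / real p powr 2)" using P[OF that] by simp
    also have "\<dots> = 2 * real p powr (-3/2)" by (subst powr_diff [symmetric]) simp
    finally show ?thesis .
  qed
  have s2: "(\<lambda>p. ln (real p) / real p ^ 2) summable_on P"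
    by (rule summable_on_comparison_test[OF sq]) (use le2 nn in auto)
  define S where "S = (\<Sum>\<^sub>\<infinity>p\<in>P. ln (real p) / real p ^ 2)"
  \<comment> \<open>Since \<open>p \<ge> 2\<close>, each power beyond the second gains a factor 1/2;
    this gives summability in \<open>k\<close> by comparison with a geometric series.\<close>
  have split: "ln (real p) / real p ^ k \<le> (1/2) ^ (k - 2) * (ln (real p) / real p ^ 2)"
    if "p \<in> P" "k \<ge> 2" for p k
  proof -
    have "real p ^ k = real p ^ (k - 2) * real p ^ 2"
      using power_add[of "real p" "k - 2" 2] that by (simp only: le_add_diff_inverse2)
    hence "ln (real p) / real p ^ k = (1 / real p) ^ (k - 2) * (ln (real p) / real p ^ 2)"
      by (simp add: field_simps)
    also have "\<dots> \<le> (1/2) ^ (k - 2) * (ln (real p) / real p ^ 2)"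
      using P[OF that(1)] nn[OF that(1)] by (intro mult_right_mono power_mono) (auto simp: field_simps)
    finally show ?thesis .
  qed
  have sk: "(\<lambda>p. ln (real p) / real p ^ k) summable_on P" if "k \<ge> 2" for k
    by (rule summable_on_comparison_test[OF summable_on_cmult_right[OF s2, of "(1/2) ^ (k - 2)"]])
       (use split nn that in auto)
  define g where "g = (\<lambda>k. \<Sum>\<^sub>\<infinity>p\<in>P. ln (real p) / real p ^ k)"
  have g_nn: "g k \<ge> 0" for k unfolding g_def by (intro infsum_nonneg nn)
  have g_le: "g k \<le> (1/2) ^ (k - 2) * S" if "k \<ge> 2" for k
    unfolding g_def S_def using that
    by (subst infsum_cmult_right' [symmetric])
       (intro infsum_mono sk summable_on_cmult_right s2 split; auto)
  have g_ge: "ln 2 / 2 ^ k + ln 3 / 3 ^ k \<le> g k" if "k \<ge> 2" for k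
  proof -
    have "(\<Sum>p\<in>{2,3}. ln (real p) / real p ^ k) \<le> g k"
      unfolding g_def by (rule finite_sum_le_infsum[OF sk]) (use that nn in \<open>auto simp: P_def\<close>)
    thus ?thesis by simp
  qed
  have "summable (\<lambda>k. (1/2) ^ k * (4 * S))" by (intro summable_mult2 summable_geometric) auto
  hence "(\<lambda>k. (1/2) ^ k * (4 * S)) summable_on UNIV"
    using g_nn[of 2] g_le[of 2] by (intro norm_summable_imp_summable_on) (simp add: abs_mult)
  hence "(\<lambda>k. (1/2) ^ k * (4 * S)) summable_on {2..}"
    by (rule summable_on_subset_banach) auto
  hence gs: "g summable_on {2..}"
  proof (rule summable_on_comparison_test)
    fix k :: nat assume k: "k \<in> {2..}"
    then obtain j where j: "k = j + 2" by (metis atLeast_iff le_add_diff_inverse2)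
    show "g k \<le> (1/2) ^ k * (4 * S)" using g_le[of k] k unfolding j by simp
  qed (rule g_nn)
  have "(49 / 100) \<le> (\<Sum>k=2..7. ln 2 / 2 ^ k + ln 3 / 3 ^ k :: real)"
    using ln_bounds by (simp add: eval_nat_numeral)
  also have "\<dots> \<le> (\<Sum>k=2..7. g k)" by (intro sum_mono g_ge) auto
  also have "\<dots> \<le> (\<Sum>\<^sub>\<infinity>k\<in>{2..}. g k)"
    by (rule finite_sum_le_infsum[OF gs]) (auto intro: g_nn)
  finally show ?thesis by (simp add: g_def P_def)
qed

text \<open>The resonance argument produces the constant on the right, with 59/50 in the role that 1
  would have under the prime number theorem. The prime power series, \<open>euler_mascheroni\<close>
  and \<open>ln (ln 4)\<close> in \<open>C1\<close> outweigh this loss and still leave a margin of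
  1/50.\<close>

lemma C1_le: "C1 \<beta> + (1 / 50) \<le> ln (1 - \<beta>) - (109 / 50) - ln (59 / 50)"
proof -
  have "ln ((59 / 50)::real) \<le> (166 / 1000)"
    using ln_approx_bounds[of "59 / 50" 2] by (simp add: eval_nat_numeral)
  moreover have "ln (4::real) = 2 * ln 2" using ln_realpow[of 2 2] by simp
  hence "ln (ln 4) \<ge> ln ((1386 / 1000)::real)" using ln_bounds by simp
  moreover have "ln ((1386 / 1000)::real) \<ge> (326 / 1000)"
    using ln_approx_bounds[of "(1386 / 1000)" 3] by (simp add: eval_nat_numeral)
  moreover have "euler_mascheroni \<ge> ((5757 / 10000) :: real)" using euler_mascheroni_gt_19_over_33 by simp
  ultimately show ?thesis using prime_power_series_ge unfolding C1_def by linarith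
qed

section \<open>The logarithmic derivative to the right of the 1-line\<close>

text \<open>Including \<open>n = 0\<close> lets the Dirichlet series below run over all naturals:
  \<open>0 powr s\<close> is 0 by convention.\<close>

lemma norm_of_nat_powr: "norm (of_nat n powr s :: complex) = real n powr Re s"
proof (cases "n = 0")
  case False
  thus ?thesis by (subst norm_powr_real_powr) auto
qed auto

lemma Re_of_nat_powr_minus:
  "Re (of_nat n powr (- Complex \<sigma> t)) = real n powr (- \<sigma>) * cos (t * ln (real n))"
proof (cases "n = 0")
  case False
  hence "(of_nat n :: complex) powr (- Complex \<sigma> t) = exp (- Complex \<sigma> t * of_real (ln (real n)))"
    by (simp add: powr_def flip: Ln_of_nat)
  thus ?thesis using False by (simp add: Re_exp powr_def)
qed auto

lemma summable_ln_powr: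
  assumes "\<sigma> > (1::real)"
  shows "summable (\<lambda>n. ln (real n) * real n powr (-\<sigma>))"
proof (rule summable_comparison_test_ev)
  \<comment> \<open>The bound \<open>ln n \<le> n powr e / e\<close> leaves the exponent
    \<open>e - \<sigma> = - (\<sigma> + 1) / 2\<close>, which is below -1.\<close>
  define e where "e = (\<sigma> - 1) / 2"
  have e: "e > 0" using assms by (simp add: e_def)
  show "summable (\<lambda>n. 1 / e * real n powr (e - \<sigma>))"
    using assms by (intro summable_mult) (simp add: summable_real_powr_iff e_def field_simps)
  show "\<forall>\<^sub>F n in sequentially. norm (ln (real n) * real n powr (-\<sigma>)) \<le> 1 / e * real n powr (e - \<sigma>)"
    using eventually_ge_at_top[of 1]
  proof eventually_elim
    case (elim n)
    have "ln (real n) * real n powr (-\<sigma>) \<le> real n powr e / e * real n powr (-\<sigma>)"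
      using elim e by (intro mult_right_mono ln_powr_bound) auto
    also have "\<dots> = 1 / e * (real n powr e * real n powr (-\<sigma>))" by simp
    also have "real n powr e * real n powr (-\<sigma>) = real n powr (e - \<sigma>)"
      by (simp flip: powr_add)
    finally show ?case using elim by simp
  qed
qed

lemma summable_dirichlet:
  fixes a :: "nat \<Rightarrow> complex"
  assumes "\<And>n. norm (a n) \<le> 1" "Re s > 1"
  shows "summable (\<lambda>n. norm (a n * of_nat n powr (-s)))"
proof (rule summable_comparison_test)
  show "summable (\<lambda>n. real n powr (- Re s))" using assms by (simp add: summable_real_powr_iff)
  show "\<exists>N. \<forall>n\<ge>N. norm (norm (a n * of_nat n powr (-s))) \<le> real n powr (- Re s)"
    using mult_right_mono[OF assms(1), of "real n powr (- Re s)" n for n]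
    by (auto simp: norm_mult norm_of_nat_powr)
qed

text \<open>Termwise differentiation is justified on the closed half-plane bounded by the midpoint
  \<open>c\<close> of 1 and \<open>Re s\<close>, where the differentiated terms are dominated by
  \<open>ln n * n powr (-c)\<close>. It serves both zeta and its logarithm.\<close>

lemma dirichlet_series_has_field_derivative:
  fixes a :: "nat \<Rightarrow> complex"
  assumes a: "\<And>n. norm (a n) \<le> 1" and s: "Re s > 1"
  shows "((\<lambda>s. \<Sum>n. a n * of_nat n powr (-s)) has_field_derivative
            (\<Sum>n. - (a n * of_real (ln (real n)) * of_nat n powr (-s)))) (at s)"
proof -
  define c where "c = (1 + Re s) / 2"
  define S where "S = {z. Re z \<ge> c}"
  have c: "c > 1" "Re s > c" using s by (simp_all add: c_def)
  have "{z. Re z > c} \<subseteq> interior S"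
    unfolding S_def by (intro interior_maximal open_halfspace_Re_gt) auto
  hence int: "s \<in> interior S" using c by auto
  show ?thesis
  proof (rule has_field_derivative_series'(2)[where S = S and ?x0.0 = s])
    show "convex S" unfolding S_def by (rule convex_halfspace_Re_ge)
    show "((\<lambda>z. a n * of_nat n powr (-z)) has_field_derivative
            - (a n * of_real (ln (real n)) * of_nat n powr (-z))) (at z within S)" for n z
    proof (cases "n = 0")
      case False
      thus ?thesis unfolding powr_def by (auto intro!: derivative_eq_intros simp: Ln_of_nat)
    qed auto
    have "uniform_limit S (\<lambda>n z. \<Sum>i<n. - (a i * of_real (ln (real i)) * of_nat i powr (-z)))
            (\<lambda>z. suminf (\<lambda>i. - (a i * of_real (ln (real i)) * of_nat i powr (-z)))) sequentially"
    proof (rule Weierstrass_m_test)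
      show "summable (\<lambda>n. ln (real n) * real n powr (-c))" by (rule summable_ln_powr) fact
      fix n z assume z: "z \<in> S"
      show "norm (- (a n * of_real (ln (real n)) * of_nat n powr (-z))) \<le> ln (real n) * real n powr (-c)"
      proof (cases "n = 0")
        case False
        have "norm (a n) * (ln (real n) * real n powr (- Re z)) \<le> 1 * (ln (real n) * real n powr (-c))"
          using False z a by (intro mult_mono powr_mono mult_nonneg_nonneg) (auto simp: S_def Suc_le_eq)
        thus ?thesis using False by (simp add: norm_mult norm_of_nat_powr mult.assoc)
      qed auto
    qed
    thus "uniformly_convergent_on S (\<lambda>n z. \<Sum>i<n. - (a i * of_real (ln (real i)) * of_nat i powr (-z)))"
      by (rule uniformly_convergentI)
    show "s \<in> S" using c by (simp add: S_def)
    show "s \<in> interior S" by fact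
    show "summable (\<lambda>n. a n * of_nat n powr (-s))"
      by (rule summable_norm_cancel[OF summable_dirichlet[OF a s]])
  qed
qed

lemma zeta_eq_suminf:
  assumes "Re s > 1"
  shows "zeta s = (\<Sum>n. of_nat n powr (-s))"
proof -
  have "summable (\<lambda>n. (of_nat n :: complex) powr (-s))"
    using summable_norm_cancel[OF summable_dirichlet[of "\<lambda>_. 1" s]] assms by simp
  hence "(\<Sum>n. (of_nat n :: complex) powr (-s)) = (\<Sum>n. of_nat (Suc n) powr (-s)) + of_nat 0 powr (-s)"
    by (subst suminf_split_head) auto
  thus ?thesis using zeta_eq_series[OF assms] by (simp add: powr_minus divide_inverse del: of_nat_Suc)
qed

lemma zeta_has_field_derivative:
  assumes "Re s > 1"
  shows "(zeta has_field_derivative (\<Sum>n. - (of_real (ln (real n)) * of_nat n powr (-s)))) (at s)"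
proof (rule has_field_derivative_transform_within_open)
  show "((\<lambda>s. \<Sum>n. of_nat n powr (-s)) has_field_derivative (\<Sum>n. - (of_real (ln (real n)) * of_nat n powr (-s)))) (at s)"
    using dirichlet_series_has_field_derivative[of "\<lambda>_. 1" s] assms by simp
  show "open {z. Re z > 1}" by (rule open_halfspace_Re_gt)
qed (use assms zeta_eq_suminf in auto)

section \<open>The von Mangoldt series and the logarithm of zeta\<close>

lemma summable_mangoldt:
  assumes "Re s > 1"
  shows "summable (\<lambda>n. norm (mangoldt n * of_nat n powr (-s) :: complex))"
proof (rule summable_comparison_test)
  show "summable (\<lambda>n. ln (real n) * real n powr (- Re s))" by (rule summable_ln_powr) fact
  have "mangoldt n * real n powr (- Re s) \<le> ln (real n) * real n powr (- Re s)" for n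
    by (cases "n = 0") (auto intro!: mult_right_mono mangoldt_le)
  hence "norm (norm (mangoldt n * of_nat n powr (-s) :: complex)) \<le> ln (real n) * real n powr (- Re s)" for n
    by (simp add: norm_mult norm_of_nat_powr abs_mult)
  thus "\<exists>N. \<forall>n\<ge>N. norm (norm (mangoldt n * of_nat n powr (-s) :: complex)) \<le> ln (real n) * real n powr (- Re s)"
    by blast
qed

lemma summable_norm_ln_dirichlet:
  assumes "Re s > 1"
  shows "summable (\<lambda>n. norm (of_real (ln (real n)) * (of_nat n :: complex) powr (-s)))"
proof -
  have "norm (of_real (ln (real n)) * (of_nat n :: complex) powr (-s)) = ln (real n) * real n powr (- Re s)" for n
    by (cases "n = 0") (auto simp: norm_mult norm_of_nat_powr)
  thus ?thesis using summable_ln_powr[OF assms] by simp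
qed

text \<open>Dirichlet convolution: absolute convergence allows grouping the double series by the
  product \<open>n\<close> of the two indices, and \<open>mangoldt\<close> summed over the divisors
  of \<open>n\<close> is \<open>ln n\<close>.\<close>

lemma zeta_times_mangoldt_series:
  assumes s: "Re s > 1"
  shows "zeta s * (\<Sum>n. mangoldt n * of_nat n powr (-s)) = (\<Sum>n. of_real (ln (real n)) * of_nat n powr (-s))"
proof -
  define f where "f = (\<lambda>n. (of_nat n :: complex) powr (-s))"
  define g where "g = (\<lambda>n. mangoldt n * (of_nat n :: complex) powr (-s))"
  have nf: "summable (\<lambda>n. norm (f n))"
    using summable_dirichlet[of "\<lambda>_. 1" s] s by (simp add: f_def)
  have ng: "summable (\<lambda>n. norm (g n))"
    unfolding g_def by (rule summable_mangoldt) fact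
  have abs_f: "(\<lambda>n. norm (f n)) summable_on {1..}" and abs_g: "(\<lambda>n. norm (g n)) summable_on {1..}"
    using nf ng by (auto intro!: summable_on_subset_banach[of _ UNIV] norm_summable_imp_summable_on)
  \<comment> \<open>Unordered sums over the positive integers permit rearrangement; dropping the
    index 0 is harmless since all terms vanish there.\<close>
  have sumeq: "suminf h = (\<Sum>\<^sub>\<infinity>n\<in>{1..}. h n)" if "summable (\<lambda>n. norm (h n))" "h 0 = 0" for h :: "nat \<Rightarrow> complex"
  proof -
    have "suminf h = (\<Sum>\<^sub>\<infinity>n\<in>UNIV. h n)"
      using norm_summable_imp_has_sum[OF that(1) summable_sums[OF summable_norm_cancel[OF that(1)]]]
      by (simp add: infsumI)
    also have "\<dots> = (\<Sum>\<^sub>\<infinity>n\<in>{1..}. h n)"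
      by (rule infsum_cong_neutral) (auto simp: that(2) not_le less_eq_Suc_le)
    finally show ?thesis .
  qed
  have "Infinite_Set_Sum.abs_summable_on (\<lambda>(a, b). f a * g b) ({1..} \<times> {1..})"
    using abs_f abs_g by (intro abs_summable_on_product) (simp_all add: abs_summable_equivalent)
  hence prod_sm: "(\<lambda>(a, b). f a * g b) summable_on ({1..} \<times> {1..})"
    by (rule abs_summable_summable[OF abs_summable_equivalent[THEN iffD2]])
  \<comment> \<open>A number \<open>n\<close> together with a divisor \<open>d\<close> corresponds
    to the pair of factors \<open>(n div d, d)\<close>, with inverse
    \<open>(a, b) \<mapsto> (a * b, b)\<close>.\<close>
  have bij: "bij_betw (\<lambda>(n, d). (n div d, d)) (SIGMA n:{1..}. {d. d dvd n}) ({1..} \<times> ({1..} :: nat set))"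
  proof (rule bij_betwI[of _ _ _ "\<lambda>(a, b). (a * b, b)"])
    show "(\<lambda>(n :: nat, d). (n div d, d)) \<in> (SIGMA n:{1..}. {d. d dvd n}) \<rightarrow> {1..} \<times> {1..}"
    proof (rule Pi_I)
      fix x :: "nat \<times> nat" assume "x \<in> (SIGMA n:{1..}. {d. d dvd n})"
      then obtain n d where x: "x = (n, d)" "n \<ge> 1" "d dvd n" by auto
      hence d: "d > 0" by (auto intro!: Nat.gr0I)
      have "n div d > 0" using x d by (auto simp: div_greater_zero_iff dest: dvd_imp_le)
      with d show "(case x of (n, d) \<Rightarrow> (n div d, d)) \<in> {1..} \<times> {1..}"
        by (simp add: x Suc_le_eq)
    qed
  qed auto
  have sm: "(\<lambda>(n, d). f (n div d) * g d) summable_on (SIGMA n:{1..}. {d. d dvd n})"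
    using summable_on_reindex_bij_betw[OF bij, of "\<lambda>(a, b). f a * g b"] prod_sm
    by (simp add: case_prod_unfold)
  have "zeta s * (\<Sum>n. g n) = (\<Sum>\<^sub>\<infinity>n\<in>{1..}. f n) * (\<Sum>\<^sub>\<infinity>n\<in>{1..}. g n)"
    using nf ng by (simp add: zeta_eq_suminf s sumeq flip: f_def) (simp add: sumeq f_def g_def)
  also have "\<dots> = (\<Sum>\<^sub>\<infinity>(a, b)\<in>{1..} \<times> {1..}. f a * g b)"
    using infsum_Sigma'_banach[OF prod_sm] by (simp add: infsum_cmult_left' infsum_cmult_right')
  also have "\<dots> = (\<Sum>\<^sub>\<infinity>(n, d)\<in>(SIGMA n:{1..}. {d. d dvd n}). f (n div d) * g d)"
    using infsum_reindex_bij_betw[OF bij, of "\<lambda>(a, b). f a * g b"] by (simp add: case_prod_unfold)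
  also have "\<dots> = (\<Sum>\<^sub>\<infinity>n\<in>{1..}. \<Sum>\<^sub>\<infinity>d\<in>{d. d dvd n}. f (n div d) * g d)"
    using infsum_Sigma'_banach[OF sm] by simp
  also have "\<dots> = (\<Sum>\<^sub>\<infinity>n\<in>{1..}. of_real (ln (real n)) * of_nat n powr (-s))"
  proof (rule infsum_cong)
    fix n :: nat assume n: "n \<in> {1..}"
    hence fin: "finite {d. d dvd n}" by (intro finite_divisors_nat) auto
    have "(\<Sum>\<^sub>\<infinity>d\<in>{d. d dvd n}. f (n div d) * g d) = (\<Sum>d | d dvd n. f (n div d) * g d)"
      using fin by simp
    also have "\<dots> = (\<Sum>d | d dvd n. mangoldt d * of_nat n powr (-s))"
    proof (rule sum.cong)
      fix d assume "d \<in> {d. d dvd n}"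
      then obtain e where e: "n = e * d" by (metis mem_Collect_eq dvd_div_mult_self)
      hence "d > 0" "e > 0" using n by (auto intro!: Nat.gr0I)
      hence "(of_nat n :: complex) powr (-s) = of_nat e powr (-s) * of_nat d powr (-s)"
        unfolding e of_nat_mult by (intro powr_times_real) auto
      thus "f (n div d) * g d = mangoldt d * of_nat n powr (-s)"
        using \<open>d > 0\<close> by (simp add: f_def g_def e)
    qed simp
    also have "\<dots> = of_real (ln (real n)) * of_nat n powr (-s)"
      using n by (simp add: mangoldt_sum flip: sum_distrib_right)
    finally show "(\<Sum>\<^sub>\<infinity>d\<in>{d. d dvd n}. f (n div d) * g d) = of_real (ln (real n)) * of_nat n powr (-s)" .
  qed
  also have "\<dots> = (\<Sum>n. of_real (ln (real n)) * of_nat n powr (-s))"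
  proof (rule sumeq [symmetric])
    show "summable (\<lambda>n. norm (of_real (ln (real n)) * (of_nat n :: complex) powr (-s)))"
      by (rule summable_norm_ln_dirichlet) fact
  qed simp
  finally show ?thesis by (simp add: g_def)
qed

text \<open>The series \<open>G\<close> is a primitive of the logarithmic derivative of zeta, so
  \<open>zeta s * exp (- G s)\<close> has derivative 0 on a convex set. Its coefficients are
  nonnegative, which is what the 3-4-1 inequality rests on.\<close>

lemma zeta_eq_exp:
  obtains C :: complex and G where "C \<noteq> 0"
    "\<And>s. Re s > 1 \<Longrightarrow> zeta s = C * exp (G s)"
    "\<And>s. Re s > 1 \<Longrightarrow> (\<lambda>n. of_real (mangoldt n / ln (real n)) * of_nat n powr (-s)) sums G s"
proof -
  \<comment> \<open>At \<open>n = 0\<close> and \<open>n = 1\<close> the coefficient is 0, because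
    \<open>mangoldt\<close> vanishes there.\<close>
  define a where "a = (\<lambda>n. complex_of_real (mangoldt n / ln (real n)))"
  define G where "G = (\<lambda>s. \<Sum>n. a n * of_nat n powr (-s))"
  have a: "norm (a n) \<le> 1" for n
  proof (cases "n \<le> 1")
    case False
    thus ?thesis using mangoldt_le[of n]
      by (simp add: a_def norm_divide norm_of_real del: of_real_divide)
  qed (auto simp: a_def le_Suc_eq)
  have aln: "a n * of_real (ln (real n)) = mangoldt n" for n
    by (cases "n \<le> 1") (auto simp: a_def le_Suc_eq)
  have sG: "(\<lambda>n. a n * of_nat n powr (-s)) sums G s" if "Re s > 1" for s
    unfolding G_def by (intro summable_sums summable_norm_cancel[OF summable_dirichlet[OF a that]])
  have dG: "(G has_field_derivative - (\<Sum>n. mangoldt n * of_nat n powr (-s))) (at s)" if s: "Re s > 1" for s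
    using dirichlet_series_has_field_derivative[of a s, OF a s] suminf_minus[OF summable_norm_cancel[OF summable_mangoldt[OF s]]]
    unfolding aln by (simp add: G_def)
  have "\<exists>C. \<forall>s\<in>{s. Re s > 1}. zeta s * exp (- G s) = C"
  proof (rule has_field_derivative_zero_constant)
    show "convex {s. Re s > 1}" by (rule convex_halfspace_Re_gt)
    fix s assume "s \<in> {s. Re s > 1}"
    hence s: "Re s > 1" by simp
    have "summable (\<lambda>n. of_real (ln (real n)) * (of_nat n :: complex) powr (-s))"
      by (rule summable_norm_cancel[OF summable_norm_ln_dirichlet[OF s]])
    hence dz: "(zeta has_field_derivative - (zeta s * (\<Sum>n. mangoldt n * of_nat n powr (-s)))) (at s)"
      using zeta_has_field_derivative[OF s] by (simp add: zeta_times_mangoldt_series[OF s] suminf_minus)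
    have "((\<lambda>s. zeta s * exp (- G s)) has_field_derivative 0) (at s)"
      by (rule derivative_eq_intros dz dG[OF s] refl)+ (simp add: algebra_simps)
    thus "((\<lambda>s. zeta s * exp (- G s)) has_field_derivative 0) (at s within {s. Re s > 1})"
      by (rule has_field_derivative_at_within)
  qed
  then obtain C where C: "\<And>s. Re s > 1 \<Longrightarrow> zeta s * exp (- G s) = C" by auto
  have z: "zeta s = C * exp (G s)" if "Re s > 1" for s
    unfolding C[OF that, symmetric] by (simp add: mult.assoc flip: exp_add)
  \<comment> \<open>If \<open>C\<close> were 0, zeta would vanish at 2, although its series there
    has positive sum.\<close>
  have "C \<noteq> 0"
  proof
    assume "C = 0"
    hence "zeta 2 = 0" using z[of 2] by simp
    moreover have sm: "summable (\<lambda>n. (of_nat n :: complex) powr (-2))"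
      using summable_norm_cancel[OF summable_dirichlet[of "\<lambda>_. 1" 2]] by simp
    have Re2: "Re (of_nat n powr (-2)) = real n powr (-2)" for n
    proof -
      have "Complex 2 0 = 2" by (simp add: complex_eq_iff)
      thus ?thesis using Re_of_nat_powr_minus[of n 2 0] by simp
    qed
    hence "Re (zeta 2) = (\<Sum>n. real n powr (-2))"
      using zeta_eq_suminf[of 2] Re_suminf[OF sm] by simp
    moreover have "(\<Sum>n. real n powr (-2)) > 0"
      by (rule suminf_pos2[of _ 1]) (auto simp: summable_real_powr_iff)
    ultimately show False by simp
  qed
  from this z sG show ?thesis unfolding a_def by (rule that)
qed

lemma zeta_nonzero_Re_gt_1: "Re s > 1 \<Longrightarrow> zeta s \<noteq> 0"
  using zeta_eq_exp by (metis exp_not_eq_zero mult_eq_0_iff)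

text \<open>Dividing the convolution identity by zeta gives the Dirichlet series of the negative
  logarithmic derivative, and \<open>n powr (-s)\<close> has real part
  \<open>n powr (-\<sigma>) * cos (t * ln n)\<close>.\<close>

lemma Re_neg_logderiv_zeta_sums:
  assumes "\<sigma> > 1"
  shows "(\<lambda>n. mangoldt n * real n powr (-\<sigma>) * cos (t * ln (real n))) sums
           - Re (deriv zeta (Complex \<sigma> t) / zeta (Complex \<sigma> t))"
proof -
  define s where "s = Complex \<sigma> t"
  have s: "Re s > 1" using assms by (simp add: s_def)
  define L where "L = (\<Sum>n. mangoldt n * (of_nat n :: complex) powr (-s))"
  have "(\<lambda>n. mangoldt n * (of_nat n :: complex) powr (-s)) sums L"
    unfolding L_def by (intro summable_sums summable_norm_cancel[OF summable_mangoldt[OF s]])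
  hence "(\<lambda>n. Re (mangoldt n * (of_nat n :: complex) powr (-s))) sums Re L"
    by (rule sums_Re)
  also have "(\<lambda>n. Re (mangoldt n * (of_nat n :: complex) powr (-s))) =
      (\<lambda>n. mangoldt n * real n powr (-\<sigma>) * cos (t * ln (real n)))"
    using Re_of_nat_powr_minus[of _ \<sigma> t] by (simp add: s_def fun_eq_iff)
  finally have "(\<lambda>n. mangoldt n * real n powr (-\<sigma>) * cos (t * ln (real n))) sums Re L" .
  moreover have "deriv zeta s = - (zeta s * L)"
  proof -
    have "summable (\<lambda>n. of_real (ln (real n)) * (of_nat n :: complex) powr (-s))"
      by (rule summable_norm_cancel[OF summable_norm_ln_dirichlet[OF s]])
    thus ?thesis
      using zeta_times_mangoldt_series[OF s] DERIV_imp_deriv[OF zeta_has_field_derivative[OF s]]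
      by (simp add: suminf_minus L_def)
  qed
  ultimately show ?thesis
    using zeta_nonzero_Re_gt_1[OF s] by (simp only: s_def) simp
qed

section \<open>The 3-4-1 inequality for zeta\<close>

lemma three_four_one_nonneg: "3 + 4 * cos x + cos (2 * x) \<ge> (0 :: real)"
proof -
  have "3 + 4 * cos x + cos (2 * x) = 2 * (1 + cos x)\<^sup>2"
    unfolding cos_double_cos by (simp add: power2_eq_square algebra_simps)
  thus ?thesis by simp
qed

text \<open>Taking logarithms, the product becomes a series with nonnegative coefficients times
  \<open>3 + 4 * cos x + cos (2 * x)\<close>. The constant is the eighth power of
  \<open>norm C\<close>, one factor for each of the 3 + 4 + 1 zeta values.\<close>

lemma zeta_three_four_one:
  obtains q where "q > 0" "\<And>\<sigma> t. \<sigma> > 1 \<Longrightarrow>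
     q \<le> norm (zeta (of_real \<sigma>)) ^ 3 * norm (zeta (Complex \<sigma> t)) ^ 4 * norm (zeta (Complex \<sigma> (2 * t)))"
proof -
  obtain C G where C: "C \<noteq> 0"
    and z: "\<And>s. Re s > 1 \<Longrightarrow> zeta s = C * exp (G s)"
    and G: "\<And>s. Re s > 1 \<Longrightarrow> (\<lambda>n. of_real (mangoldt n / ln (real n)) * of_nat n powr (-s)) sums G s"
    using zeta_eq_exp by blast
  have "norm C ^ 8 \<le> norm (zeta (of_real \<sigma>)) ^ 3 * norm (zeta (Complex \<sigma> t)) ^ 4 * norm (zeta (Complex \<sigma> (2 * t)))"
    if \<sigma>: "\<sigma> > 1" for \<sigma> t
  proof -
    define b where "b = (\<lambda>n. mangoldt n / ln (real n) * real n powr (-\<sigma>))"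
    have b: "b n \<ge> 0" for n
      unfolding b_def by (cases "n = 0") (auto intro!: mult_nonneg_nonneg divide_nonneg_nonneg mangoldt_nonneg)
    have ReG: "(\<lambda>n. b n * cos (t * ln (real n))) sums Re (G (Complex \<sigma> t))" for t
    proof -
      have "(\<lambda>n. Re (of_real (mangoldt n / ln (real n)) * of_nat n powr (- Complex \<sigma> t))) sums Re (G (Complex \<sigma> t))"
        using \<sigma> by (intro sums_Re G) simp
      moreover have "Re (of_real (mangoldt n / ln (real n)) * of_nat n powr (- Complex \<sigma> t)) = b n * cos (t * ln (real n))" for n
        using Re_of_nat_powr_minus[of n \<sigma> t] by (simp add: b_def del: of_real_divide)
      ultimately show ?thesis by simp
    qed
    have sm: "(\<lambda>n. 3 * (b n * cos (0 * ln (real n))) + 4 * (b n * cos (t * ln (real n))) + b n * cos (2 * t * ln (real n)))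
       sums (3 * Re (G (Complex \<sigma> 0)) + 4 * Re (G (Complex \<sigma> t)) + Re (G (Complex \<sigma> (2 * t))))"
      by (intro sums_add sums_mult ReG)
    have nn: "3 * (b n * cos (0 * ln (real n))) + 4 * (b n * cos (t * ln (real n))) + b n * cos (2 * t * ln (real n)) \<ge> 0" for n
      using mult_nonneg_nonneg[OF b three_four_one_nonneg, of n "t * ln (real n)"] by (simp add: algebra_simps)
    have "3 * Re (G (Complex \<sigma> 0)) + 4 * Re (G (Complex \<sigma> t)) + Re (G (Complex \<sigma> (2 * t))) \<ge> 0"
      by (rule sums_le[OF nn sums_zero sm])
    hence "norm C ^ 8 * 1 \<le> norm C ^ 8 * exp (3 * Re (G (Complex \<sigma> 0)) + 4 * Re (G (Complex \<sigma> t)) + Re (G (Complex \<sigma> (2 * t))))"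
      by (intro mult_left_mono) auto
    also have "\<dots> = (norm C * exp (Re (G (Complex \<sigma> 0)))) ^ 3 * (norm C * exp (Re (G (Complex \<sigma> t)))) ^ 4 * (norm C * exp (Re (G (Complex \<sigma> (2 * t)))))"
    proof -
      have e1: "exp (3 * a + 4 * b + c) = exp a ^ 3 * exp b ^ 4 * exp c" for a b c :: real
        using exp_of_nat_mult[of 3 a] exp_of_nat_mult[of 4 b] by (simp add: exp_add)
      have e2: "c ^ 8 * (x ^ 3 * y ^ 4 * z) = (c * x) ^ 3 * (c * y) ^ 4 * (c * z)" for c x y z :: real
        by (simp add: eval_nat_numeral)
      show ?thesis unfolding e1 by (rule e2)
    qed
    finally show ?thesis using \<sigma> by (simp add: z norm_mult complex_of_real_def)
  qed
  thus ?thesis using C by (intro that[of "norm C ^ 8"]) auto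
qed

section \<open>Growth of zeta near the 1-line\<close>

text \<open>On the half-plane \<open>Re w > 0\<close> this is \<open>(w - 1) * zeta w\<close> with
  the pole removed, in the form given by the recurrence for the zeta series at
  \<open>k = 0\<close>.\<close>

definition zeta_reg :: "complex \<Rightarrow> complex" where
  "zeta_reg w = 1 + (\<Sum>m. zeta_rem 0 m w)"

lemma holomorphic_zeta_reg: "zeta_reg holomorphic_on {w. Re w > 0}"
  using holomorphic_suminf_zeta_rem[of 0] unfolding zeta_reg_def by (auto intro!: holomorphic_intros)

lemma zeta_rem_0:
  "zeta_rem 0 m w = of_nat (Suc (Suc m)) powr (1 - w) - of_nat (Suc m) powr (1 - w) -
     (1 - w) * of_nat (Suc m) powr (- w)"
proof -
  have *: "(\<Sum>j\<le>Suc 0. ((1 - w) gchoose j) * x powr (1 - w - of_nat j)) = x powr (1 - w) + (1 - w) * x powr (- w)" for x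
    by simp
  show ?thesis unfolding zeta_rem_def * by (rule diff_diff_eq [symmetric])
qed

lemma zeta_reg_1: "zeta_reg 1 = 1"
proof -
  have "zeta_rem 0 m 1 = 0" for m
    using of_nat_neq_0[of m, where 'a = complex] of_nat_neq_0[of "Suc m", where 'a = complex]
    unfolding zeta_rem_0 by (simp del: of_nat_Suc)
  thus ?thesis by (simp add: zeta_reg_def)
qed

text \<open>The recurrence gives the identity for \<open>Re w > 1\<close>, and the punctured
  half-plane is connected. At \<open>w = 1\<close> it fails: the product is 0 there, but
  \<open>zeta_reg\<close> is 1.\<close>

lemma zeta_reg_eq:
  assumes "Re w > 0" "w \<noteq> 1"
  shows "zeta_reg w = (w - 1) * zeta w"
proof (rule analytic_continuation_open[of "{s. Re s > 1}" "{s. Re s > 0} - {1}" zeta_reg "\<lambda>w. (w - 1) * zeta w"])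
  show "open {s. 1 < Re s}" by (rule open_halfspace_Re_gt)
  show "open ({s. 0 < Re s} - {1})" by (intro open_delete open_halfspace_Re_gt)
  show "{s. 1 < Re s} \<noteq> {}" by (auto intro!: exI[of _ 2])
  show "connected ({s. 0 < Re s} - {1})"
    by (intro connected_open_delete open_halfspace_Re_gt convex_connected convex_halfspace_Re_gt) simp
  show "zeta_reg holomorphic_on {s. 0 < Re s} - {1}"
    using holomorphic_zeta_reg by (rule holomorphic_on_subset) auto
  show "(\<lambda>w. (w - 1) * zeta w) holomorphic_on {s. 0 < Re s} - {1}"
    by (intro holomorphic_intros holomorphic_on_subset[OF holomorphic_zeta]) auto
  show "zeta_reg z = (z - 1) * zeta z" if "z \<in> {s. 1 < Re s}" for z
  proof -
    have z: "Re z > 1" using that by simp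
    have "(z - 1) * (\<Sum>n. (of_nat (Suc n) :: complex) powr (-z)) = zeta_reg z"
      using zeta_series_recurrence[OF z, of 0] by (simp add: zeta_reg_def)
    thus ?thesis using zeta_eq_series[OF z] by (simp add: powr_minus divide_inverse del: of_nat_Suc)
  qed
qed (use assms in auto)

text \<open>The first \<open>M\<close> remainder terms telescope, so a partial sum of the Dirichlet
  series comes out explicitly. Choosing \<open>M\<close> of the size of \<open>w\<close> then gives
  growth bounds up to and slightly beyond the 1-line.\<close>

lemma zeta_reg_split:
  assumes "Re w > 0"
  shows "zeta_reg w = of_nat (Suc M) powr (1 - w) + (w - 1) * (\<Sum>m<M. of_nat (Suc m) powr (- w)) +
           (\<Sum>m. zeta_rem 0 (m + M) w)"
proof -
  have "summable (\<lambda>m. zeta_rem 0 m w)"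
  proof (rule summable_norm_cancel, rule summable_comparison_test)
    show "summable (\<lambda>m. norm (\<Prod>l<Suc (Suc 0). 1 - w - of_nat l) * real (Suc m) powr (- 1 - real 0 - Re w))"
      using assms by (intro summable_mult summable_nat_powr) auto
    show "\<exists>N. \<forall>m\<ge>N. norm (norm (zeta_rem 0 m w)) \<le>
        norm (\<Prod>l<Suc (Suc 0). 1 - w - of_nat l) * real (Suc m) powr (- 1 - real 0 - Re w)"
      using zeta_rem_bound[of 0 w] assms by (auto simp del: prod.lessThan_Suc of_nat_Suc)
  qed
  hence "zeta_reg w = 1 + (\<Sum>m<M. zeta_rem 0 m w) + (\<Sum>m. zeta_rem 0 (m + M) w)"
    unfolding zeta_reg_def by (subst suminf_split_initial_segment[of _ M]) simp_all
  also have "1 + (\<Sum>m<M. zeta_rem 0 m w) =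
      of_nat (Suc M) powr (1 - w) + (w - 1) * (\<Sum>m<M. of_nat (Suc m) powr (- w))"
    by (induction M) (simp_all add: zeta_rem_0 algebra_simps del: of_nat_Suc, simp)
  finally show ?thesis .
qed

lemma zeta_reg_growth:
  assumes r: "0 < r" "r < 1 / 2"
  obtains K where "K > 0" "\<And>w. Re w \<ge> 1 - r \<Longrightarrow> norm (zeta_reg w) \<le> K * (norm w + 3) powr (1 + 2 * r)"
proof -
  define Z where "Z = (\<Sum>m. real (Suc m) powr (- 1 - r))"
  have sZ: "summable (\<lambda>m. real (Suc m) powr (- 1 - r))" using r by (intro summable_nat_powr) auto
  have Z: "Z \<ge> 0" unfolding Z_def by (intro suminf_nonneg sZ) auto
  have partial: "(\<Sum>m<M. real (Suc m) powr (- 1 - r)) \<le> Z" for M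
    unfolding Z_def by (rule sum_le_suminf[OF sZ]) auto
  have "norm (zeta_reg w) \<le> (1 + 2 * Z) * (norm w + 3) powr (1 + 2 * r)" if w: "Re w \<ge> 1 - r" for w
  proof -
    \<comment> \<open>Each remainder term carries the factor \<open>norm (1 - w) * norm w\<close>;
      cutting at \<open>M \<ge> norm w\<close> lets the decay of the terms beyond \<open>M\<close>
      compensate for the second factor.\<close>
    define M where "M = nat \<lceil>norm w\<rceil> + 1"
    define X where "X = norm w + 3"
    have M: "real M \<ge> norm w" "M \<ge> 1" unfolding M_def by linarith+
    have M': "real (Suc M) \<le> X" unfolding M_def X_def using norm_ge_zero[of w] by linarith
    have X: "X \<ge> 3" "norm (1 - w) \<le> X" "norm (w - 1) \<le> X"
      using norm_triangle_ineq4[of 1 w] norm_triangle_ineq4[of w 1] by (auto simp: X_def)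
    have "norm (of_nat (Suc M) powr (1 - w)) = real (Suc M) powr (1 - Re w)"
      using norm_nat_powr[of M "1 - w"] by simp
    also have "\<dots> \<le> real (Suc M) powr (1 + 2 * r)"
      using w r by (intro powr_mono) auto
    also have "\<dots> \<le> X powr (1 + 2 * r)"
      using M' r by (intro powr_mono2) auto
    finally have 1: "norm (of_nat (Suc M) powr (1 - w)) \<le> X powr (1 + 2 * r)" .
    have "norm (\<Sum>m<M. of_nat (Suc m) powr (- w)) \<le> (\<Sum>m<M. X powr (2 * r) * real (Suc m) powr (- 1 - r))"
    proof (rule sum_norm_le)
      fix m assume m: "m \<in> {..<M}"
      have "norm (of_nat (Suc m) powr (- w)) = real (Suc m) powr (- Re w)"
        using norm_nat_powr[of m "- w"] by simp
      also have "\<dots> \<le> real (Suc m) powr (2 * r + (- 1 - r))"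
        using w by (intro powr_mono) auto
      also have "\<dots> = real (Suc m) powr (2 * r) * real (Suc m) powr (- 1 - r)"
        by (rule powr_add)
      also have "\<dots> \<le> X powr (2 * r) * real (Suc m) powr (- 1 - r)"
        using m M' r by (intro mult_right_mono powr_mono2) auto
      finally show "norm (of_nat (Suc m) powr (- w)) \<le> X powr (2 * r) * real (Suc m) powr (- 1 - r)" .
    qed
    also have "\<dots> \<le> X powr (2 * r) * Z"
      unfolding sum_distrib_left [symmetric] by (intro mult_left_mono partial) auto
    finally have "norm ((w - 1) * (\<Sum>m<M. of_nat (Suc m) powr (- w))) \<le> X * (X powr (2 * r) * Z)"
      unfolding norm_mult using X Z by (intro mult_mono) auto
    also have "\<dots> = X powr (1 + 2 * r) * Z" using X by (simp add: powr_add)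
    finally have 2: "norm ((w - 1) * (\<Sum>m<M. of_nat (Suc m) powr (- w))) \<le> X powr (1 + 2 * r) * Z" .
    have rem: "norm (zeta_rem 0 (m + M) w) \<le> X powr (1 + 2 * r) * real (Suc m) powr (- 1 - r)" for m
    proof -
      have "norm (zeta_rem 0 (m + M) w) \<le> norm (\<Prod>l<Suc (Suc 0). 1 - w - of_nat l) * real (Suc (m + M)) powr (- 1 - real 0 - Re w)"
        using w r by (intro zeta_rem_bound) auto
      also have "\<dots> = norm (1 - w) * norm w * real (Suc (m + M)) powr (- 1 - Re w)"
        by (simp add: norm_mult)
      \<comment> \<open>Here \<open>- 1 - Re w \<le> r - 2 = (2 * r - 1) + (- 1 - r)\<close>: the
        first exponent turns the factor \<open>M\<close> into \<open>M powr (2 * r)\<close>, and the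
        second makes the sum over \<open>m\<close> converge.\<close>
      also have "\<dots> \<le> X * real M * real (Suc (m + M)) powr ((2 * r - 1) + (- 1 - r))"
        using w X M by (intro mult_mono powr_mono) auto
      also have "\<dots> = X * real M * (real (Suc (m + M)) powr (2 * r - 1) * real (Suc (m + M)) powr (- 1 - r))"
        by (subst powr_add) simp
      also have "\<dots> \<le> X * real M * (real M powr (2 * r - 1) * real (Suc m) powr (- 1 - r))"
        using w X M r by (intro mult_mono mult_left_mono powr_mono2') auto
      also have "\<dots> = X * (real M powr 1 * real M powr (2 * r - 1)) * real (Suc m) powr (- 1 - r)"
        by (simp add: mult_ac)
      also have "real M powr 1 * real M powr (2 * r - 1) = real M powr (2 * r)"
        by (subst powr_add [symmetric]) simp
      also have "X * real M powr (2 * r) * real (Suc m) powr (- 1 - r) \<le> X * X powr (2 * r) * real (Suc m) powr (- 1 - r)"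
        using X M M' r by (intro mult_right_mono mult_left_mono powr_mono2) auto
      also have "X * X powr (2 * r) = X powr (1 + 2 * r)" using X by (simp add: powr_add)
      finally show ?thesis .
    qed
    have 3: "norm (\<Sum>m. zeta_rem 0 (m + M) w) \<le> X powr (1 + 2 * r) * Z"
      unfolding Z_def suminf_mult[OF sZ, symmetric]
      by (rule norm_suminf_le) (use rem sZ in \<open>auto intro: summable_mult\<close>)
    have "norm (a + b + c) \<le> norm a + norm b + norm c" for a b c :: complex
      by (intro order.trans[OF norm_triangle_ineq] add_right_mono norm_triangle_ineq)
    hence "norm (zeta_reg w) \<le> norm (of_nat (Suc M) powr (1 - w)) +
        norm ((w - 1) * (\<Sum>m<M. of_nat (Suc m) powr (- w))) + norm (\<Sum>m. zeta_rem 0 (m + M) w)"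
      using zeta_reg_split[of w M] w r by simp
    with 1 2 3 have "norm (zeta_reg w) \<le> X powr (1 + 2 * r) + X powr (1 + 2 * r) * Z + X powr (1 + 2 * r) * Z"
      by linarith
    thus ?thesis by (simp add: X_def algebra_simps)
  qed
  with Z show ?thesis by (intro that[of "1 + 2 * Z"]) auto
qed

text \<open>Bounding zeta on discs of radius \<open>r\<close> that reach to the left of the 1-line
  yields the bound for the derivative by Cauchy's inequality.\<close>

lemma zeta_growth:
  fixes e :: real
  assumes e: "e > 0"
  obtains K where "K \<ge> 1"
    "\<And>\<sigma> t. 1 \<le> \<sigma> \<Longrightarrow> \<sigma> \<le> 2 \<Longrightarrow> t \<ge> 2 \<Longrightarrow> norm (zeta (Complex \<sigma> t)) \<le> K * t powr e"
    "\<And>\<sigma> t. 1 \<le> \<sigma> \<Longrightarrow> \<sigma> \<le> 2 \<Longrightarrow> t \<ge> 2 \<Longrightarrow> norm (deriv zeta (Complex \<sigma> t)) \<le> K * t powr e"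
proof -
  define r where "r = min (e / 2) (1 / 4)"
  have r: "0 < r" "r < 1 / 2" "r \<le> 1 / 4" "2 * r \<le> e" using e by (auto simp: r_def)
  obtain K where K: "K > 0" "\<And>w. Re w \<ge> 1 - r \<Longrightarrow> norm (zeta_reg w) \<le> K * (norm w + 3) powr (1 + 2 * r)"
    using zeta_reg_growth[OF r(1,2)] by blast
  \<comment> \<open>The factor 98 is \<open>7^2 * 2\<close>: the 7 comes from
    \<open>norm w + 3 \<le> 7 * y\<close> with exponent at most 2, the 2 from
    \<open>(2 * t) powr (2 * r)\<close>. The summand 1 ensures \<open>B \<ge> 1\<close>.\<close>
  define B where "B = 98 * K + 1"
  have zeta_le: "norm (zeta w) \<le> B * t powr e"
    if w: "w \<in> cball (Complex \<sigma> t) r" and st: "1 \<le> \<sigma>" "\<sigma> \<le> 2" "t \<ge> 2" for w \<sigma> t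
  proof -
    define y where "y = Im w"
    have "\<bar>Re (Complex \<sigma> t - w)\<bar> \<le> r" "\<bar>Im (Complex \<sigma> t - w)\<bar> \<le> r"
      using w abs_Re_le_cmod[of "Complex \<sigma> t - w"] abs_Im_le_cmod[of "Complex \<sigma> t - w"]
      by (auto simp: dist_norm)
    hence b: "Re w \<ge> 1 - r" "Re w \<le> 3" "y \<ge> 1" "y \<le> 2 * t"
      using st r unfolding y_def by (auto simp: abs_le_iff)
    have "norm w \<le> \<bar>Re w\<bar> + \<bar>Im w\<bar>" by (rule cmod_le)
    hence nw: "norm w + 3 \<le> 7 * y" using b r by (auto simp: y_def)
    have ny: "y \<le> norm (w - 1)" using abs_Im_le_cmod[of "w - 1"] b by (simp add: y_def)
    have "y * norm (zeta w) \<le> norm (w - 1) * norm (zeta w)"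
      by (intro mult_right_mono ny) auto
    also have "\<dots> = norm (zeta_reg w)" using zeta_reg_eq[of w] b r by (force simp: norm_mult y_def)
    also have "\<dots> \<le> K * (norm w + 3) powr (1 + 2 * r)" using K b by blast
    also have "\<dots> \<le> K * (7 * y) powr (1 + 2 * r)"
      using K r nw by (intro mult_left_mono powr_mono2) (auto intro: add_nonneg_nonneg)
    also have "\<dots> = y * (K * (7 powr (1 + 2 * r) * y powr (2 * r)))"
      using b by (simp add: powr_mult powr_add)
    finally have "norm (zeta w) \<le> K * (7 powr (1 + 2 * r) * y powr (2 * r))"
      using b by simp
    also have "\<dots> \<le> K * (7 powr 2 * (2 * t) powr (2 * r))"
      using K r b by (intro mult_left_mono mult_mono powr_mono powr_mono2) auto
    also have "(2 * t) powr (2 * r) = 2 powr (2 * r) * t powr (2 * r)"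
      using st by (simp add: powr_mult)
    also have "K * (7 powr 2 * (2 powr (2 * r) * t powr (2 * r))) \<le> K * (7 powr 2 * (2 powr 1 * t powr e))"
      using K r st by (intro mult_left_mono mult_mono powr_mono) auto
    also have "\<dots> \<le> B * t powr e" using st by (simp add: B_def algebra_simps)
    finally show ?thesis .
  qed
  have deriv_le: "norm (deriv zeta (Complex \<sigma> t)) \<le> B / r * t powr e"
    if st: "1 \<le> \<sigma>" "\<sigma> \<le> 2" "t \<ge> 2" for \<sigma> t
  proof -
    have sub: "cball (Complex \<sigma> t) r \<subseteq> - {1}"
    proof -
      have "1 \<notin> cball (Complex \<sigma> t) r"
        using abs_Im_le_cmod[of "Complex \<sigma> t - 1"] st r by (auto simp: dist_norm)
      thus ?thesis by auto
    qed
    have "norm ((deriv ^^ 1) zeta (Complex \<sigma> t)) \<le> fact 1 * (B * t powr e) / r ^ 1"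
    proof (rule Cauchy_inequality)
      show "zeta holomorphic_on ball (Complex \<sigma> t) r"
        using sub by (intro holomorphic_on_subset[OF holomorphic_zeta]) auto
      show "continuous_on (cball (Complex \<sigma> t) r) zeta"
        using sub by (intro holomorphic_on_imp_continuous_on holomorphic_on_subset[OF holomorphic_zeta])
      show "norm (zeta x) \<le> B * t powr e" if "norm (Complex \<sigma> t - x) = r" for x
        using that st by (intro zeta_le) (auto simp: dist_norm)
    qed (use r in auto)
    thus ?thesis by simp
  qed
  define K' where "K' = B / r"
  have BK: "B \<le> K'" "K' \<ge> 1"
  proof -
    have "B * r \<le> B * 1" using r K by (intro mult_left_mono) (auto simp: B_def)
    thus "B \<le> K'" using r by (simp add: K'_def le_divide_eq)
    thus "K' \<ge> 1" using K by (simp add: B_def)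
  qed
  show ?thesis
  proof (rule that[of K'])
    show "norm (zeta (Complex \<sigma> t)) \<le> K' * t powr e" if "1 \<le> \<sigma>" "\<sigma> \<le> 2" "t \<ge> 2" for \<sigma> t
      using zeta_le[of "Complex \<sigma> t" \<sigma> t] that r mult_right_mono[OF BK(1), of "t powr e"]
      by (simp add: order.trans)
  qed (use BK deriv_le in \<open>auto simp: K'_def\<close>)
qed

section \<open>Lower bounds for zeta and non-vanishing on the 1-line\<close>

lemma zeta_has_deriv: "w \<noteq> 1 \<Longrightarrow> (zeta has_field_derivative deriv zeta w) (at w)"
  using holomorphic_zeta by (intro holomorphic_derivI[of _ "- {1}"]) auto

text \<open>At distance at least \<open>d\<close> from the 1-line the 3-4-1 inequality bounds zeta
  from below, since the pole costs only \<open>(K / d) ^ 3\<close>; closer to the line, the bound on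
  the derivative carries this over. Keeping \<open>X\<close> general serves both a fixed height and
  heights tending to infinity.\<close>

lemma zeta_lower_bound:
  obtains c where "c > 0"
    "\<And>X t \<sigma>. X \<ge> 1 \<Longrightarrow> t > 0 \<Longrightarrow>
       (\<And>\<sigma>. 1 \<le> \<sigma> \<Longrightarrow> \<sigma> \<le> 2 \<Longrightarrow> norm (zeta (Complex \<sigma> (2 * t))) \<le> X) \<Longrightarrow>
       (\<And>\<sigma>. 1 \<le> \<sigma> \<Longrightarrow> \<sigma> \<le> 2 \<Longrightarrow> norm (deriv zeta (Complex \<sigma> t)) \<le> X) \<Longrightarrow>
       1 \<le> \<sigma> \<Longrightarrow> \<sigma> \<le> 2 \<Longrightarrow> norm (zeta (Complex \<sigma> t)) \<ge> c / X ^ 4"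
proof -
  obtain q where q: "q > 0" and tfo: "\<And>\<sigma> t. \<sigma> > 1 \<Longrightarrow>
     q \<le> norm (zeta (of_real \<sigma>)) ^ 3 * norm (zeta (Complex \<sigma> t)) ^ 4 * norm (zeta (Complex \<sigma> (2 * t)))"
    using zeta_three_four_one by blast
  have "continuous_on {1..2} (\<lambda>\<sigma>. zeta_reg (of_real \<sigma>))"
    by (intro continuous_on_compose2[OF holomorphic_on_imp_continuous_on[OF holomorphic_zeta_reg]] continuous_intros) auto
  hence "bounded ((\<lambda>\<sigma>. zeta_reg (of_real \<sigma>)) ` {1..2})"
    by (intro compact_imp_bounded compact_continuous_image) auto
  then obtain K where K: "K > 0" "\<And>\<sigma>. 1 \<le> \<sigma> \<Longrightarrow> \<sigma> \<le> 2 \<Longrightarrow> norm (zeta_reg (of_real \<sigma>)) \<le> K"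
    unfolding bounded_pos by (metis atLeastAtMost_iff imageI)
  have zeta_real: "norm (zeta (of_real \<sigma>)) \<le> K / (\<sigma> - 1)" if "1 < \<sigma>" "\<sigma> \<le> 2" for \<sigma>
  proof -
    have "of_real \<sigma> \<noteq> (1 :: complex)" using that by simp
    hence "zeta_reg (of_real \<sigma>) = (of_real \<sigma> - 1) * zeta (of_real \<sigma>)" using that by (intro zeta_reg_eq) auto
    moreover have "norm (of_real \<sigma> - 1 :: complex) = \<sigma> - 1"
      using norm_of_real[of "\<sigma> - 1", where 'a = complex] that by simp
    ultimately have "norm (zeta_reg (of_real \<sigma>)) = (\<sigma> - 1) * norm (zeta (of_real \<sigma>))"
      by (simp add: norm_mult)
    thus ?thesis using K(2)[of \<sigma>] that by (simp add: field_simps)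
  qed
  \<comment> \<open>Capping at 1 keeps \<open>d \<le> 1\<close> below, so that \<open>1 + d\<close>
    stays in the range where the bounds hold.\<close>
  define q' where "q' = min 1 (q / K ^ 3)"
  have q': "q' > 0" "q' \<le> 1" "q' * K ^ 3 \<le> q" using q K by (auto simp: q'_def min_def field_simps)
  show ?thesis
  proof (rule that[of "q' / 16"])
    fix X t \<sigma> :: real
    assume X: "X \<ge> 1" and t: "t > 0"
      and X1: "\<And>\<sigma>. 1 \<le> \<sigma> \<Longrightarrow> \<sigma> \<le> 2 \<Longrightarrow> norm (zeta (Complex \<sigma> (2 * t))) \<le> X"
      and X2: "\<And>\<sigma>. 1 \<le> \<sigma> \<Longrightarrow> \<sigma> \<le> 2 \<Longrightarrow> norm (deriv zeta (Complex \<sigma> t)) \<le> X"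
      and \<sigma>: "1 \<le> \<sigma>" "\<sigma> \<le> 2"
    \<comment> \<open>This choice makes \<open>(2 * d * X) ^ 4 * X = q' * d ^ 3\<close>. The bound
      at distance \<open>d\<close> is then \<open>2 * d * X\<close>, twice the variation
      \<open>d * X\<close> that the derivative permits on the way to the line.\<close>
    define d where "d = q' / (16 * X ^ 5)"
    have X5: "X ^ 5 \<ge> 1" using X by (rule one_le_power)
    have "q' \<le> 16 * X ^ 5" "16 * X ^ 5 > 0" using q' X5 by linarith+
    hence d: "d > 0" "d \<le> 1" unfolding d_def using q' by (simp_all only: divide_pos_pos divide_le_eq_1_pos)
    have far: "norm (zeta (Complex \<sigma> t)) \<ge> 2 * d * X" if s: "1 + d \<le> \<sigma>" "\<sigma> \<le> 2" for \<sigma>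
    proof -
      define n where "n = norm (zeta (Complex \<sigma> t)) ^ 4"
      have s1: "\<sigma> > 1" using s d by simp
      have "q \<le> norm (zeta (of_real \<sigma>)) ^ 3 * n * norm (zeta (Complex \<sigma> (2 * t)))"
        unfolding n_def by (rule tfo) fact
      also have "\<dots> \<le> (K / (\<sigma> - 1)) ^ 3 * n * X"
      proof -
        have "norm (zeta (of_real \<sigma>)) ^ 3 \<le> (K / (\<sigma> - 1)) ^ 3"
          by (intro power_mono zeta_real s1 s) auto
        moreover have "n \<ge> 0" "K / (\<sigma> - 1) \<ge> 0" using K s1 by (auto simp: n_def)
        moreover have "norm (zeta (Complex \<sigma> (2 * t))) \<le> X" using X1 s s1 by simp
        ultimately show ?thesis by (intro mult_mono) auto
      qed
      also have "\<dots> \<le> (K / d) ^ 3 * n * X"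
        using s d K X by (intro mult_right_mono power_mono divide_left_mono) (auto simp: n_def)
      finally have "q' * K ^ 3 \<le> (K / d) ^ 3 * n * X" using q' by linarith
      hence "q' * d ^ 3 \<le> n * X" using K d by (simp add: power_divide field_simps)
      moreover have "16 * X ^ 5 * d = q'" using X by (simp add: d_def)
      moreover have "(2 * d * X) ^ 4 * X = (16 * X ^ 5 * d) * d ^ 3"
        by (simp add: power_mult_distrib eval_nat_numeral)
      ultimately have "(2 * d * X) ^ 4 * X \<le> n * X" by simp
      hence "(2 * d * X) ^ 4 \<le> n" using X by simp
      thus ?thesis unfolding n_def by (rule power_le_imp_le_base[of _ 3, simplified]) auto
    qed
    have "norm (zeta (Complex \<sigma> t)) \<ge> d * X"
    proof (cases "1 + d \<le> \<sigma>")
      case True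
      have "d * X \<ge> 0" using d X by simp
      thus ?thesis using far[OF True \<sigma>(2)] by linarith
    next
      case False
      \<comment> \<open>The horizontal segment from 1 to 2 at height \<open>t\<close>, written as an
        intersection of half-planes to make its convexity evident.\<close>
      define S where "S = {z. Re z \<ge> 1} \<inter> {z. Re z \<le> 2} \<inter> {z. Im z \<ge> t} \<inter> {z. Im z \<le> t}"
      have S: "z \<noteq> 1" "1 \<le> Re z" "Re z \<le> 2" "z = Complex (Re z) t" if "z \<in> S" for z
        using that t by (auto simp: S_def complex_eq_iff)
      have "norm (zeta (Complex (1 + d) t) - zeta (Complex \<sigma> t)) \<le> X * norm (Complex (1 + d) t - Complex \<sigma> t)"
      proof (rule field_differentiable_bound)
        show "convex S" unfolding S_def
          by (intro convex_Int convex_halfspace_Re_ge convex_halfspace_Re_le convex_halfspace_Im_ge convex_halfspace_Im_le)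
        show "(zeta has_field_derivative deriv zeta z) (at z within S)" if "z \<in> S" for z
          by (rule has_field_derivative_at_within[OF zeta_has_deriv]) (use S[OF that] in auto)
        show "norm (deriv zeta z) \<le> X" if "z \<in> S" for z
          using X2[of "Re z"] S[OF that] by metis
      qed (use d \<sigma> in \<open>auto simp: S_def\<close>)
      also have "Complex (1 + d) t - Complex \<sigma> t = of_real (1 + d - \<sigma>)" by (simp add: complex_eq_iff)
      also have "norm (of_real (1 + d - \<sigma>) :: complex) = 1 + d - \<sigma>" using False unfolding norm_of_real by simp
      also have "X * (1 + d - \<sigma>) \<le> X * d" using X \<sigma> by (intro mult_left_mono) auto
      finally have "norm (zeta (Complex (1 + d) t)) - norm (zeta (Complex \<sigma> t)) \<le> X * d"
        using norm_triangle_ineq2 order.trans by blast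
      thus ?thesis using far[of "1 + d"] d by (simp add: mult.commute)
    qed
    also have "d * X = q' / 16 / X ^ 4" using X by (simp add: d_def eval_nat_numeral)
    finally show "q' / 16 / X ^ 4 \<le> norm (zeta (Complex \<sigma> t))" .
  qed (use q' in auto)
qed

text \<open>At a fixed height zeta and its derivative are bounded on compact segments, so the
  preceding lower bound applies with a constant \<open>X\<close>.\<close>

lemma zeta_nonzero_on_line:
  assumes "t > 0"
  shows "zeta (Complex 1 t) \<noteq> 0"
proof -
  obtain c where c: "c > 0"
    "\<And>X t \<sigma>. X \<ge> 1 \<Longrightarrow> t > 0 \<Longrightarrow>
       (\<And>\<sigma>. 1 \<le> \<sigma> \<Longrightarrow> \<sigma> \<le> 2 \<Longrightarrow> norm (zeta (Complex \<sigma> (2 * t))) \<le> X) \<Longrightarrow>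
       (\<And>\<sigma>. 1 \<le> \<sigma> \<Longrightarrow> \<sigma> \<le> 2 \<Longrightarrow> norm (deriv zeta (Complex \<sigma> t)) \<le> X) \<Longrightarrow>
       1 \<le> \<sigma> \<Longrightarrow> \<sigma> \<le> 2 \<Longrightarrow> norm (zeta (Complex \<sigma> t)) \<ge> c / X ^ 4"
    using zeta_lower_bound by metis
  have bdd: "\<exists>B. \<forall>\<sigma>. 1 \<le> \<sigma> \<and> \<sigma> \<le> 2 \<longrightarrow> norm (f (Complex \<sigma> y)) \<le> B"
    if f: "f holomorphic_on (- {1})" and y: "y > 0" for f y
  proof -
    have "(\<lambda>\<sigma>. Complex \<sigma> y) = (\<lambda>\<sigma>. of_real \<sigma> + \<i> * of_real y)" by (simp add: Complex_eq)
    hence "continuous_on {1..2} (\<lambda>\<sigma>. f (Complex \<sigma> y))"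
      using y by (intro continuous_on_compose2[OF holomorphic_on_imp_continuous_on[OF f]])
                 (auto intro!: continuous_intros simp: complex_eq_iff)
    hence "bounded ((\<lambda>\<sigma>. f (Complex \<sigma> y)) ` {1..2})"
      by (intro compact_imp_bounded compact_continuous_image) auto
    thus ?thesis unfolding bounded_iff by (metis atLeastAtMost_iff imageI)
  qed
  obtain B1 B2 where B: "\<And>\<sigma>. 1 \<le> \<sigma> \<Longrightarrow> \<sigma> \<le> 2 \<Longrightarrow> norm (zeta (Complex \<sigma> (2 * t))) \<le> B1"
      "\<And>\<sigma>. 1 \<le> \<sigma> \<Longrightarrow> \<sigma> \<le> 2 \<Longrightarrow> norm (deriv zeta (Complex \<sigma> t)) \<le> B2"
    using bdd[OF holomorphic_zeta, of "2 * t"] bdd[OF holomorphic_deriv[OF holomorphic_zeta], of t] assms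
    by (auto simp: open_Compl)
  define X where "X = max 1 (max B1 B2)"
  have "norm (zeta (Complex 1 t)) \<ge> c / X ^ 4"
    using B assms by (intro c(2)) (auto simp: X_def le_max_iff_disj)
  moreover have "c / X ^ 4 > 0" using c by (auto simp: X_def)
  ultimately show ?thesis by auto
qed

section \<open>The logarithmic derivative up to the 1-line\<close>

lemma zeta_reg_nonzero:
  assumes "Re w \<ge> 1" "Im w \<ge> 0"
  shows "zeta_reg w \<noteq> 0"
proof (cases "w = 1")
  case False
  have "zeta w \<noteq> 0"
  proof (cases "Re w > 1")
    case True
    thus ?thesis by (rule zeta_nonzero_Re_gt_1)
  next
    case False
    hence "w = Complex 1 (Im w)" "Im w > 0" using assms \<open>w \<noteq> 1\<close> by (auto simp: complex_eq_iff)
    thus ?thesis using zeta_nonzero_on_line by metis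
  qed
  thus ?thesis using zeta_reg_eq[of w] assms False by auto
qed (simp add: zeta_reg_1)

text \<open>Logarithmic differentiation of \<open>(w - 1) * zeta w\<close> isolates the pole; the
  other part stays continuous at 1.\<close>

lemma logderiv_zeta_eq:
  assumes "Re w \<ge> 1" "Im w \<ge> 0" "w \<noteq> 1"
  shows "deriv zeta w / zeta w = deriv zeta_reg w / zeta_reg w - 1 / (w - 1)"
proof -
  have "((\<lambda>w. (w - 1) * zeta w) has_field_derivative (zeta w + (w - 1) * deriv zeta w)) (at w)"
    by (rule derivative_eq_intros zeta_has_deriv assms refl)+ simp
  hence "(zeta_reg has_field_derivative (zeta w + (w - 1) * deriv zeta w)) (at w)"
  proof (rule has_field_derivative_transform_within_open)
    show "open ({z. Re z > 0} - {1})" by (intro open_delete open_halfspace_Re_gt)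
    show "w \<in> {z. Re z > 0} - {1}" using assms by auto
    show "(z - 1) * zeta z = zeta_reg z" if "z \<in> {z. Re z > 0} - {1}" for z
      using zeta_reg_eq[of z] that by auto
  qed
  hence d: "deriv zeta_reg w = zeta w + (w - 1) * deriv zeta w" by (rule DERIV_imp_deriv)
  have H: "zeta_reg w = (w - 1) * zeta w" using assms by (intro zeta_reg_eq) auto
  have "zeta w \<noteq> 0" using zeta_reg_nonzero[of w] assms H by auto
  moreover have "w - 1 \<noteq> 0" using assms by simp
  moreover have "b / a = (a + u * b) / (u * a) - 1 / u" if "a \<noteq> 0" "u \<noteq> 0" for a b u :: complex
    using that by (simp add: add_divide_distrib)
  ultimately show ?thesis unfolding d H by blast
qed

lemma continuous_on_logderiv_zeta_reg:
  "continuous_on {w. Re w \<ge> 1 \<and> Im w \<ge> 0} (\<lambda>w. deriv zeta_reg w / zeta_reg w)"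
proof -
  have "continuous_on {w. Re w > 0} (deriv zeta_reg)"
    by (intro holomorphic_on_imp_continuous_on holomorphic_deriv holomorphic_zeta_reg open_halfspace_Re_gt)
  moreover have "continuous_on {w. Re w > 0} zeta_reg"
    by (intro holomorphic_on_imp_continuous_on holomorphic_zeta_reg)
  ultimately show ?thesis
    using zeta_reg_nonzero by (intro continuous_on_divide) (auto elim!: continuous_on_subset)
qed

text \<open>Using \<open>zeta_reg\<close> makes the function continuous at \<open>t = 0\<close> too.
  For \<open>t > 0\<close> nothing changes compared with zeta, because the contribution
  \<open>1 / (\<i> * t)\<close> of the pole is purely imaginary.\<close>

definition neg_logderiv_line :: "real \<Rightarrow> real" where
  "neg_logderiv_line t = - Re (deriv zeta_reg (Complex 1 t) / zeta_reg (Complex 1 t))"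

lemma neg_logderiv_line_eq:
  assumes "t > 0"
  shows "neg_logderiv_line t = - Re (deriv zeta (Complex 1 t) / zeta (Complex 1 t))"
proof -
  have "Complex 1 t - 1 = \<i> * of_real t" by (simp add: complex_eq_iff)
  hence "Re (1 / (Complex 1 t - 1)) = 0" by (simp add: Re_divide)
  moreover have "Complex 1 t \<noteq> 1" using assms by (simp add: complex_eq_iff)
  ultimately show ?thesis
    unfolding neg_logderiv_line_def using assms by (subst logderiv_zeta_eq) auto
qed

lemma continuous_on_neg_logderiv_line: "continuous_on {0..} neg_logderiv_line"
proof -
  have "(\<lambda>t. Complex 1 t) = (\<lambda>t. 1 + \<i> * of_real t)" by (simp add: complex_eq_iff fun_eq_iff)
  hence "continuous_on {0..} (\<lambda>t. Complex 1 t)" by (simp, intro continuous_intros)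
  thus ?thesis unfolding neg_logderiv_line_def
    by (intro continuous_intros continuous_on_compose2[OF continuous_on_logderiv_zeta_reg]) auto
qed

lemma neg_logderiv_line_growth:
  assumes e: "e > (0 :: real)"
  obtains K where "K > 0" "\<And>t. t \<ge> 0 \<Longrightarrow> neg_logderiv_line t \<le> K * (1 + t) powr e"
proof -
  obtain c where c: "c > 0"
    "\<And>X t \<sigma>. X \<ge> 1 \<Longrightarrow> t > 0 \<Longrightarrow>
       (\<And>\<sigma>. 1 \<le> \<sigma> \<Longrightarrow> \<sigma> \<le> 2 \<Longrightarrow> norm (zeta (Complex \<sigma> (2 * t))) \<le> X) \<Longrightarrow>
       (\<And>\<sigma>. 1 \<le> \<sigma> \<Longrightarrow> \<sigma> \<le> 2 \<Longrightarrow> norm (deriv zeta (Complex \<sigma> t)) \<le> X) \<Longrightarrow>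
       1 \<le> \<sigma> \<Longrightarrow> \<sigma> \<le> 2 \<Longrightarrow> norm (zeta (Complex \<sigma> t)) \<ge> c / X ^ 4"
    using zeta_lower_bound by metis
  \<comment> \<open>The quotient costs five powers of the bound \<open>X\<close>: one for the
    derivative and four for the lower bound on zeta.\<close>
  define e' where "e' = e / 5"
  have e': "e' > 0" using e by (simp add: e'_def)
  obtain K where K: "K \<ge> 1"
    "\<And>\<sigma> t. 1 \<le> \<sigma> \<Longrightarrow> \<sigma> \<le> 2 \<Longrightarrow> t \<ge> 2 \<Longrightarrow> norm (zeta (Complex \<sigma> t)) \<le> K * t powr e'"
    "\<And>\<sigma> t. 1 \<le> \<sigma> \<Longrightarrow> \<sigma> \<le> 2 \<Longrightarrow> t \<ge> 2 \<Longrightarrow> norm (deriv zeta (Complex \<sigma> t)) \<le> K * t powr e'"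
    using zeta_growth[OF e'] by metis
  have large: "neg_logderiv_line t \<le> (K * 2 powr e') ^ 5 / c * (1 + t) powr e" if t: "t \<ge> 2" for t
  proof -
    define X where "X = K * (2 * t) powr e'"
    have X: "X \<ge> 1" "K * t powr e' \<le> X"
    proof -
      have "K * t powr e' \<ge> 1 * 1" using K t e' by (intro mult_mono ge_one_powr_ge_zero) auto
      moreover show "K * t powr e' \<le> X"
        unfolding X_def using K t e' by (intro mult_left_mono powr_mono2) auto
      ultimately show "X \<ge> 1" by simp
    qed
    have low: "norm (zeta (Complex 1 t)) \<ge> c / X ^ 4"
    proof (rule c(2))
      show "norm (zeta (Complex \<sigma> (2 * t))) \<le> X" if "1 \<le> \<sigma>" "\<sigma> \<le> 2" for \<sigma>
        unfolding X_def using that t by (intro K(2)) auto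
      show "norm (deriv zeta (Complex \<sigma> t)) \<le> X" if "1 \<le> \<sigma>" "\<sigma> \<le> 2" for \<sigma>
        using K(3)[OF that t] X(2) by linarith
    qed (use X t in auto)
    have "neg_logderiv_line t \<le> norm (deriv zeta (Complex 1 t) / zeta (Complex 1 t))"
      using neg_logderiv_line_eq[of t] t abs_Re_le_cmod[of "deriv zeta (Complex 1 t) / zeta (Complex 1 t)"] by linarith
    also have "\<dots> = norm (deriv zeta (Complex 1 t)) / norm (zeta (Complex 1 t))" by (rule norm_divide)
    also have "\<dots> \<le> X / (c / X ^ 4)"
      using low K(3)[of 1 t] t X c by (intro frac_le) auto
    also have "\<dots> = X ^ 5 / c" using c X by (simp add: eval_nat_numeral)
    also have "X ^ 5 = (K * 2 powr e') ^ 5 * (t powr e') ^ 5"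
      unfolding X_def using t by (simp add: powr_mult power_mult_distrib)
    also have "(t powr e') ^ 5 = t powr e"
      using t by (subst powr_power) (auto simp: e'_def)
    also have "(K * 2 powr e') ^ 5 * t powr e / c \<le> (K * 2 powr e') ^ 5 * (1 + t) powr e / c"
      using K c t e by (intro divide_right_mono mult_left_mono powr_mono2) auto
    finally show ?thesis by simp
  qed
  have "bounded (neg_logderiv_line ` {0..2})"
    by (intro compact_imp_bounded compact_continuous_image continuous_on_subset[OF continuous_on_neg_logderiv_line]) auto
  then obtain B where B: "B > 0" "\<And>t. 0 \<le> t \<Longrightarrow> t \<le> 2 \<Longrightarrow> \<bar>neg_logderiv_line t\<bar> \<le> B"
    unfolding bounded_pos by (auto simp: image_iff)
  define K' where "K' = max B ((K * 2 powr e') ^ 5 / c)"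
  show ?thesis
  proof (rule that[of K'])
    show "K' > 0" using B by (simp add: K'_def)
    fix t :: real assume t: "t \<ge> 0"
    show "neg_logderiv_line t \<le> K' * (1 + t) powr e"
    proof (cases "t \<ge> 2")
      case True
      have "(K * 2 powr e') ^ 5 / c * (1 + t) powr e \<le> K' * (1 + t) powr e"
        by (intro mult_right_mono) (auto simp: K'_def)
      thus ?thesis using large[OF True] by linarith
    next
      case False
      have "neg_logderiv_line t \<le> B * 1" using B(2)[of t] t False by simp
      also have "\<dots> \<le> K' * (1 + t) powr e"
        using t e B by (intro mult_mono ge_one_powr_ge_zero) (auto simp: K'_def)
      finally show ?thesis .
    qed
  qed
qed

section \<open>Positive definite weights\<close>

text \<open>The cone of finite sums of cosines with nonnegative coefficients and arbitrary real
  frequencies. Membership of \<open>g - f\<close> gives an inequality between integrals against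
  \<open>1 - t / T\<close>, even where \<open>g - f\<close> takes negative values.\<close>

inductive pos_def :: "(real \<Rightarrow> real) \<Rightarrow> bool" where
  cos: "c \<ge> 0 \<Longrightarrow> pos_def (\<lambda>t. c * cos (l * t))"
| add: "pos_def f \<Longrightarrow> pos_def g \<Longrightarrow> pos_def (\<lambda>t. f t + g t)"

lemma pos_def_const: "c \<ge> 0 \<Longrightarrow> pos_def (\<lambda>t. c)"
  using pos_def.cos[of c 0] by simp

lemma pos_def_cmult:
  assumes "pos_def f" "c \<ge> 0"
  shows "pos_def (\<lambda>t. c * f t)"
  using assms(1)
proof induction
  case (cos c' l)
  thus ?case using pos_def.cos[of "c * c'" l] assms(2) by (simp add: mult.assoc)
next
  case (add f g)
  thus ?case using pos_def.add by (simp add: distrib_left)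
qed

text \<open>The product of two cosines is half the sum of the cosines of the difference and of the
  sum of the frequencies.\<close>

lemma pos_def_mult:
  assumes "pos_def f" "pos_def g"
  shows "pos_def (\<lambda>t. f t * g t)"
  using assms(1)
proof induction
  case (cos c l)
  show ?case using assms(2)
  proof induction
    case (cos c' l')
    have "pos_def (\<lambda>t. c * c' / 2 * cos ((l - l') * t) + c * c' / 2 * cos ((l + l') * t))"
      using \<open>c \<ge> 0\<close> cos by (intro pos_def.intros) auto
    also have "(\<lambda>t. c * c' / 2 * cos ((l - l') * t) + c * c' / 2 * cos ((l + l') * t)) =
               (\<lambda>t. c * cos (l * t) * (c' * cos (l' * t)))"
      by (simp add: fun_eq_iff algebra_simps cos_add cos_diff)
    finally show ?case .
  next
    case (add f g)
    thus ?case using pos_def.add by (simp add: distrib_left)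
  qed
next
  case (add f g)
  thus ?case using pos_def.add by (simp add: distrib_right)
qed

lemma pos_def_sum:
  assumes "\<And>i. i \<in> A \<Longrightarrow> pos_def (f i)"
  shows "pos_def (\<lambda>t. \<Sum>i\<in>A. f i t)"
  using assms by (induction A rule: infinite_finite_induct) (auto intro: pos_def.add pos_def_const)

lemma pos_def_prod:
  assumes "\<And>i. i \<in> A \<Longrightarrow> pos_def (f i)"
  shows "pos_def (\<lambda>t. \<Prod>i\<in>A. f i t)"
  using assms by (induction A rule: infinite_finite_induct) (auto intro: pos_def_mult pos_def_const)

lemma pos_def_rescale: "pos_def f \<Longrightarrow> pos_def (\<lambda>t. f (a * t))"
proof (induction rule: pos_def.induct)
  case (cos c l)
  thus ?case using pos_def.cos[of c "l * a"] by (simp add: mult.assoc)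
qed (auto intro: pos_def.add)

lemma pos_def_le: "pos_def f \<Longrightarrow> f t \<le> f 0"
proof (induction rule: pos_def.induct)
  case (cos c l)
  thus ?case using mult_left_mono[of "cos (l * t)" 1 c] by simp
qed (auto intro: add_mono)

lemma pos_def_continuous: "pos_def f \<Longrightarrow> continuous_on S f"
  by (induction rule: pos_def.induct) (auto intro!: continuous_intros)

text \<open>For \<open>l \<noteq> 0\<close> the integral equals
  \<open>(1 - cos (l * T)) / (l^2 * T)\<close>. This is the reason for the weight
  \<open>1 - t / T\<close>: without it the integral \<open>sin (l * T) / l\<close> changes
  sign.\<close>

lemma integral_cos_hat_nonneg:
  fixes T :: real
  assumes T: "T > 0"
  shows "integral {0..T} (\<lambda>t. cos (l * t) * (1 - t / T)) \<ge> 0"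
proof (cases "l = 0")
  case True
  thus ?thesis using T by (auto intro!: integral_nonneg integrable_continuous_real continuous_intros simp: field_simps)
next
  case False
  define F where "F = (\<lambda>t. (1 - t / T) * sin (l * t) / l - cos (l * t) / (l\<^sup>2 * T))"
  have "((\<lambda>t. cos (l * t) * (1 - t / T)) has_integral (F T - F 0)) {0..T}"
  proof (rule fundamental_theorem_of_calculus)
    fix t assume "t \<in> {0..T}"
    have "(F has_real_derivative (cos (l * t) * (1 - t / T))) (at t within {0..T})"
      unfolding F_def using T False
      by (auto intro!: derivative_eq_intros simp: field_simps power2_eq_square)
    thus "(F has_vector_derivative cos (l * t) * (1 - t / T)) (at t within {0..T})"
      by (simp add: has_real_derivative_iff_has_vector_derivative)
  qed (use T in auto)
  hence "integral {0..T} (\<lambda>t. cos (l * t) * (1 - t / T)) = F T - F 0" by (rule integral_unique)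
  also have "\<dots> = (1 - cos (l * T)) / (l\<^sup>2 * T)"
    using T by (simp add: F_def diff_divide_distrib)
  also have "\<dots> \<ge> 0" using T by simp
  finally show ?thesis .
qed

section \<open>Integration against the weight \<open>1 - t / T\<close>\<close>

lemma integral_hat: "T > 0 \<Longrightarrow> integral {0..T} (\<lambda>t. 1 - t / T) = T / 2" for T :: real
proof (rule integral_unique)
  assume T: "T > 0"
  have "((\<lambda>t. 1 - t / T) has_integral ((T - T\<^sup>2 / (2 * T)) - (0 - 0\<^sup>2 / (2 * T)))) {0..T}"
    using T by (intro fundamental_theorem_of_calculus)
      (auto intro!: derivative_eq_intros simp flip: has_real_derivative_iff_has_vector_derivative)
  thus "((\<lambda>t. 1 - t / T) has_integral T / 2) {0..T}"
    using T by (simp add: power2_eq_square)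
qed

definition hat_integral :: "real \<Rightarrow> (real \<Rightarrow> real) \<Rightarrow> real" where
  "hat_integral T f = integral {0..T} (\<lambda>t. f t * (1 - t / T))"

lemma integrable_hat:
  "continuous_on {0..T} f \<Longrightarrow> (\<lambda>t. f t * (1 - t / T)) integrable_on {0..T}" for T :: real
  unfolding divide_inverse by (intro integrable_continuous_real continuous_intros)

lemma hat_integral_add:
  assumes "continuous_on {0..T} f" "continuous_on {0..T} g"
  shows "hat_integral T (\<lambda>t. f t + g t) = hat_integral T f + hat_integral T g"
  unfolding hat_integral_def distrib_right using assms by (intro Henstock_Kurzweil_Integration.integral_add integrable_hat)

lemma hat_integral_diff:
  assumes "continuous_on {0..T} f" "continuous_on {0..T} g"
  shows "hat_integral T (\<lambda>t. f t - g t) = hat_integral T f - hat_integral T g"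
  unfolding hat_integral_def left_diff_distrib using assms by (intro Henstock_Kurzweil_Integration.integral_diff integrable_hat)

lemma hat_integral_cmult: "hat_integral T (\<lambda>t. c * f t) = c * hat_integral T f"
  unfolding hat_integral_def by (simp add: mult.assoc)

lemma hat_integral_sum:
  assumes "finite A" "\<And>i. i \<in> A \<Longrightarrow> continuous_on {0..T} (f i)"
  shows "hat_integral T (\<lambda>t. \<Sum>i\<in>A. f i t) = (\<Sum>i\<in>A. hat_integral T (f i))"
  unfolding hat_integral_def sum_distrib_right using assms by (intro Henstock_Kurzweil_Integration.integral_sum integrable_hat)

lemma hat_integral_mono:
  assumes "T > 0" "continuous_on {0..T} f" "continuous_on {0..T} g" "\<And>t. 0 \<le> t \<Longrightarrow> t \<le> T \<Longrightarrow> f t \<le> g t"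
  shows "hat_integral T f \<le> hat_integral T g"
  unfolding hat_integral_def using assms
  by (intro integral_le integrable_hat mult_right_mono) auto

lemma hat_integral_pos_def_nonneg:
  assumes "T > 0" "pos_def f"
  shows "hat_integral T f \<ge> 0"
  using assms(2)
proof induction
  case (cos c l)
  show ?case using integral_cos_hat_nonneg[OF assms(1), of l] cos
    unfolding hat_integral_cmult by (simp add: hat_integral_def)
next
  case (add f g)
  thus ?case by (subst hat_integral_add) (auto intro: pos_def_continuous)
qed

lemma hat_integral_mono_pos_def:
  assumes "T > 0" "pos_def (\<lambda>t. g t - f t)" "continuous_on {0..T} f" "continuous_on {0..T} g"
  shows "hat_integral T f \<le> hat_integral T g"
  using hat_integral_pos_def_nonneg[OF assms(1,2)] hat_integral_diff[OF assms(4,3)] by simp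

section \<open>Weighted means of the logarithmic derivative\<close>

lemma continuous_on_logderiv_zeta_reg_line:
  "\<sigma> \<ge> 1 \<Longrightarrow> continuous_on {0..T} (\<lambda>t. deriv zeta_reg (Complex \<sigma> t) / zeta_reg (Complex \<sigma> t))"
  unfolding Complex_eq
  by (rule continuous_on_compose2[OF continuous_on_logderiv_zeta_reg]) (auto intro!: continuous_intros)

lemma neg_logderiv_split:
  assumes "\<sigma> > 1" "t \<ge> 0"
  shows "- Re (deriv zeta (Complex \<sigma> t) / zeta (Complex \<sigma> t)) =
           (\<sigma> - 1) / ((\<sigma> - 1)\<^sup>2 + t\<^sup>2) - Re (deriv zeta_reg (Complex \<sigma> t) / zeta_reg (Complex \<sigma> t))"
proof -
  have "Complex \<sigma> t - 1 = Complex (\<sigma> - 1) t" by (simp add: complex_eq_iff)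
  hence "Re (1 / (Complex \<sigma> t - 1)) = (\<sigma> - 1) / ((\<sigma> - 1)\<^sup>2 + t\<^sup>2)" by (simp add: Re_divide)
  moreover have "Complex \<sigma> t \<noteq> 1" using assms by (simp add: complex_eq_iff)
  ultimately show ?thesis using assms by (subst logderiv_zeta_eq) auto
qed

lemma continuous_on_neg_logderiv_zeta:
  assumes "\<sigma> > 1"
  shows "continuous_on {0..T} (\<lambda>t. - Re (deriv zeta (Complex \<sigma> t) / zeta (Complex \<sigma> t)))"
proof -
  have "continuous_on {0..T} (\<lambda>t. (\<sigma> - 1) / ((\<sigma> - 1)\<^sup>2 + t\<^sup>2) - Re (deriv zeta_reg (Complex \<sigma> t) / zeta_reg (Complex \<sigma> t)))"
    using assms by (intro continuous_intros continuous_on_logderiv_zeta_reg_line) (auto simp: sum_power2_eq_zero_iff)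
  thus ?thesis by (rule continuous_on_eq) (rule neg_logderiv_split [symmetric], use assms in auto)
qed

text \<open>
  To the right of the 1-line the expansion of the logarithmic derivative has nonnegative
  coefficients, so against a positive definite weight any part of it can be dropped.
\<close>

lemma partial_sum_le_hat_integral:
  assumes T: "T > 0" and f: "pos_def f" "\<And>t. f t \<ge> 0" and \<sigma>: "\<sigma> > 1"
  shows "(\<Sum>n=1..N. mangoldt n * real n powr (-\<sigma>) * hat_integral T (\<lambda>t. cos (ln (real n) * t) * f t)) \<le>
           hat_integral T (\<lambda>t. - Re (deriv zeta (Complex \<sigma> t) / zeta (Complex \<sigma> t)) * f t)"
proof -
  define a where "a = (\<lambda>n. mangoldt n * real n powr (-\<sigma>) :: real)"
  define L where "L = (\<lambda>t. - Re (deriv zeta (Complex \<sigma> t) / zeta (Complex \<sigma> t)))"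
  define I where "I = (\<lambda>n. hat_integral T (\<lambda>t. cos (ln (real n) * t) * f t))"
  have a: "a n \<ge> 0" for n unfolding a_def by (intro mult_nonneg_nonneg mangoldt_nonneg) auto
  have sa: "summable a"
    using summable_mangoldt[of "of_real \<sigma>"] \<sigma> by (simp add: a_def norm_mult norm_of_nat_powr)
  have pdI: "pos_def (\<lambda>t. cos (ln (real n) * t) * f t)" for n
    using pos_def_mult[OF pos_def.cos[of 1 "ln (real n)"] f(1)] by simp
  have I: "I n \<ge> 0" for n unfolding I_def by (rule hat_integral_pos_def_nonneg[OF T pdI])
  have cont: "continuous_on {0..T} f" by (rule pos_def_continuous) fact
  have contL: "continuous_on {0..T} L" unfolding L_def by (rule continuous_on_neg_logderiv_zeta) fact
  \<comment> \<open>Cutting the series at a finite \<open>M > N\<close> avoids exchanging an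
    infinite sum with the integral; the error is the tail of \<open>a\<close>, which tends to 0 as
    \<open>M\<close> grows.\<close>
  have *: "(\<Sum>n=1..N. a n * I n) \<le> hat_integral T (\<lambda>t. L t * f t) + (suminf a - (\<Sum>n<M. a n)) * hat_integral T f"
    if M: "M > N" for M
  proof -
    define d where "d = suminf a - (\<Sum>n<M. a n)"
    have tail: "(\<Sum>n<M. a n * cos (t * ln (real n))) \<le> L t + d" for t
    proof -
      have "(\<lambda>n. a n * cos (t * ln (real n))) sums L t"
        using Re_neg_logderiv_zeta_sums[OF \<sigma>, of t] by (simp add: a_def L_def)
      hence sm: "(\<lambda>n. a n + a n * cos (t * ln (real n))) sums (suminf a + L t)"
        by (intro sums_add summable_sums sa)
      \<comment> \<open>Adding \<open>a n\<close> to each term makes the terms nonnegative, so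
        partial sums are bounded by the full sum.\<close>
      have nn: "a n + a n * cos (t * ln (real n)) \<ge> 0" for n
        using mult_left_mono[OF cos_ge_minus_one a[of n], of "t * ln (real n)"] by simp
      have "(\<Sum>n<M. a n + a n * cos (t * ln (real n))) \<le> (\<Sum>n. a n + a n * cos (t * ln (real n)))"
        by (rule sum_le_suminf[OF sums_summable[OF sm]]) (use nn in auto)
      also have "\<dots> = suminf a + L t" by (rule sums_unique[OF sm, symmetric])
      finally have "(\<Sum>n<M. a n + a n * cos (t * ln (real n))) \<le> suminf a + L t" .
      thus ?thesis unfolding d_def sum.distrib by linarith
    qed
    have "(\<Sum>n=1..N. a n * I n) \<le> (\<Sum>n<M. a n * I n)"
      using M a I by (intro sum_mono2) auto
    also have "\<dots> = hat_integral T (\<lambda>t. \<Sum>n<M. a n * (cos (ln (real n) * t) * f t))"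
      unfolding I_def by (subst hat_integral_sum) (auto intro!: continuous_intros cont simp: hat_integral_cmult)
    also have "\<dots> \<le> hat_integral T (\<lambda>t. L t * f t + d * f t)"
    proof (rule hat_integral_mono[OF T])
      fix t
      have "(\<Sum>n<M. a n * (cos (ln (real n) * t) * f t)) = (\<Sum>n<M. a n * cos (t * ln (real n))) * f t"
        unfolding sum_distrib_right by (intro sum.cong refl) (simp add: mult_ac)
      also have "\<dots> \<le> (L t + d) * f t" by (intro mult_right_mono tail f)
      finally show "(\<Sum>n<M. a n * (cos (ln (real n) * t) * f t)) \<le> L t * f t + d * f t"
        by (simp add: distrib_right)
    qed (auto intro!: continuous_intros cont contL)
    also have "\<dots> = hat_integral T (\<lambda>t. L t * f t) + d * hat_integral T f"
      by (subst hat_integral_add) (auto intro!: continuous_intros cont contL simp: hat_integral_cmult)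
    finally show ?thesis by (simp add: d_def)
  qed
  have "(\<Sum>n=1..N. a n * I n) \<le> hat_integral T (\<lambda>t. L t * f t) + (suminf a - suminf a) * hat_integral T f"
  proof (rule tendsto_lowerbound)
    show "(\<lambda>M. hat_integral T (\<lambda>t. L t * f t) + (suminf a - (\<Sum>n<M. a n)) * hat_integral T f)
            \<longlonglongrightarrow> hat_integral T (\<lambda>t. L t * f t) + (suminf a - suminf a) * hat_integral T f"
      by (intro tendsto_intros summable_LIMSEQ sa)
    show "\<forall>\<^sub>F M in sequentially. (\<Sum>n=1..N. a n * I n) \<le> hat_integral T (\<lambda>t. L t * f t) + (suminf a - (\<Sum>n<M. a n)) * hat_integral T f"
      using eventually_gt_at_top[of N] by eventually_elim (rule *)
  qed auto
  thus ?thesis by (simp add: a_def I_def L_def)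
qed

text \<open>The real part of the pole term is a Poisson kernel with primitive
  \<open>arctan (t / s)\<close>. The bound is uniform in \<open>s\<close>, so the pole costs a
  bounded amount as \<open>s\<close> tends to 0.\<close>

lemma integral_poisson_le:
  fixes s T :: real
  assumes "s > 0" "T > 0"
  shows "integral {0..T} (\<lambda>t. s / (s\<^sup>2 + t\<^sup>2)) \<le> pi / 2"
proof -
  have "((\<lambda>t. s / (s\<^sup>2 + t\<^sup>2)) has_integral (arctan (T / s) - arctan (0 / s))) {0..T}"
  proof (rule fundamental_theorem_of_calculus)
    fix t assume "t \<in> {0..T}"
    have "((\<lambda>t. arctan (t / s)) has_real_derivative s / (s\<^sup>2 + t\<^sup>2)) (at t within {0..T})"
    proof -
      have "((\<lambda>t. arctan (t / s)) has_real_derivative (inverse (1 + (t / s)\<^sup>2) * (1 / s))) (at t within {0..T})"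
        using assms by (auto intro!: derivative_eq_intros)
      also have "inverse (1 + (t / s)\<^sup>2) * (1 / s) = s / (s\<^sup>2 + t\<^sup>2)"
      proof -
        have "s\<^sup>2 + t\<^sup>2 > 0" using assms by (simp add: sum_power2_gt_zero_iff)
        have "1 + (t / s)\<^sup>2 = (s\<^sup>2 + t\<^sup>2) / s\<^sup>2" using assms by (simp add: power_divide add_divide_distrib)
        thus ?thesis using assms by (simp add: power2_eq_square)
      qed
      finally show ?thesis .
    qed
    thus "((\<lambda>t. arctan (t / s)) has_vector_derivative s / (s\<^sup>2 + t\<^sup>2)) (at t within {0..T})"
      by (simp add: has_real_derivative_iff_has_vector_derivative)
  qed (use assms in auto)
  hence "integral {0..T} (\<lambda>t. s / (s\<^sup>2 + t\<^sup>2)) = arctan (T / s)" by (simp add: integral_unique)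
  also have "\<dots> \<le> pi / 2" using arctan_ubound less_imp_le by blast
  finally show ?thesis .
qed

text \<open>Letting \<open>\<sigma>\<close> tend to 1 from the right: the pole term is absorbed by
  \<open>pi / 2 * f 0\<close> because \<open>f\<close> is largest at 0, and the regular part
  converges uniformly on \<open>{0..T}\<close>.\<close>

lemma hat_integral_neg_logderiv_line_ge:
  assumes T: "T > 0" and f: "pos_def f" "\<And>t. f t \<ge> 0"
  shows "(\<Sum>n=1..N. mangoldt n / real n * hat_integral T (\<lambda>t. cos (ln (real n) * t) * f t)) \<le>
           pi / 2 * f 0 + hat_integral T (\<lambda>t. neg_logderiv_line t * f t)"
proof (rule field_le_epsilon)
  fix \<epsilon> :: real assume \<epsilon>: "\<epsilon> > 0"
  define I where "I = (\<lambda>n. hat_integral T (\<lambda>t. cos (ln (real n) * t) * f t))"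
  define E where "E = (\<lambda>\<sigma> t. - Re (deriv zeta_reg (Complex \<sigma> t) / zeta_reg (Complex \<sigma> t)))"
  \<comment> \<open>The denominator makes the uniform error, integrated against \<open>f\<close>, at
    most \<open>\<epsilon>\<close>; the summand 1 keeps it positive.\<close>
  define \<epsilon>' where "\<epsilon>' = \<epsilon> / (hat_integral T f + 1)"
  have If: "hat_integral T f \<ge> 0" by (rule hat_integral_pos_def_nonneg) fact+
  have \<epsilon>': "\<epsilon>' > 0" using \<epsilon> If by (simp add: \<epsilon>'_def)
  have contf: "continuous_on {0..T} f" by (rule pos_def_continuous) fact
  have contD: "continuous_on {0..T} neg_logderiv_line" by (rule continuous_on_subset[OF continuous_on_neg_logderiv_line]) auto
  have contE: "continuous_on {0..T} (E \<sigma>)" if "\<sigma> \<ge> 1" for \<sigma>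
    unfolding E_def by (intro continuous_intros continuous_on_logderiv_zeta_reg_line that)
  define S where "S = cbox (Complex 1 0) (Complex 2 T)"
  have "continuous_on S (\<lambda>w. deriv zeta_reg w / zeta_reg w)"
    by (rule continuous_on_subset[OF continuous_on_logderiv_zeta_reg]) (auto simp: S_def in_cbox_complex_iff)
  hence "uniformly_continuous_on S (\<lambda>w. deriv zeta_reg w / zeta_reg w)"
    by (intro compact_uniformly_continuous) (auto simp: S_def)
  then obtain d where d: "d > 0" "\<And>w z. w \<in> S \<Longrightarrow> z \<in> S \<Longrightarrow> dist z w < d \<Longrightarrow>
      dist (deriv zeta_reg z / zeta_reg z) (deriv zeta_reg w / zeta_reg w) < \<epsilon>'"
    unfolding uniformly_continuous_on_def using \<epsilon>' by metis
  have EI: "E \<sigma> t \<le> neg_logderiv_line t + \<epsilon>'" if \<sigma>: "1 < \<sigma>" "\<sigma> < 1 + min d 1" and t: "0 \<le> t" "t \<le> T" for \<sigma> t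
  proof -
    have "Complex \<sigma> t - Complex 1 t = of_real (\<sigma> - 1)" by (simp add: complex_eq_iff)
    hence "dist (Complex \<sigma> t) (Complex 1 t) = \<sigma> - 1" using \<sigma> unfolding dist_norm by (simp only: norm_of_real)
    hence "dist (deriv zeta_reg (Complex \<sigma> t) / zeta_reg (Complex \<sigma> t)) (deriv zeta_reg (Complex 1 t) / zeta_reg (Complex 1 t)) < \<epsilon>'"
      using \<sigma> t by (intro d(2)) (auto simp: S_def in_cbox_complex_iff)
    hence "\<bar>Re (deriv zeta_reg (Complex \<sigma> t) / zeta_reg (Complex \<sigma> t) - deriv zeta_reg (Complex 1 t) / zeta_reg (Complex 1 t))\<bar> < \<epsilon>'"
      unfolding dist_norm using abs_Re_le_cmod order.strict_trans1 by blast
    thus ?thesis unfolding E_def neg_logderiv_line_def minus_complex.sel by linarith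
  qed
  have main: "(\<Sum>n=1..N. mangoldt n * real n powr (-\<sigma>) * I n) \<le>
      pi / 2 * f 0 + hat_integral T (\<lambda>t. neg_logderiv_line t * f t) + \<epsilon>"
    if \<sigma>: "1 < \<sigma>" "\<sigma> < 1 + min d 1" for \<sigma>
  proof -
    define s where "s = \<sigma> - 1"
    have s: "s > 0" using \<sigma> by (simp add: s_def)
    have f0: "f 0 \<ge> 0" using f by blast
    have nz: "s\<^sup>2 + t\<^sup>2 \<noteq> 0" for t using s by (simp add: sum_power2_eq_zero_iff)
    have "(\<Sum>n=1..N. mangoldt n * real n powr (-\<sigma>) * I n) \<le>
           hat_integral T (\<lambda>t. - Re (deriv zeta (Complex \<sigma> t) / zeta (Complex \<sigma> t)) * f t)"
      unfolding I_def by (rule partial_sum_le_hat_integral[OF T f \<sigma>(1)])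
    also have "\<dots> \<le> hat_integral T (\<lambda>t. s / (s\<^sup>2 + t\<^sup>2) * f t + (neg_logderiv_line t + \<epsilon>') * f t)"
    proof (rule hat_integral_mono[OF T])
      fix t assume t: "0 \<le> t" "t \<le> T"
      have "- Re (deriv zeta (Complex \<sigma> t) / zeta (Complex \<sigma> t)) = s / (s\<^sup>2 + t\<^sup>2) + E \<sigma> t"
        using neg_logderiv_split[OF \<sigma>(1) t(1)] unfolding E_def s_def by linarith
      also have "\<dots> \<le> s / (s\<^sup>2 + t\<^sup>2) + (neg_logderiv_line t + \<epsilon>')" using EI[OF \<sigma> t] by simp
      finally show "- Re (deriv zeta (Complex \<sigma> t) / zeta (Complex \<sigma> t)) * f t \<le>
          s / (s\<^sup>2 + t\<^sup>2) * f t + (neg_logderiv_line t + \<epsilon>') * f t"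
        unfolding distrib_right [symmetric] by (intro mult_right_mono f)
    next
      show "continuous_on {0..T} (\<lambda>t. - Re (deriv zeta (Complex \<sigma> t) / zeta (Complex \<sigma> t)) * f t)"
        by (intro continuous_on_mult continuous_on_neg_logderiv_zeta contf \<sigma>)
    qed (use nz in \<open>auto intro!: continuous_intros contf contD\<close>)
    also have "\<dots> = hat_integral T (\<lambda>t. s / (s\<^sup>2 + t\<^sup>2) * f t) + hat_integral T (\<lambda>t. neg_logderiv_line t * f t + \<epsilon>' * f t)"
      unfolding distrib_right using nz by (intro hat_integral_add continuous_intros contf contD) auto
    also have "hat_integral T (\<lambda>t. neg_logderiv_line t * f t + \<epsilon>' * f t) = hat_integral T (\<lambda>t. neg_logderiv_line t * f t) + \<epsilon>' * hat_integral T f"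
      by (subst hat_integral_add) (auto intro!: continuous_intros contf contD simp: hat_integral_cmult)
    also have "\<epsilon>' * hat_integral T f \<le> \<epsilon>"
      using If \<epsilon> by (simp add: \<epsilon>'_def field_simps)
    also have "hat_integral T (\<lambda>t. s / (s\<^sup>2 + t\<^sup>2) * f t) \<le> integral {0..T} (\<lambda>t. s / (s\<^sup>2 + t\<^sup>2) * f 0)"
      unfolding hat_integral_def
    proof (rule integral_le)
      show "(\<lambda>t. s / (s\<^sup>2 + t\<^sup>2) * f t * (1 - t / T)) integrable_on {0..T}"
        using nz by (intro integrable_hat continuous_intros contf) auto
      show "(\<lambda>t. s / (s\<^sup>2 + t\<^sup>2) * f 0) integrable_on {0..T}"
        using nz by (intro integrable_continuous_real continuous_intros) auto
      fix t assume t: "t \<in> {0..T}"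
      have "s / (s\<^sup>2 + t\<^sup>2) * f t * (1 - t / T) \<le> s / (s\<^sup>2 + t\<^sup>2) * f t * 1"
        using t T s f by (intro mult_left_mono mult_nonneg_nonneg divide_nonneg_nonneg) auto
      also have "\<dots> \<le> s / (s\<^sup>2 + t\<^sup>2) * f 0"
        using s pos_def_le[OF f(1), of t] by (simp add: divide_right_mono mult_left_mono)
      finally show "s / (s\<^sup>2 + t\<^sup>2) * f t * (1 - t / T) \<le> s / (s\<^sup>2 + t\<^sup>2) * f 0" .
    qed
    also have "\<dots> = integral {0..T} (\<lambda>t. s / (s\<^sup>2 + t\<^sup>2)) * f 0" by (rule integral_mult_left)
    also have "\<dots> \<le> pi / 2 * f 0" by (intro mult_right_mono integral_poisson_le s T f0)
    finally show ?thesis by simp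
  qed
  have "(\<Sum>n=1..N. mangoldt n * real n powr (-1) * I n) \<le> pi / 2 * f 0 + hat_integral T (\<lambda>t. neg_logderiv_line t * f t) + \<epsilon>"
  proof (rule tendsto_upperbound)
    show "((\<lambda>\<sigma>. \<Sum>n=1..N. mangoldt n * real n powr (-\<sigma>) * I n) \<longlongrightarrow> (\<Sum>n=1..N. mangoldt n * real n powr (-1) * I n)) (at_right 1)"
      by (intro tendsto_intros) auto
    show "\<forall>\<^sub>F \<sigma> in at_right 1. (\<Sum>n=1..N. mangoldt n * real n powr (-\<sigma>) * I n) \<le> pi / 2 * f 0 + hat_integral T (\<lambda>t. neg_logderiv_line t * f t) + \<epsilon>"
      unfolding eventually_at_right_field using main d(1) by (intro exI[of _ "1 + min d 1"]) auto
  qed simp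
  also have "(\<Sum>n=1..N. mangoldt n * real n powr (-1) * I n) = (\<Sum>n=1..N. mangoldt n / real n * I n)"
    by (intro sum.cong refl) (auto simp: powr_minus_divide)
  finally show "(\<Sum>n=1..N. mangoldt n / real n * hat_integral T (\<lambda>t. cos (ln (real n) * t) * f t)) \<le>
           pi / 2 * f 0 + hat_integral T (\<lambda>t. neg_logderiv_line t * f t) + \<epsilon>" by (simp add: I_def)
qed

section \<open>The resonator\<close>

text \<open>The Fourier coefficients of the Fejer kernel of length \<open>J\<close>. Truncating at 0
  defines them on all integers, so they may be shifted freely.\<close>

definition tri :: "nat \<Rightarrow> int \<Rightarrow> real" where
  "tri J i = max 0 (1 - \<bar>real_of_int i\<bar> / real J)"

text \<open>The squared modulus of a geometric sum of \<open>J\<close> unit vectors, divided by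
  \<open>J\<close>; in this form nonnegativity is immediate.\<close>

definition fejer :: "nat \<Rightarrow> real \<Rightarrow> real" where
  "fejer J \<theta> = ((\<Sum>a<J. cos (real a * \<theta>))\<^sup>2 + (\<Sum>a<J. sin (real a * \<theta>))\<^sup>2) / real J"

lemma fejer_nonneg: "fejer J \<theta> \<ge> 0"
  by (simp add: fejer_def)

lemma fejer_0: "fejer J 0 = real J"
  by (simp add: fejer_def power2_eq_square)

lemma sum_symmetric_int:
  fixes g :: "int \<Rightarrow> real"
  shows "(\<Sum>j\<in>{-int J..int J}. g j) = g 0 + (\<Sum>i<J. g (int i - int J)) + (\<Sum>i<J. g (int J - int i))"
proof (induction J)
  case (Suc J)
  have "{-int (Suc J)..int (Suc J)} = insert (-int (Suc J)) (insert (int (Suc J)) {-int J..int J})" by auto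
  hence "(\<Sum>j\<in>{-int (Suc J)..int (Suc J)}. g j) = g (- int (Suc J)) + g (int (Suc J)) + (\<Sum>j\<in>{-int J..int J}. g j)"
    by simp
  thus ?case unfolding Suc.IH sum.lessThan_Suc_shift by (simp add: algebra_simps)
qed auto

text \<open>The difference \<open>j\<close> occurs \<open>J - \<bar>j\<bar>\<close> times in a
  square of side \<open>J\<close>: the row and the column added at each step contribute every
  difference from \<open>-J\<close> to \<open>J\<close> once.\<close>

lemma sum_differences:
  fixes g :: "int \<Rightarrow> real"
  shows "(\<Sum>a<J. \<Sum>b<J. g (int a - int b)) = (\<Sum>j\<in>{-int J..int J}. (real J - \<bar>real_of_int j\<bar>) * g j)"
proof (induction J)
  case (Suc J)
  have "(\<Sum>a<Suc J. \<Sum>b<Suc J. g (int a - int b)) =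
        (\<Sum>a<J. \<Sum>b<J. g (int a - int b)) + (\<Sum>j\<in>{-int J..int J}. g j)"
    unfolding sum_symmetric_int by (simp add: sum.distrib)
  also have "\<dots> = (\<Sum>j\<in>{-int J..int J}. (real (Suc J) - \<bar>real_of_int j\<bar>) * g j)"
    unfolding Suc.IH by (simp add: algebra_simps flip: sum.distrib)
  also have "\<dots> = (\<Sum>j\<in>{-int (Suc J)..int (Suc J)}. (real (Suc J) - \<bar>real_of_int j\<bar>) * g j)"
    by (rule sum.mono_neutral_left) (auto simp: not_le abs_if)
  finally show ?case .
qed auto

lemma fejer_expand:
  assumes "J > 0"
  shows "fejer J \<theta> = (\<Sum>j\<in>{-int J..int J}. tri J j * cos (real_of_int j * \<theta>))"
proof -
  have "(\<Sum>a<J. cos (real a * \<theta>))\<^sup>2 + (\<Sum>a<J. sin (real a * \<theta>))\<^sup>2 =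
        (\<Sum>a<J. \<Sum>b<J. cos (real_of_int (int a - int b) * \<theta>))"
    by (simp add: power2_eq_square sum_product cos_diff left_diff_distrib flip: sum.distrib)
  also have "\<dots> = (\<Sum>j\<in>{-int J..int J}. (real J - \<bar>real_of_int j\<bar>) * cos (real_of_int j * \<theta>))"
    by (rule sum_differences)
  finally have "fejer J \<theta> = (\<Sum>j\<in>{-int J..int J}. (real J - \<bar>real_of_int j\<bar>) * cos (real_of_int j * \<theta>)) / real J"
    by (simp add: fejer_def)
  also have "\<dots> = (\<Sum>j\<in>{-int J..int J}. tri J j * cos (real_of_int j * \<theta>))"
    unfolding sum_divide_distrib
  proof (intro sum.cong refl)
    fix j assume "j \<in> {- int J..int J}"
    hence "\<bar>real_of_int j\<bar> \<le> real J" by auto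
    hence "tri J j = (real J - \<bar>real_of_int j\<bar>) / real J"
      using assms by (simp add: tri_def max_def field_simps)
    thus "(real J - \<bar>real_of_int j\<bar>) * cos (real_of_int j * \<theta>) / real J = tri J j * cos (real_of_int j * \<theta>)"
      by simp
  qed
  finally show ?thesis .
qed

lemma tri_nonneg: "tri J i \<ge> 0"
  by (simp add: tri_def)

lemma tri_eq_0: "\<bar>i\<bar> \<ge> int J \<Longrightarrow> J > 0 \<Longrightarrow> tri J i = 0"
proof -
  assume "\<bar>i\<bar> \<ge> int J" "J > 0"
  hence "real J \<le> \<bar>real_of_int i\<bar>" by linarith
  with \<open>J > 0\<close> show "tri J i = 0" by (simp add: tri_def)
qed

lemma pos_def_fejer:
  assumes "J > 0"
  shows "pos_def (fejer J)"
proof -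
  have "pos_def (\<lambda>\<theta>. \<Sum>j\<in>{-int J..int J}. tri J j * cos (real_of_int j * \<theta>))"
    by (intro pos_def_sum pos_def.cos tri_nonneg)
  moreover have "fejer J = (\<lambda>\<theta>. \<Sum>j\<in>{-int J..int J}. tri J j * cos (real_of_int j * \<theta>))"
    using fejer_expand[OF assms] by (rule ext)
  ultimately show ?thesis by simp
qed

text \<open>The constant Fourier coefficient is \<open>tri J 0 = 1\<close>, so subtracting 1 removes
  exactly one term.\<close>

lemma pos_def_fejer_minus_1:
  assumes "J > 0"
  shows "pos_def (\<lambda>\<theta>. fejer J \<theta> - 1)"
proof -
  have "pos_def (\<lambda>\<theta>. \<Sum>j\<in>{-int J..int J} - {0}. tri J j * cos (real_of_int j * \<theta>))"
    by (intro pos_def_sum pos_def.cos tri_nonneg)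
  also have "(\<lambda>\<theta>. \<Sum>j\<in>{-int J..int J} - {0}. tri J j * cos (real_of_int j * \<theta>)) = (\<lambda>\<theta>. fejer J \<theta> - 1)"
    unfolding fejer_expand[OF assms] by (subst sum_diff1) (auto simp: tri_def)
  finally show ?thesis .
qed

lemma tri_shift_real:
  fixes a b :: real
  assumes b: "0 \<le> b" "b \<le> 1"
  shows "(1 - b) * max 0 (1 - \<bar>a\<bar>) \<le> (max 0 (1 - \<bar>a - b\<bar>) + max 0 (1 - \<bar>a + b\<bar>)) / 2"
proof -
  have nonneg: "(1 - b) * max 0 (1 - a) \<le> (max 0 (1 - \<bar>a - b\<bar>) + max 0 (1 - \<bar>a + b\<bar>)) / 2" if a: "a \<ge> 0" for a
  proof (cases "a \<ge> 1")
    case False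
    \<comment> \<open>The products are the only nonlinear quantities; with their signs known, each
      case of the absolute values is linear.\<close>
    have "a * b \<ge> 0" "a * (1 - b) \<ge> 0" "b * (1 - a) \<ge> 0" using a b False by auto
    moreover have "(1 - b) * max 0 (1 - a) = 1 - a - b + a * b"
      using False by (simp add: max_def algebra_simps)
    ultimately show ?thesis using a b False by (auto simp: algebra_simps max_def abs_if)
  qed auto
  show ?thesis
  proof (cases "a \<ge> 0")
    case True
    thus ?thesis using nonneg[of a] by simp
  next
    case False
    have "\<bar>- a - b\<bar> = \<bar>a + b\<bar>" "\<bar>- a + b\<bar> = \<bar>a - b\<bar>" by linarith+
    thus ?thesis using nonneg[of "- a"] False by (simp add: add.commute)
  qed
qed

lemma tri_shift:
  assumes "k \<le> J" "J > 0"
  shows "(1 - real k / real J) * tri J i \<le> (tri J (i - int k) + tri J (i + int k)) / 2"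
proof -
  have "\<bar>real_of_int (i - int k)\<bar> / real J = \<bar>real_of_int i / real J - real k / real J\<bar>"
    using assms by (simp flip: diff_divide_distrib)
  moreover have "\<bar>real_of_int (i + int k)\<bar> / real J = \<bar>real_of_int i / real J + real k / real J\<bar>"
    using assms by (simp flip: add_divide_distrib)
  moreover have "\<bar>real_of_int i\<bar> / real J = \<bar>real_of_int i / real J\<bar>" by simp
  ultimately show ?thesis
    unfolding tri_def using assms by (simp only:) (rule tri_shift_real, auto)
qed

text \<open>Multiplication by \<open>cos (k * \<theta>)\<close> replaces the coefficients by the
  average of their shifts by \<open>k\<close> and \<open>-k\<close>. By \<open>tri_shift\<close>
  this average dominates \<open>1 - k / J\<close> times the original, coefficient by coefficient;
  the range \<open>A\<close> is wide enough for both shifts.\<close>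

lemma pos_def_cos_fejer:
  assumes "k \<le> J" "J > 0"
  shows "pos_def (\<lambda>\<theta>. cos (real k * \<theta>) * fejer J \<theta> - (1 - real k / real J) * fejer J \<theta>)"
proof -
  define A where "A = {- int (J + k)..int (J + k)}"
  have shift: "(\<Sum>j\<in>{-int J..int J}. tri J j * cos (real_of_int (j + m) * \<theta>)) =
       (\<Sum>i\<in>A. tri J (i - m) * cos (real_of_int i * \<theta>))" if "\<bar>m\<bar> \<le> int k" for m \<theta>
  proof -
    have "(\<Sum>j\<in>{-int J..int J}. tri J j * cos (real_of_int (j + m) * \<theta>)) =
          (\<Sum>i\<in>{-int J + m..int J + m}. tri J (i - m) * cos (real_of_int i * \<theta>))"
      by (rule sum.reindex_bij_witness[of _ "\<lambda>i. i - m" "\<lambda>j. j + m"]) auto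
    also have "\<dots> = (\<Sum>i\<in>A. tri J (i - m) * cos (real_of_int i * \<theta>))"
      using that assms by (intro sum.mono_neutral_left) (auto simp: A_def intro!: tri_eq_0)
    finally show ?thesis .
  qed
  have "cos (real k * \<theta>) * fejer J \<theta> = (\<Sum>i\<in>A. (tri J (i - int k) + tri J (i + int k)) / 2 * cos (real_of_int i * \<theta>))" for \<theta>
  proof -
    have "2 * (cos (real k * \<theta>) * fejer J \<theta>) =
        (\<Sum>j\<in>{-int J..int J}. tri J j * cos (real_of_int (j + int k) * \<theta>)) +
        (\<Sum>j\<in>{-int J..int J}. tri J j * cos (real_of_int (j + - int k) * \<theta>))"
      unfolding fejer_expand[OF assms(2)] sum_distrib_left sum.distrib [symmetric]
      by (intro sum.cong refl) (simp add: algebra_simps cos_add cos_diff)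
    also have "\<dots> = (\<Sum>i\<in>A. tri J (i - int k) * cos (real_of_int i * \<theta>)) + (\<Sum>i\<in>A. tri J (i - - int k) * cos (real_of_int i * \<theta>))"
      by (intro arg_cong2[of _ _ _ _ "(+)"] shift) auto
    finally show ?thesis
      by (simp add: add_divide_distrib distrib_right sum.distrib flip: sum_divide_distrib)
  qed
  moreover have "fejer J \<theta> = (\<Sum>i\<in>A. tri J i * cos (real_of_int i * \<theta>))" for \<theta>
    using shift[of 0 \<theta>] fejer_expand[OF assms(2)] by simp
  ultimately have "(\<lambda>\<theta>. cos (real k * \<theta>) * fejer J \<theta> - (1 - real k / real J) * fejer J \<theta>) =
     (\<lambda>\<theta>. \<Sum>i\<in>A. ((tri J (i - int k) + tri J (i + int k)) / 2 - (1 - real k / real J) * tri J i) * cos (real_of_int i * \<theta>))"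
    by (simp add: fun_eq_iff sum_distrib_left left_diff_distrib mult.assoc flip: sum_subtractf)
  moreover have "pos_def \<dots>"
    using tri_shift[OF assms] by (intro pos_def_sum pos_def.cos) simp
  ultimately show ?thesis by simp
qed

section \<open>The product over primes\<close>

definition primes_upto :: "nat \<Rightarrow> nat set" where
  "primes_upto N = {p. prime p \<and> p \<le> N}"

lemma finite_primes_upto [simp]: "finite (primes_upto N)"
  by (simp add: primes_upto_def)

lemma primes_upto_div_pos: "p \<in> primes_upto N \<Longrightarrow> N div p > 0"
  by (auto simp: primes_upto_def div_greater_zero_iff prime_gt_0_nat)

text \<open>
  Up to normalisation this is the square modulus of the sum of \<open>m\<^sup>i\<^sup>t\<close> over the divisors \<open>m\<close> of
  the product of the prime powers \<open>p ^ (N div p - 1)\<close>.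
\<close>

definition resonator :: "nat \<Rightarrow> real \<Rightarrow> real" where
  "resonator N t = (\<Prod>p\<in>primes_upto N. fejer (N div p) (ln (real p) * t))"

lemma resonator_nonneg: "resonator N t \<ge> 0"
  unfolding resonator_def by (intro prod_nonneg fejer_nonneg)

lemma pos_def_resonator: "pos_def (resonator N)"
  unfolding resonator_def [abs_def] by (intro pos_def_prod pos_def_rescale pos_def_fejer primes_upto_div_pos)

lemma resonator_0: "resonator N 0 = (\<Prod>p\<in>primes_upto N. real (N div p))"
  by (simp add: resonator_def fejer_0)

lemma pos_def_prod_minus_1:
  assumes "\<And>i. i \<in> A \<Longrightarrow> pos_def (f i)" "\<And>i. i \<in> A \<Longrightarrow> pos_def (\<lambda>t. f i t - 1)"
  shows "pos_def (\<lambda>t. (\<Prod>i\<in>A. f i t) - 1)"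
  using assms
proof (induction A rule: infinite_finite_induct)
  case (insert x A)
  \<comment> \<open>This is the splitting \<open>F * P - 1 = (F - 1) * P + (P - 1)\<close>.\<close>
  have "pos_def (\<lambda>t. (f x t - 1) * (\<Prod>i\<in>A. f i t) + ((\<Prod>i\<in>A. f i t) - 1))"
    using insert by (intro pos_def.add pos_def_mult pos_def_prod) auto
  thus ?case using insert by (simp add: algebra_simps)
qed (auto intro: pos_def_const)

text \<open>Every factor has constant coefficient 1 and no negative coefficients. The lemma gives
  the resonator a weighted integral of at least \<open>T / 2\<close>, that of the constant
  1.\<close>

lemma pos_def_resonator_minus_1: "pos_def (\<lambda>t. resonator N t - 1)"
  unfolding resonator_def
proof (rule pos_def_prod_minus_1)
  fix p assume "p \<in> primes_upto N"
  hence *: "N div p > 0" by (rule primes_upto_div_pos)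
  show "pos_def (\<lambda>t. fejer (N div p) (ln (real p) * t))" by (intro pos_def_rescale pos_def_fejer *)
  show "pos_def (\<lambda>t. fejer (N div p) (ln (real p) * t) - 1)"
    using pos_def_rescale[OF pos_def_fejer_minus_1[OF *], of "ln (real p)"] .
qed

text \<open>Only the factor at \<open>p\<close> interacts with the frequency
  \<open>k * ln p\<close>; the others form a positive definite multiplier. The loss
  \<open>k / J\<close> of the Fejer kernel must then be compared with
  \<open>1 / (N div p ^ k)\<close>.\<close>

lemma pos_def_resonator_primepow:
  assumes p: "prime p" and k: "k > 0" and le: "p ^ k \<le> N"
  shows "pos_def (\<lambda>t. cos (ln (real (p ^ k)) * t) * resonator N t - (1 - 1 / real (N div p ^ k)) * resonator N t)"
proof -
  define J where "J = N div p"
  define m where "m = N div p ^ k"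
  have p2: "p \<ge> 2" using p by (rule prime_ge_2_nat)
  have "p \<le> p ^ k" using p2 k by (intro self_le_power) auto
  hence pP: "p \<in> primes_upto N" using p le by (simp add: primes_upto_def)
  hence J: "J > 0" unfolding J_def by (rule primes_upto_div_pos)
  have m: "m > 0" using le p2 by (simp add: m_def div_greater_zero_iff)
  \<comment> \<open>The comparison amounts to \<open>k * m \<le> J\<close>, which follows from
    \<open>k \<le> p ^ (k - 1)\<close> and \<open>m = J div p ^ (k - 1)\<close>.\<close>
  have "k \<le> 2 ^ (k - 1)" using k by (induction k) (auto simp: Suc_le_eq less_exp)
  also have "\<dots> \<le> p ^ (k - 1)" using p2 by (intro power_mono) auto
  finally have "k * m \<le> p ^ (k - 1) * m" by simp
  also have "\<dots> = p ^ (k - 1) * (J div p ^ (k - 1))"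
    unfolding m_def J_def using k by (simp flip: div_mult2_eq power_Suc)
  also have "\<dots> \<le> J" by simp
  finally have km: "k * m \<le> J" .
  have kJ: "k \<le> J" using km m by (metis le_trans mult_le_mono2 nat_mult_1_right Suc_leI One_nat_def)
  have "real k * real m \<le> real J" using km by (metis of_nat_le_iff of_nat_mult)
  hence r: "1 - 1 / real m \<le> 1 - real k / real J" using m J by (simp add: field_simps)
  define F where "F = (\<lambda>t. fejer J (ln (real p) * t))"
  define G where "G = (\<lambda>t. \<Prod>q\<in>primes_upto N - {p}. fejer (N div q) (ln (real q) * t))"
  have FG: "resonator N t = F t * G t" for t
    unfolding resonator_def F_def G_def J_def using pP by (simp add: prod.remove)
  have PDG: "pos_def G" unfolding G_def by (intro pos_def_prod pos_def_rescale pos_def_fejer primes_upto_div_pos) auto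
  have PDF: "pos_def F" unfolding F_def by (intro pos_def_rescale pos_def_fejer J)
  have "pos_def (\<lambda>t. cos (real k * (ln (real p) * t)) * F t - (1 - real k / real J) * F t)"
    using pos_def_rescale[OF pos_def_cos_fejer[OF kJ J], of "ln (real p)"] by (simp add: F_def)
  hence "pos_def (\<lambda>t. (cos (real k * (ln (real p) * t)) * F t - (1 - real k / real J) * F t) +
                 ((1 - real k / real J) - (1 - 1 / real m)) * F t)"
    using r by (intro pos_def.add pos_def_cmult PDF) auto
  hence "pos_def (\<lambda>t. ((cos (real k * (ln (real p) * t)) * F t - (1 - real k / real J) * F t) +
                 ((1 - real k / real J) - (1 - 1 / real m)) * F t) * G t)"
    by (intro pos_def_mult PDG)
  also have "(\<lambda>t. ((cos (real k * (ln (real p) * t)) * F t - (1 - real k / real J) * F t) +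
                 ((1 - real k / real J) - (1 - 1 / real m)) * F t) * G t) =
     (\<lambda>t. cos (ln (real (p ^ k)) * t) * resonator N t - (1 - 1 / real m) * resonator N t)"
    using p2 unfolding FG by (simp add: fun_eq_iff ln_realpow algebra_simps)
  finally show ?thesis by (simp add: m_def)
qed

lemma pos_def_resonator_mangoldt:
  "pos_def (\<lambda>t. (\<Sum>n=1..N. mangoldt n / real n * (cos (ln (real n) * t) * resonator N t)) -
           (\<Sum>n=1..N. mangoldt n / real n * (1 - 1 / real (N div n))) * resonator N t)"
proof -
  have "pos_def (\<lambda>t. \<Sum>n=1..N. mangoldt n / real n * (cos (ln (real n) * t) * resonator N t - (1 - 1 / real (N div n)) * resonator N t))"
  proof (rule pos_def_sum)
    fix n assume n: "n \<in> {1..N}"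
    show "pos_def (\<lambda>t. mangoldt n / real n * (cos (ln (real n) * t) * resonator N t - (1 - 1 / real (N div n)) * resonator N t))"
    proof (cases "primepow n")
      case True
      then obtain p k where pk: "prime p" "k > 0" "n = p ^ k"
        by (auto simp: primepow_def)
      show ?thesis
        using pos_def_resonator_primepow[OF pk(1,2), of N] n pk(3)
        by (intro pos_def_cmult divide_nonneg_nonneg mangoldt_nonneg) auto
    qed (auto simp: mangoldt_def intro: pos_def_const)
  qed
  moreover have "(\<Sum>n=1..N. mangoldt n / real n * (cos (ln (real n) * t) * resonator N t - (1 - 1 / real (N div n)) * resonator N t)) =
      (\<Sum>n=1..N. mangoldt n / real n * (cos (ln (real n) * t) * resonator N t)) -
      (\<Sum>n=1..N. mangoldt n / real n * (1 - 1 / real (N div n))) * resonator N t" for t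
    unfolding sum_distrib_right sum_subtractf [symmetric]
    by (intro sum.cong refl) (rule trans[OF right_diff_distrib], simp only: mult.assoc)
  ultimately show ?thesis by simp
qed

text \<open>The weighted sum of cosines times the resonator exceeds \<open>V\<close> times the
  resonator in the positive definite order, which passes to integrals; the Dirichlet series then
  bounds the integral of that sum from above.\<close>

lemma resonator_inequality:
  fixes T :: real and N :: nat
  assumes T: "T > 0"
  defines "V \<equiv> (\<Sum>n=1..N. mangoldt n / real n * (1 - 1 / real (N div n)))"
  shows "V * hat_integral T (resonator N) \<le> pi / 2 * resonator N 0 + hat_integral T (\<lambda>t. neg_logderiv_line t * resonator N t)"
    and "hat_integral T (resonator N) \<ge> T / 2"
proof -
  have cont: "continuous_on {0..T} (resonator N)" by (intro pos_def_continuous pos_def_resonator)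
  have "V * hat_integral T (resonator N) = hat_integral T (\<lambda>t. V * resonator N t)"
    by (rule hat_integral_cmult [symmetric])
  also have "\<dots> \<le> hat_integral T (\<lambda>t. \<Sum>n=1..N. mangoldt n / real n * (cos (ln (real n) * t) * resonator N t))"
    using pos_def_resonator_mangoldt[of N] unfolding V_def
    by (intro hat_integral_mono_pos_def T continuous_intros cont)
  also have "\<dots> = (\<Sum>n=1..N. hat_integral T (\<lambda>t. mangoldt n / real n * (cos (ln (real n) * t) * resonator N t)))"
    by (rule hat_integral_sum) (auto intro!: continuous_intros cont)
  also have "\<dots> = (\<Sum>n=1..N. mangoldt n / real n * hat_integral T (\<lambda>t. cos (ln (real n) * t) * resonator N t))"
    by (simp only: hat_integral_cmult)
  also have "\<dots> \<le> pi / 2 * resonator N 0 + hat_integral T (\<lambda>t. neg_logderiv_line t * resonator N t)"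
    by (rule hat_integral_neg_logderiv_line_ge[OF T pos_def_resonator resonator_nonneg])
  finally show "V * hat_integral T (resonator N) \<le> pi / 2 * resonator N 0 + hat_integral T (\<lambda>t. neg_logderiv_line t * resonator N t)" .
  have "hat_integral T (\<lambda>t. 1) \<le> hat_integral T (resonator N)"
    by (intro hat_integral_mono_pos_def T pos_def_resonator_minus_1 continuous_intros cont)
  thus "hat_integral T (resonator N) \<ge> T / 2" by (simp add: hat_integral_def integral_hat[OF T])
qed

section \<open>Large values\<close>

text \<open>On \<open>[0, \<tau>]\<close> and on the set of large values the integrand is at most
  \<open>B * f 0\<close>, elsewhere at most \<open>W\<close> times the weighted resonator. The mean
  exceeds \<open>W + \<delta>\<close> up to the pole term, so the contributions of \<open>W\<close>
  cancel and only the excess \<open>\<delta>\<close> remains.\<close>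

lemma measure_large_values_ge:
  fixes T \<tau> B W V :: real and N :: nat
  assumes T: "0 \<le> \<tau>" "\<tau> \<le> T" "0 < T" and B: "B \<ge> 0" "\<And>t. 0 \<le> t \<Longrightarrow> t \<le> T \<Longrightarrow> neg_logderiv_line t \<le> B"
    and W: "W \<ge> 0"
    and V: "W + \<delta> \<le> (\<Sum>n=1..N. mangoldt n / real n * (1 - 1 / real (N div n)))" "\<delta> \<ge> 0"
  shows "\<delta> * (T / 2) \<le> resonator N 0 * (pi / 2 + B * (\<tau> + measure lebesgue {t \<in> {\<tau>..T}. neg_logderiv_line t \<ge> W}))"
proof -
  define S where "S = {t \<in> {\<tau>..T}. neg_logderiv_line t \<ge> W}"
  define f where "f = resonator N"
  define A where "A = hat_integral T f"
  have contD: "continuous_on A neg_logderiv_line" if "A \<subseteq> {0..}" for A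
    using that by (rule continuous_on_subset[OF continuous_on_neg_logderiv_line])
  have contf: "continuous_on A f" for A unfolding f_def by (intro pos_def_continuous pos_def_resonator)
  have f: "f t \<ge> 0" "f t \<le> f 0" for t
    unfolding f_def by (intro resonator_nonneg pos_def_le pos_def_resonator)+
  have "S = {\<tau>..T} \<inter> neg_logderiv_line -` {W..}" by (auto simp: S_def)
  also have "closed \<dots>"
    using T by (intro continuous_closed_preimage contD) auto
  finally have "S \<in> lmeasurable"
    by (intro lmeasurable_compact) (auto simp: compact_eq_bounded_closed S_def intro: bounded_subset[of "{\<tau>..T}"])
  moreover have "indicat_real S = (\<lambda>t. if t \<in> S then 1 else 0)" by (auto simp: indicator_def)
  ultimately have "((\<lambda>t. if t \<in> S then 1 else 0 :: real) has_integral measure lebesgue S) UNIV"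
    by (simp add: lmeasurable_iff_has_integral)
  hence "((\<lambda>t. 1 :: real) has_integral measure lebesgue S) S"
    by (simp only: has_integral_restrict_UNIV)
  hence S_int: "((\<lambda>t. if t \<in> S then 1 else 0) has_integral measure lebesgue S) {0..T}"
    using T by (subst has_integral_restrict) (auto simp: S_def)
  have "((\<lambda>t. 1 :: real) has_integral \<tau>) {0..\<tau>}"
    using has_integral_const_real[of "1 :: real" 0 \<tau>] T by simp
  hence \<tau>_int: "((\<lambda>t. if t \<in> {0..\<tau>} then 1 else 0 :: real) has_integral \<tau>) {0..T}"
    using T by (subst has_integral_restrict) auto
  have A_int: "((\<lambda>t. f t * (1 - t / T)) has_integral A) {0..T}"
    unfolding A_def hat_integral_def by (intro integrable_integral integrable_hat contf)
  \<comment> \<open>A majorant of the integrand; since \<open>W \<ge> 0\<close>, its last term may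
    be kept on the exceptional set as well.\<close>
  have rhs: "((\<lambda>t. B * f 0 * ((if t \<in> {0..\<tau>} then 1 else 0) + (if t \<in> S then 1 else 0)) + W * (f t * (1 - t / T)))
               has_integral (B * f 0 * (\<tau> + measure lebesgue S) + W * A)) {0..T}"
    by (intro has_integral_add has_integral_mult_right \<tau>_int S_int A_int)
  have lhs: "((\<lambda>t. neg_logderiv_line t * f t * (1 - t / T)) has_integral hat_integral T (\<lambda>t. neg_logderiv_line t * f t)) {0..T}"
    unfolding hat_integral_def by (intro integrable_integral integrable_hat continuous_intros contf contD) auto
  have "hat_integral T (\<lambda>t. neg_logderiv_line t * f t) \<le> B * f 0 * (\<tau> + measure lebesgue S) + W * A"
  proof (rule has_integral_le[OF lhs rhs])
    fix t assume t: "t \<in> {0..T}"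
    have h: "1 - t / T \<ge> 0" "1 - t / T \<le> 1" using t T by auto
    have fh: "0 \<le> f t * (1 - t / T)" "f t * (1 - t / T) \<le> f 0 * 1"
      by (intro mult_nonneg_nonneg mult_mono f h)+
    show "neg_logderiv_line t * f t * (1 - t / T) \<le> B * f 0 * ((if t \<in> {0..\<tau>} then 1 else 0) + (if t \<in> S then 1 else 0)) + W * (f t * (1 - t / T))"
    proof (cases "t \<in> {0..\<tau>} \<or> t \<in> S")
      case True
      have "neg_logderiv_line t * (f t * (1 - t / T)) \<le> B * (f t * (1 - t / T))"
        using B(2)[of t] t fh by (intro mult_right_mono) auto
      also have "\<dots> \<le> B * (f 0 * 1)" using B fh by (intro mult_left_mono)
      also have "\<dots> \<le> B * f 0 * ((if t \<in> {0..\<tau>} then 1 else 0) + (if t \<in> S then 1 else 0))"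
        using True B f[of 0] by auto
      also have "\<dots> \<le> \<dots> + W * (f t * (1 - t / T))" using W fh by simp
      finally show ?thesis by (simp add: mult.assoc)
    next
      case False
      hence "neg_logderiv_line t \<le> W" using t by (auto simp: S_def)
      hence "neg_logderiv_line t * (f t * (1 - t / T)) \<le> W * (f t * (1 - t / T))"
        using fh by (intro mult_right_mono) auto
      thus ?thesis using False by (auto simp: mult.assoc)
    qed
  qed
  moreover have A: "A \<ge> T / 2" unfolding A_def f_def by (rule resonator_inequality) fact
  moreover have "(W + \<delta>) * A \<le> pi / 2 * f 0 + hat_integral T (\<lambda>t. neg_logderiv_line t * f t)"
  proof -
    have "(W + \<delta>) * A \<le> (\<Sum>n=1..N. mangoldt n / real n * (1 - 1 / real (N div n))) * A"
      using V A T by (intro mult_right_mono) auto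
    also have "\<dots> \<le> pi / 2 * f 0 + hat_integral T (\<lambda>t. neg_logderiv_line t * f t)"
      unfolding A_def f_def by (rule resonator_inequality) fact
    finally show ?thesis .
  qed
  moreover have "\<delta> * (T / 2) \<le> \<delta> * A" using A V by (intro mult_left_mono)
  moreover have "(W + \<delta>) * A = W * A + \<delta> * A" by (rule distrib_right)
  ultimately have "\<delta> * (T / 2) \<le> pi / 2 * f 0 + B * f 0 * (\<tau> + measure lebesgue S)"
    by linarith
  also have "\<dots> = f 0 * (pi / 2 + B * (\<tau> + measure lebesgue S))" by (simp add: distrib_left)
  finally show ?thesis unfolding f_def S_def .
qed

lemma resonator_0_eq_exp:
  "resonator N 0 = exp (\<Sum>p | prime p \<and> p \<le> N. ln (real (N div p)))"
proof -
  have "resonator N 0 = (\<Prod>p\<in>primes_upto N. exp (ln (real (N div p))))"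
    unfolding resonator_0 by (intro prod.cong refl) (auto dest: primes_upto_div_pos)
  also have "\<dots> = exp (\<Sum>p\<in>primes_upto N. ln (real (N div p)))"
    by (simp add: exp_sum)
  finally show ?thesis by (simp add: primes_upto_def)
qed

text \<open>With \<open>N\<close> about \<open>c * ln T * ln (ln T)\<close> and
  \<open>ln N \<ge> ln (ln T)\<close>, the logarithm of the resonator at 0 is at most
  \<open>59 / 50 * c * ln T = a * ln T\<close>, while \<open>ln N\<close> supplies both iterated
  logarithms and \<open>ln c\<close>.\<close>

lemma resonator_length_choice:
  fixes a :: real
  assumes a: "a > 0"
  obtains N :: "real \<Rightarrow> nat" where
    "\<forall>\<^sub>F T in at_top. resonator (N T) 0 \<le> T powr a"
    "\<forall>\<^sub>F T in at_top. (\<Sum>n=1..N T. mangoldt n / real n * (1 - 1 / real (N T div n))) \<ge>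
        ln (ln T) + ln (ln (ln T)) + ln a - ln (59 / 50) - 109 / 50 - 1 / 1000"
proof -
  define c where "c = a / (59 / 50)"
  have c: "c > 0" using a by (simp add: c_def)
  define y where "y = (\<lambda>T::real. c * (ln T * ln (ln T)))"
  define N where "N = (\<lambda>T. nat \<lfloor>y T\<rfloor>)"
  have y_lim: "filterlim y at_top at_top"
    unfolding y_def by (rule filterlim_tendsto_pos_mult_at_top[OF tendsto_const c]) real_asymp
  \<comment> \<open>After rounding down, this leaves \<open>N T \<ge> ln T\<close>, hence
    \<open>ln N \<ge> ln (ln T)\<close>.\<close>
  have y_ge: "\<forall>\<^sub>F T in at_top. y T \<ge> ln T + 1"
  proof -
    have "\<forall>\<^sub>F T in at_top. ln (ln T) \<ge> 2 / c"
      by (rule filterlim_at_top[THEN iffD1, rule_format]) real_asymp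
    moreover have "\<forall>\<^sub>F T::real in at_top. ln T \<ge> 1" by real_asymp
    ultimately show ?thesis
    proof eventually_elim
      case (elim T)
      have "ln T * 2 \<le> ln T * (c * ln (ln T))"
        using elim c by (intro mult_left_mono) (auto simp: field_simps)
      also have "\<dots> = y T" by (simp add: y_def)
      finally show ?case using elim by linarith
    qed
  qed
  have N: "real (N T) \<le> y T" "real (N T) \<ge> y T - 1" if "y T \<ge> 0" for T
    using that unfolding N_def by linarith+
  have N_lim: "filterlim N at_top at_top"
    unfolding N_def by (rule filterlim_compose[OF filterlim_nat_sequentially filterlim_compose[OF filterlim_floor_sequentially y_lim]])
  \<comment> \<open>The bound 2000 makes \<open>N T \<ge> 1000\<close>, so rounding
    \<open>y T\<close> down costs at most 1/1000 in the logarithm.\<close>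
  have lower: "\<forall>\<^sub>F T in at_top. T > 1 \<and> ln T > 1 \<and> ln (ln T) > 0 \<and> y T \<ge> 2000 \<and> y T \<ge> ln T + 1"
    using y_lim[unfolded filterlim_at_top, rule_format, of 2000] y_ge
    by (intro eventually_conj) (assumption | real_asymp)+
  show ?thesis
  proof (rule that[of N])
    show "\<forall>\<^sub>F T in at_top. resonator (N T) 0 \<le> T powr a"
      using lower filterlim_iff[THEN iffD1, rule_format, OF N_lim eventually_sum_primes_ln_div_le]
    proof eventually_elim
      case (elim T)
      have Ny: "real (N T) \<le> y T" "real (N T) \<ge> ln T" using N[of T] elim by auto
      have lnN: "ln (real (N T)) \<ge> ln (ln T)" using Ny elim by (subst ln_le_cancel_iff) auto
      have "59 / 50 * real (N T) / ln (real (N T)) \<le> 59 / 50 * y T / ln (ln T)"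
        using lnN Ny elim by (intro frac_le) auto
      also have "\<dots> = a * ln T" using elim by (simp add: y_def c_def)
      finally have "(\<Sum>p | prime p \<and> p \<le> N T. ln (real (N T div p))) \<le> a * ln T" using elim by linarith
      thus ?case using elim unfolding resonator_0_eq_exp by (auto simp: powr_def)
    qed
    show "\<forall>\<^sub>F T in at_top. (\<Sum>n=1..N T. mangoldt n / real n * (1 - 1 / real (N T div n))) \<ge>
        ln (ln T) + ln (ln (ln T)) + ln a - ln (59 / 50) - 109 / 50 - 1 / 1000"
      using lower filterlim_iff[THEN iffD1, rule_format, OF N_lim eventually_sum_mangoldt_weighted_ge]
    proof eventually_elim
      case (elim T)
      have "ln (y T / (real (N T))) \<le> y T / real (N T) - 1"
        using elim N[of T] by (intro ln_le_minus_one) auto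
      also have "\<dots> = (y T - real (N T)) / real (N T)"
        using elim N[of T] by (simp add: diff_divide_distrib)
      also have "\<dots> \<le> 1 / real (N T)"
        using elim N[of T] by (intro divide_right_mono) auto
      also have "\<dots> \<le> 1 / 1000" using elim N[of T] by (intro divide_left_mono) auto
      finally have "ln (real (N T)) \<ge> ln (y T) - 1 / 1000"
        using elim N[of T] by (simp add: ln_div)
      moreover have "ln (y T) = ln (ln T) + ln (ln (ln T)) + ln a - ln (59 / 50)"
      proof -
        have "ln c = ln a - ln (59 / 50)" unfolding c_def using a by (intro ln_divide_pos) auto
        moreover have "ln (y T) = ln c + (ln (ln T) + ln (ln (ln T)))"
          unfolding y_def using elim c by (simp add: ln_mult_pos)
        ultimately show ?thesis by simp
      qed
      ultimately show ?case using elim by linarith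
    qed
  qed
qed

theorem theorem2:
  fixes \<beta> x :: real
  assumes "0 < \<beta>" and "\<beta> < 1" and "x > 0"
  shows "\<exists>\<epsilon> :: real \<Rightarrow> real. (\<epsilon> \<longlongrightarrow> 0) at_top \<and>
           (\<forall>\<^sub>F T in at_top. large_meas \<beta> T x \<ge> T powr (1 - (1 - \<beta>) * exp (- x) + \<epsilon> T))"
\<comment> \<open>The margin in the numerical constants yields the exponent without any error term,
  so the zero function is the witness.\<close>
proof (intro exI[of _ "\<lambda>_. 0"] conjI tendsto_const)
  define b where "b = (1 - \<beta>) * exp (- x)"
  \<comment> \<open>With \<open>e\<close> below, \<open>a + e = b - 3 * b / 800\<close>. The
    resonator size and the growth of the logarithmic derivative together thus stay a power of
    \<open>T\<close> below \<open>T powr b\<close>.\<close>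
  define a where "a = b * (199 / 200)"
  define e where "e = b / 800"
  have b: "0 < b" "b < 1 - \<beta>" using assms by (auto simp: b_def)
  hence ae: "a > 0" "e > 0" by (auto simp: a_def e_def)
  obtain N :: "real \<Rightarrow> nat" where N:
    "\<forall>\<^sub>F T in at_top. resonator (N T) 0 \<le> T powr a"
    "\<forall>\<^sub>F T in at_top. (\<Sum>n=1..N T. mangoldt n / real n * (1 - 1 / real (N T div n))) \<ge>
        ln (ln T) + ln (ln (ln T)) + ln a - ln (59 / 50) - 109 / 50 - 1 / 1000"
    using resonator_length_choice[OF ae(1)] by blast
  obtain K where K: "K > 0" "\<And>t. t \<ge> 0 \<Longrightarrow> neg_logderiv_line t \<le> K * (1 + t) powr e"
    using neg_logderiv_line_growth[OF ae(2)] by blast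
  define K' where "K' = K * 2 powr e"
  have K': "K' > 0" using K by (simp add: K'_def)
  define W where "W = (\<lambda>T. ln (ln T) + ln (ln (ln T)) + C1 \<beta> - x)"
  have W0: "\<forall>\<^sub>F T in at_top. W T \<ge> 0"
  proof -
    have "filterlim (\<lambda>T::real. ln (ln T) + ln (ln (ln T))) at_top at_top" by real_asymp
    hence "\<forall>\<^sub>F T in at_top. ln (ln T) + ln (ln (ln T)) \<ge> x - C1 \<beta>"
      by (simp add: filterlim_at_top)
    thus ?thesis by eventually_elim (simp add: W_def)
  qed
  \<comment> \<open>The margin 1/50 of \<open>C1_le\<close> pays for the excess 1/100, for the
    rounding loss 1/1000 and for \<open>a\<close> being smaller than \<open>b\<close>, which costs
    at most 1/199.\<close>
  have lna: "C1 \<beta> - x + 1 / 100 \<le> ln a - ln (59 / 50) - 109 / 50 - 1 / 1000"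
  proof -
    have "ln (1 / (199 / 200) :: real) \<le> 1 / (199 / 200) - 1" by (rule ln_le_minus_one) simp
    hence "ln (199 / 200 :: real) \<ge> - 1 / 199" by (simp add: ln_div)
    moreover have "ln a = ln b + ln (199 / 200)" unfolding a_def using b by (intro ln_mult_pos) auto
    moreover have "ln b = ln (1 - \<beta>) - x" unfolding b_def using assms by (simp add: ln_mult_pos)
    ultimately show ?thesis using C1_le[of \<beta>] by simp
  qed
  have small: "\<forall>\<^sub>F T in at_top. (2 + 2 * K') * T powr (- (3 * b / 800)) < 1 / 200"
  proof -
    have "((\<lambda>T. (2 + 2 * K') * T powr (- (3 * b / 800))) \<longlongrightarrow> (2 + 2 * K') * 0) at_top"
      using b by (intro tendsto_mult tendsto_const tendsto_neg_powr filterlim_ident) auto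
    thus ?thesis by (rule order_tendstoD) simp
  qed
  show "\<forall>\<^sub>F T in at_top. large_meas \<beta> T x \<ge> T powr (1 - (1 - \<beta>) * exp (- x) + 0)"
    using N W0 small eventually_ge_at_top[of 1]
  proof eventually_elim
    case (elim T)
    define \<tau> where "\<tau> = T powr \<beta>"
    define B where "B = K' * T powr e"
    define \<mu> where "\<mu> = measure lebesgue {t \<in> {\<tau>..T}. neg_logderiv_line t \<ge> W T}"
    have T: "T \<ge> 1" by fact
    have \<tau>: "0 < \<tau>" "\<tau> \<le> T" using T assms powr_mono[of \<beta> 1 T] by (auto simp: \<tau>_def)
    \<comment> \<open>Since \<open>\<tau> > 0\<close>, the pole stays outside the range and
      \<open>neg_logderiv_line\<close> agrees there with the expression in zeta.\<close>
    have "large_set \<beta> T x = {t \<in> {\<tau>..T}. neg_logderiv_line t \<ge> W T}"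
      unfolding large_set_def \<tau>_def [symmetric] W_def [symmetric] using \<tau>
      by (intro Collect_cong conj_cong refl) (auto simp: neg_logderiv_line_eq Complex_eq W_def)
    hence \<mu>: "large_meas \<beta> T x = \<mu>" by (simp add: large_meas_def \<mu>_def)
    have main: "1 / 100 * (T / 2) \<le> resonator (N T) 0 * (pi / 2 + B * (\<tau> + \<mu>))"
      unfolding \<mu>_def
    proof (rule measure_large_values_ge)
      show "neg_logderiv_line t \<le> B" if t: "0 \<le> t" "t \<le> T" for t
      proof -
        have "neg_logderiv_line t \<le> K * (1 + t) powr e" by (rule K) fact
        also have "\<dots> \<le> K * (2 * T) powr e"
          using t T K ae by (intro mult_left_mono powr_mono2) auto
        also have "\<dots> = B" using T by (simp add: B_def K'_def powr_mult)
        finally show ?thesis .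
      qed
      show "W T + 1 / 100 \<le> (\<Sum>n=1..N T. mangoldt n / real n * (1 - 1 / real (N T div n)))"
        using elim lna unfolding W_def by linarith
    qed (use T \<tau> K' elim in \<open>auto simp: B_def\<close>)
    have "\<mu> \<ge> T powr (1 - b)"
    proof (rule ccontr)
      assume "\<not> \<mu> \<ge> T powr (1 - b)"
      \<comment> \<open>Here \<open>b < 1 - \<beta>\<close> enters, which comes from
        \<open>x > 0\<close>: the initial segment is no longer than the claimed measure.\<close>
      moreover have "\<tau> \<le> T powr (1 - b)" unfolding \<tau>_def using b T by (intro powr_mono) auto
      ultimately have "\<tau> + \<mu> \<le> 2 * T powr (1 - b)" by linarith
      hence "B * (\<tau> + \<mu>) \<le> B * (2 * T powr (1 - b))"
        using K' by (intro mult_left_mono) (auto simp: B_def)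
      moreover have "pi / 2 \<le> 2 * (T powr e * T powr (1 - b))"
      proof -
        have "T powr e * T powr (1 - b) \<ge> 1 * 1"
          using T ae b assms by (intro mult_mono ge_one_powr_ge_zero) auto
        thus ?thesis using pi_less_4 by linarith
      qed
      moreover have "B * (2 * T powr (1 - b)) = 2 * K' * (T powr e * T powr (1 - b))" by (simp add: B_def)
      ultimately have le: "pi / 2 + B * (\<tau> + \<mu>) \<le> (2 + 2 * K') * (T powr e * T powr (1 - b))"
        unfolding distrib_right by linarith
      have "\<tau> \<ge> 0" "\<mu> \<ge> 0" using \<tau> by (simp_all add: \<mu>_def)
      hence "pi / 2 + B * (\<tau> + \<mu>) \<ge> 0"
        using K' pi_gt_zero by (intro add_nonneg_nonneg mult_nonneg_nonneg) (auto simp: B_def)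
      hence "1 / 100 * (T / 2) \<le> T powr a * (pi / 2 + B * (\<tau> + \<mu>))"
        by (intro order.trans[OF main] mult_right_mono elim(1))
      also have "\<dots> \<le> T powr a * ((2 + 2 * K') * (T powr e * T powr (1 - b)))"
        by (intro mult_left_mono le) auto
      also have "\<dots> = (2 + 2 * K') * (T powr (a + (e + (1 - b))))"
        by (simp only: powr_add mult.left_commute)
      \<comment> \<open>The right-hand side is now a constant times
        \<open>T powr (1 - 3 * b / 800)\<close>, which for large \<open>T\<close> is below
        \<open>T / 200\<close>, the value on the left.\<close>
      also have "a + (e + (1 - b)) = - (3 * b / 800) + 1" by (simp add: a_def e_def)
      also have "T powr \<dots> = T powr (- (3 * b / 800)) * T" using T by (subst powr_add) simp
      also have "(2 + 2 * K') * (T powr (- (3 * b / 800)) * T) < 1 / 200 * T"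
        using mult_strict_right_mono[OF elim(4), of T] T by (simp add: mult.assoc)
      finally show False by simp
    qed
    thus ?case by (simp add: \<mu> b_def)
  qed
qed

end
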